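(* There exist constants $\alpha,\sigma>0$ such that, as $N\to\infty$, the values of $\log \mathbf S_N$ are asymptotically distributed according to a Gaussian law with mean $\alpha N$ and variance $\sigma^2N$, in the following sense: for $t\in\mathbb R$ satisfying $t=O(N^{1/6})$ (that is, for every fixed $C>0$, uniformly in $N\ge 1$ and $|t|\le CN^{1/6}$, with an implied constant depending only on $C$), $$\mathbb P_N\Bigl[\frac{\log \mathbf S_N-\alpha N}{\sigma\sqrt N}\le t\Bigr]=\int_{-\infty}^t\frac{e^{-v^2/2}\,dv}{\sqrt{2\pi}}+O\Bigl(\frac{(1+t^2)e^{-t^2/2}}{\sqrt N}\Bigr).$$ Moreover, for the same $\alpha,\sigma$, there exist $(\nu_1,\nu_2)\in\mathbb R^2$ and $\theta\in[0,1)$ such that $$\mathbb E_N[\log \mathbf S_N]=\alpha N+\nu_1+O(\theta^N),\qquad \mathbb V_N[\log \mathbf S_N]=\sigma^2N+\nu_2+O(N\theta^N).$$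
   Context: The Stern sequence $(s(n))_{n\ge0}$ is defined by $s(0)=0$, $s(1)=1$, and $s(2n)=s(n)$, $s(2n+1)=s(n)+s(n+1)$ for all $n\ge1$. For $N\ge0$ let $\mathcal I_N=\mathbb Z\cap[2^N,2^{N+1})$, endowed with the uniform probability measure; $\mathbf S_N$ is the random variable $\mathbf S_N=s(n)$ with $n$ uniformly random in $\mathcal I_N$, and $\mathbb P_N,\mathbb E_N,\mathbb V_N$ denote the corresponding probability, expectation and variance. *)

theory Defs
  imports "HOL-Probability.Probability" "HOL-Library.Landau_Symbols"
begin

function stern :: "nat \<Rightarrow> nat" where
  "stern n = (if n \<le> 1 then n
              else if even n then stern (n div 2)
              else stern (n div 2) + stern (n div 2 + 1))"
  by pat_completeness auto
termination
proof (relation "Wellfounded.measure id")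
  fix n :: nat
  assume "\<not> n \<le> 1" and "odd n"
  then show "(n div 2 + 1, n) \<in> Wellfounded.measure id"
    by (auto elim!: oddE)
qed auto

declare stern.simps [simp del]

lemma stern_0: "stern 0 = 0"
  and stern_1: "stern 1 = 1"
  by (simp_all add: stern.simps)

lemma stern_even: "n \<ge> 1 \<Longrightarrow> stern (2 * n) = stern n"
  by (simp add: stern.simps [of "2 * n"])

lemma stern_odd: "n \<ge> 1 \<Longrightarrow> stern (2 * n + 1) = stern n + stern (n + 1)"
  by (simp add: stern.simps [of "Suc (2 * n)"])

definition dyadic_block :: "nat \<Rightarrow> nat set" where
  "dyadic_block N = {2 ^ N..<2 ^ (N + 1)}"

lemma finite_dyadic_block: "finite (dyadic_block N)"
  and dyadic_block_nonempty: "dyadic_block N \<noteq> {}"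
  by (auto simp: dyadic_block_def)

definition unif_block :: "nat \<Rightarrow> nat pmf" where
  "unif_block N = pmf_of_set (dyadic_block N)"

(* The random variable log S_N, as a function on the sample space of unif_block N.
   The values stern n are positive on every dyadic block, so the convention ln 0 = 0
   plays no role. *)
definition log_stern :: "nat \<Rightarrow> real" where
  "log_stern n = ln (real (stern n))"

end

(* For real x in [0,1] let F_N(z,x) be the average of (x s(n) + (1-x) s(n+1))^z over the block
   [2^N, 2^(N+1)).  Splitting n by parity gives F_(N+1)(z,.) = L_z F_N(z,.) for the transfer operator
     L_z h(x) = ((2-x)^z h(1/(2-x)) + (1+x)^z h(x/(1+x))) / 2,
   and F_N(z,1) is the moment generating function of log S_N.  One branch is parabolic, but on average
   L_0 contracts the Lipschitz seminorm by 5/8.  Hence, for small complex z, the normalised iterates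
   contract too, the ratios M_(N+1)(z)/M_N(z) stay near 1 and converge exponentially fast, and
   Cauchy's inequalities turn this into the asymptotics of mean and variance.  The variance grows
   linearly because x -> E log(x s(n) + (1-x) s(n+1)) is concave and symmetric about 1/2, which bounds the
   gap between the two branches below away from x = 1/2.
   For the distribution function, tilt the law of the standardised variable Y by exp(t Y).  The tilted and
   recentred law is compared with the normal law through the Berry-Esseen smoothing inequality, which
   only needs the characteristic function on a range of order sqrt N; undoing the tilt multiplies the
   error by exp(-t^2/2). *)

theory Submission
  imports Defs "HOL-Complex_Analysis.Complex_Analysis"
begin

section \<open>The transfer operator of the Stern sequence\<close>

text \<open>Appending a binary digit to n acts on the pair (s(n), s(n+1)) by one of two matrices; x
  is the coordinate of a linear form on such pairs, and rescaling its coefficients to sum 1 produces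
  the two Moebius branches. Each branch has a neutral fixed point (1 and 0 respectively), so neither
  contracts uniformly; but where one has slope 1 the other has slope 1/4, whence 5/8 = (1 + 1/4)/2.
  Everything happens for z in one fixed disc about 0. This suffices because z = w / (\<sigma> sqrt
  N), so the disc covers all |w| up to order sqrt N. The tilt uses t itself and not the exact saddle
  point. The tilted law is therefore centred at t only up to O((1 + t^2) / sqrt N), which is where
  the factor 1 + t^2 of the error term arises. The range t = O(N^(1/6)) keeps the cubic correction
  |t|^3 / sqrt N in the exponent bounded. Undoing the tilt costs one more factor |t|, which is
  recovered from the decay of the Gaussian tail: |t| times the Mills ratio is at most 1.\<close>

definition stern_lin :: "real \<Rightarrow> nat \<Rightarrow> real" where
  "stern_lin x n = x * real (stern n) + (1 - x) * real (stern (n + 1))"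

lemma stern_pos: "n \<ge> 1 \<Longrightarrow> stern n > 0"
proof (induction n rule: less_induct)
  case (less n)
  show ?case
  proof (cases "n = 1")
    case False
    then have "stern (n div 2) > 0" using less by auto
    then show ?thesis using less False by (subst stern.simps) auto
  qed (simp add: stern_1[unfolded One_nat_def])
qed

lemma stern_lin_pos:
  assumes "x \<in> {0..1}" "n \<ge> 1"
  shows "stern_lin x n > 0"
proof -
  have p: "real (stern n) > 0" "real (stern (n+1)) > 0" using assms stern_pos by auto
  show ?thesis
  proof (cases "x = 0")
    case False
    then have "x * real (stern n) > 0" using assms p by auto
    moreover have "(1 - x) * real (stern (n + 1)) \<ge> 0" using assms p by auto
    ultimately show ?thesis by (simp add: stern_lin_def)
  qed (use p in \<open>simp add: stern_lin_def\<close>)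
qed

lemma stern_lin_one [simp]: "stern_lin 1 n = real (stern n)"
  by (simp add: stern_lin_def)

text \<open>The pair (s(2n), s(2n+1)) equals (s(n), s(n) + s(n+1)), so the coefficients (x, 1-x)
  become (1, 1-x), of sum 2-x. Dividing by this sum restores the shape of \<open>stern_lin\<close>:
  the divisor is the weight, the new first coefficient the branch of the transfer operator.\<close>

lemma stern_lin_even:
  assumes "x \<in> {0..1}" "n \<ge> 1"
  shows "stern_lin x (2 * n) = (2 - x) * stern_lin (1 / (2 - x)) n"
proof -
  have "stern_lin x (2 * n) = real (stern n) + (1 - x) * real (stern (n + 1))"
    using assms stern_even[of n] stern_odd[of n] by (simp add: stern_lin_def algebra_simps)
  also have "\<dots> = (2 - x) * stern_lin (1 / (2 - x)) n"
    using assms by (simp add: stern_lin_def divide_simps)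
  finally show ?thesis .
qed

lemma stern_lin_odd:
  assumes "x \<in> {0..1}" "n \<ge> 1"
  shows "stern_lin x (2 * n + 1) = (1 + x) * stern_lin (x / (1 + x)) n"
proof -
  have "stern_lin x (2 * n + 1) = x * real (stern n) + real (stern (n + 1))"
    using assms stern_even[of "n+1"] stern_odd[of n] by (simp add: stern_lin_def algebra_simps)
  also have "\<dots> = (1 + x) * stern_lin (x / (1 + x)) n"
    using assms by (simp add: stern_lin_def divide_simps)
  finally show ?thesis .
qed

section \<open>Averages over dyadic blocks and their recursion\<close>

definition block_avg :: "nat \<Rightarrow> (nat \<Rightarrow> 'a) \<Rightarrow> 'a :: real_vector" where
  "block_avg N f = (\<Sum>n\<in>dyadic_block N. f n) /\<^sub>R 2 ^ N"

lemma dyadic_block_ge_1: "n \<in> dyadic_block N \<Longrightarrow> n \<ge> 1"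
  by (auto simp: dyadic_block_def intro: order_trans[of 1 "2^N"])

lemma block_avg_0: "block_avg 0 f = f 1"
  by (simp add: block_avg_def dyadic_block_def numeral_2_eq_2)

lemma dyadic_block_Suc:
  "dyadic_block (Suc N) = (\<lambda>n. 2 * n) ` dyadic_block N \<union> (\<lambda>n. 2 * n + 1) ` dyadic_block N"
proof (intro equalityI subsetI)
  fix m assume "m \<in> dyadic_block (Suc N)"
  then have "m div 2 \<in> dyadic_block N" by (auto simp: dyadic_block_def)
  moreover have "m = 2 * (m div 2) \<or> m = 2 * (m div 2) + 1" by presburger
  ultimately show "m \<in> (\<lambda>n. 2 * n) ` dyadic_block N \<union> (\<lambda>n. 2 * n + 1) ` dyadic_block N"
    by blast
qed (auto simp: dyadic_block_def)

lemma block_avg_Suc: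
  "block_avg (Suc N) f = (block_avg N (\<lambda>n. f (2 * n)) + block_avg N (\<lambda>n. f (2 * n + 1))) /\<^sub>R 2"
proof -
  have "(\<Sum>n\<in>dyadic_block (Suc N). f n) =
     (\<Sum>n\<in>(\<lambda>n. 2 * n) ` dyadic_block N. f n) + (\<Sum>n\<in>(\<lambda>n. 2 * n + 1) ` dyadic_block N. f n)"
    unfolding dyadic_block_Suc
    by (rule sum.union_disjoint) (auto simp: finite_dyadic_block, presburger)
  also have "(\<Sum>n\<in>(\<lambda>n. 2 * n) ` dyadic_block N. f n) = (\<Sum>n\<in>dyadic_block N. f (2 * n))"
    by (subst sum.reindex) (auto intro: inj_onI)
  also have "(\<Sum>n\<in>(\<lambda>n. 2 * n + 1) ` dyadic_block N. f n) = (\<Sum>n\<in>dyadic_block N. f (2 * n + 1))"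
    by (subst sum.reindex) (auto intro: inj_onI)
  finally show ?thesis
    by (simp add: block_avg_def scaleR_add_right)
qed

lemma card_dyadic_block: "card (dyadic_block N) = 2 ^ N"
  by (simp add: dyadic_block_def)

lemma block_avg_add: "block_avg N (\<lambda>n. f n + g n) = block_avg N f + block_avg N g"
  by (simp add: block_avg_def sum.distrib scaleR_add_right)

lemma block_avg_cmult: "block_avg N (\<lambda>n. c * f n) = (c :: 'a :: real_algebra) * block_avg N f"
  by (simp add: block_avg_def sum_distrib_left[symmetric])

lemma block_avg_const: "block_avg N (\<lambda>_. c) = c"
  by (simp add: block_avg_def card_dyadic_block flip: of_nat_power scaleR_conv_of_real)
     (simp add: scaleR_left.sum[symmetric] sum_constant_scaleR card_dyadic_block)

lemma block_avg_cong: "(\<And>n. n \<ge> 1 \<Longrightarrow> f n = g n) \<Longrightarrow> block_avg N f = block_avg N g"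
  unfolding block_avg_def by (intro arg_cong2[where f = scaleR] sum.cong refl) (auto dest: dyadic_block_ge_1)

lemma block_avg_mono:
  "(\<And>n. n \<ge> 1 \<Longrightarrow> f n \<le> (g n :: real)) \<Longrightarrow> block_avg N f \<le> block_avg N g"
  unfolding block_avg_def by (intro scaleR_left_mono sum_mono) (auto dest: dyadic_block_ge_1)

text \<open>Complex powers are written exp (z * ln ...): for x in [0,1] the base is a positive real,
  so this is a single-valued entire function of z.\<close>

definition stern_mgf :: "nat \<Rightarrow> complex \<Rightarrow> real \<Rightarrow> complex" where
  "stern_mgf N z x = block_avg N (\<lambda>n. exp (z * of_real (ln (stern_lin x n))))"

definition transfer :: "complex \<Rightarrow> (real \<Rightarrow> complex) \<Rightarrow> real \<Rightarrow> complex" where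
  "transfer z h x = (exp (z * of_real (ln (2 - x))) * h (1 / (2 - x)) +
                     exp (z * of_real (ln (1 + x))) * h (x / (1 + x))) / 2"

lemma stern_mgf_0: "x \<in> {0..1} \<Longrightarrow> stern_mgf 0 z x = 1"
  using stern_even[of 1] by (simp add: stern_mgf_def block_avg_0 stern_lin_def numeral_2_eq_2 stern_1[unfolded One_nat_def])

lemma stern_mgf_Suc:
  assumes "x \<in> {0..1}"
  shows "stern_mgf (Suc N) z x = transfer z (stern_mgf N z) x"
proof -
  have x1: "1 / (2 - x) \<in> {0..1}" "x / (1 + x) \<in> {0..1}" using assms by (auto simp: field_simps)
  have "block_avg N (\<lambda>n. exp (z * of_real (ln (stern_lin x (2 * n))))) =
        block_avg N (\<lambda>n. exp (z * of_real (ln (2 - x))) * exp (z * of_real (ln (stern_lin (1 / (2 - x)) n))))"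
    using assms less_imp_neq[OF stern_lin_pos[OF x1(1)]]
    by (intro block_avg_cong) (simp add: stern_lin_even ln_mult exp_add[symmetric] distrib_left)
  moreover have "block_avg N (\<lambda>n. exp (z * of_real (ln (stern_lin x (2 * n + 1))))) =
        block_avg N (\<lambda>n. exp (z * of_real (ln (1 + x))) * exp (z * of_real (ln (stern_lin (x / (1 + x)) n))))"
    using assms less_imp_neq[OF stern_lin_pos[OF x1(2)]]
    by (intro block_avg_cong) (simp add: stern_lin_odd[unfolded Suc_eq_plus1[symmetric]] ln_mult exp_add[symmetric] distrib_left)
  ultimately show ?thesis
    unfolding stern_mgf_def block_avg_Suc transfer_def
    by (simp add: block_avg_cmult scaleR_conv_of_real)
qed

section \<open>Contraction of the normalised operator for small complex z\<close>

lemma norm_exp_minus_1_bound: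
  fixes w :: "'a :: {real_normed_field, banach}"
  shows "norm (exp w - 1) \<le> norm w * exp (norm w)"
proof -
  have "norm (exp w - exp 0) \<le> exp (norm w) * norm (w - 0)"
  proof (rule field_differentiable_bound[of "cball 0 (norm w)" exp exp])
    fix u :: 'a assume "u \<in> cball 0 (norm w)"
    then have "exp (norm u) \<le> exp (norm w)" by simp
    then show "norm (exp u) \<le> exp (norm w)" by (rule order_trans[OF norm_exp])
  qed (auto intro: DERIV_subset[OF DERIV_exp])
  then show ?thesis by (simp add: mult.commute)
qed

lemma norm_exp_minus_1_le:
  assumes "norm (w :: complex) \<le> 1 / 2"
  shows "norm (exp w - 1) \<le> 2 * norm w"
proof -
  have "exp (norm w) \<le> exp (1 / 2)" using assms by simp
  also have "\<dots> \<le> 2" using exp_bound_half[of "1 / 2 :: real"] by auto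
  finally have "norm w * exp (norm w) \<le> norm w * 2" by (intro mult_left_mono) auto
  then show ?thesis using norm_exp_minus_1_bound[of w] by simp
qed

text \<open>Since ln u lies in [0,1] for u in [1,2], the radius 1/4000 makes the weights deviate
  from 1 by at most 2/4000, and likewise makes them 1/1000-Lipschitz in u. The operator is thereby a
  perturbation of size 1/1000 of the one at z = 0.\<close>

lemma exp_log_weight:
  fixes z :: complex and u v :: real
  assumes "norm z \<le> 1 / 4000" "u \<in> {1..2}" "v \<in> {1..2}"
  shows "norm (exp (z * of_real (ln u)) - 1) \<le> 1 / 1000"
    and "norm (exp (z * of_real (ln u))) \<le> 1001 / 1000"
    and "norm (exp (z * of_real (ln u)) - exp (z * of_real (ln v))) \<le> \<bar>u - v\<bar> / 1000"
proof -
  have l: "0 \<le> ln w" "ln w \<le> 1" if "w \<in> {1..2}" for w :: real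
    using that ln_le_minus_one[of w] by auto
  have 1: "norm (exp (z * of_real (ln u)) - 1) \<le> 1 / 1000"
    if "u \<in> {1..2}" for u :: real
  proof -
    have n: "norm (z * complex_of_real (ln u)) \<le> 1 / 4000 * 1"
      unfolding norm_mult by (rule mult_mono) (use assms(1) l[OF that] in auto)
    then have "norm (exp (z * of_real (ln u)) - 1) \<le> 2 * norm (z * of_real (ln u))"
      by (intro norm_exp_minus_1_le) auto
    then show ?thesis using n by simp
  qed
  show "norm (exp (z * of_real (ln u)) - 1) \<le> 1 / 1000" by (rule 1) fact
  have 2: "norm (exp (z * of_real (ln u))) \<le> 1001 / 1000" if "u \<in> {1..2}" for u :: real
    using norm_triangle_ineq[of "exp (z * of_real (ln u)) - 1" 1] 1[OF that] by simp
  show "norm (exp (z * of_real (ln u))) \<le> 1001 / 1000" by (rule 2) fact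
  have lip: "\<bar>ln u - ln v\<bar> \<le> \<bar>u - v\<bar>"
  proof -
    have "ln u - ln v \<le> \<bar>u - v\<bar>" if "u \<in> {1..2}" "v \<in> {1..2}" for u v :: real
    proof -
      have "ln u - ln v = ln (u / v)" using that by (simp add: ln_div)
      also have "\<dots> \<le> u / v - 1" using that by (intro ln_le_minus_one) auto
      also have "\<dots> = (u - v) / v" using that by (simp add: field_simps)
      also have "\<dots> \<le> \<bar>u - v\<bar> / v" using that by (intro divide_right_mono) auto
      also have "\<dots> \<le> \<bar>u - v\<bar> / 1" using that by (intro divide_left_mono) auto
      finally show ?thesis by simp
    qed
    from this[of u v] this[of v u] assms show ?thesis by auto
  qed
  have "\<bar>u - v\<bar> \<le> 1" using assms by auto
  have n: "norm (z * complex_of_real (ln u - ln v)) \<le> 1 / 4000 * \<bar>u - v\<bar>"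
    unfolding norm_mult by (rule mult_mono) (use assms(1) lip in \<open>auto simp flip: of_real_diff\<close>)
  have "exp (z * of_real (ln u)) - exp (z * of_real (ln v)) =
     exp (z * of_real (ln v)) * (exp (z * of_real (ln u - ln v)) - 1)"
    by (simp add: algebra_simps exp_diff)
  also have "norm \<dots> \<le> 1001 / 1000 * (2 * (1 / 4000 * \<bar>u - v\<bar>))"
    unfolding norm_mult
    by (intro mult_mono 2 order_trans[OF norm_exp_minus_1_le])
       (use n assms \<open>\<bar>u - v\<bar> \<le> 1\<close> in auto)
  also have "\<dots> \<le> \<bar>u - v\<bar> / 1000" by simp
  finally show "norm (exp (z * of_real (ln u)) - exp (z * of_real (ln v))) \<le> \<bar>u - v\<bar> / 1000" .
qed

text \<open>The two terms are the difference quotients of the branches 1/(2-x) and x/(1+x), so half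
  of the sum is the average contraction. The value 5/4 = 1 + 1/4 occurs at x = y = 0 and x = y = 1,
  where one branch is neutral. The inequality of means reduces the claim to the diagonal x =
  y.\<close>

lemma inverse_product_bound:
  fixes x y :: real
  assumes "x \<in> {0..1}" "y \<in> {0..1}"
  shows "1 / ((2 - x) * (2 - y)) + 1 / ((1 + x) * (1 + y)) \<le> 5 / 4"
proof -
  have amgm: "1 / (a * b) \<le> (1 / a\<^sup>2 + 1 / b\<^sup>2) / 2" for a b :: real
    using sum_squares_bound[of "1/a" "1/b"] by (simp add: power_divide)
  have one: "1 / (2 - x)\<^sup>2 + 1 / (1 + x)\<^sup>2 \<le> 5 / 4" if "x \<in> {0..1}" for x :: real
  proof -
    \<comment> \<open>As (2-x) + (1+x) = 3, the sum of the two squares is 9 - 2q, and q >= 2 on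
      [0,1] with equality at the ends.\<close>
    define q where "q = (2 - x) * (1 + x)"
    have "x * (1 - x) \<ge> 0" using that by auto
    then have q: "q \<ge> 2" by (simp add: q_def algebra_simps)
    have "1 / (2 - x)\<^sup>2 + 1 / (1 + x)\<^sup>2 = (9 - 2 * q) / q\<^sup>2"
      using that by (simp add: q_def divide_simps power2_eq_square) (simp add: algebra_simps)
    also have "\<dots> \<le> 5 / 4"
    proof -
      have "4 * (9 - 2 * q) \<le> 5 * q\<^sup>2"
        using q mult_mono[OF q q] by (simp add: power2_eq_square)
      then show ?thesis using q by (simp add: field_simps)
    qed
    finally show ?thesis .
  qed
  have "1 / ((2 - x) * (2 - y)) + 1 / ((1 + x) * (1 + y)) \<le>
     (1 / (2 - x)\<^sup>2 + 1 / (2 - y)\<^sup>2) / 2 + (1 / (1 + x)\<^sup>2 + 1 / (1 + y)\<^sup>2) / 2"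
    by (intro add_mono amgm)
  also have "\<dots> \<le> 5 / 4" using one[OF assms(1)] one[OF assms(2)] by argo
  finally show ?thesis .
qed

text \<open>An inequality of Lasota-Yorke type: the branches contribute 1001/1000 * 5/8 < 626/1000
  times the seminorm, the variation of the weights 1/1000 times the supremum.\<close>

lemma transfer_lipschitz:
  assumes z: "norm z \<le> 1 / 4000" and h: "L-lipschitz_on {0..1} h"
    and m: "\<And>x. x \<in> {0..1} \<Longrightarrow> norm (h x) \<le> m"
  shows "(626 / 1000 * L + m / 1000)-lipschitz_on {0..1} (transfer z h)"
proof (rule lipschitz_onI)
  have L: "L \<ge> 0" by (rule lipschitz_on_nonneg[OF h])
  have m0: "m \<ge> 0" using order_trans[OF norm_ge_zero m[of 0]] by auto
  then show "0 \<le> 626 / 1000 * L + m / 1000" using L by auto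
  fix x y :: real assume x: "x \<in> {0..1}" and y: "y \<in> {0..1}"
  define d where "d = \<bar>x - y\<bar>"
  have x1: "1 / (2 - x) \<in> {0..1}" "x / (1 + x) \<in> {0..1}" using x by (auto simp: field_simps)
  have y1: "1 / (2 - y) \<in> {0..1}" "y / (1 + y) \<in> {0..1}" using y by (auto simp: field_simps)
  let ?w = "\<lambda>u. exp (z * of_real (ln u)) :: complex"
  have gen: "norm (?w a * h a' - ?w b * h b') \<le> 1001 / 1000 * (L * \<bar>a' - b'\<bar>) + d / 1000 * m"
    if "a \<in> {1..2}" "b \<in> {1..2}" "a' \<in> {0..1}" "b' \<in> {0..1}" "\<bar>a - b\<bar> = d" for a b a' b'
  proof -
    have "?w a * h a' - ?w b * h b' = ?w a * (h a' - h b') + (?w a - ?w b) * h b'"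
      by (simp add: algebra_simps)
    also have "norm \<dots> \<le> norm (?w a * (h a' - h b')) + norm ((?w a - ?w b) * h b')"
      by (rule norm_triangle_ineq)
    also have "\<dots> \<le> 1001 / 1000 * (L * \<bar>a' - b'\<bar>) + d / 1000 * m"
      unfolding norm_mult
      by (intro add_mono mult_mono m order_trans[OF exp_log_weight(2)[OF z]] order_trans[OF exp_log_weight(3)[OF z]])
         (use that lipschitz_on_normD[OF h, of a' b'] in \<open>auto simp: d_def\<close>)
    finally show ?thesis .
  qed
  have A: "\<bar>1 / (2 - x) - 1 / (2 - y)\<bar> = d * (1 / ((2 - x) * (2 - y)))"
  proof -
    have "1 / (2 - x) - 1 / (2 - y) = (x - y) / ((2 - x) * (2 - y))" using x y by (simp add: field_simps)
    then show ?thesis using x y by (simp add: d_def abs_mult)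
  qed
  have B: "\<bar>x / (1 + x) - y / (1 + y)\<bar> = d * (1 / ((1 + x) * (1 + y)))"
  proof -
    have "x / (1 + x) - y / (1 + y) = (x - y) / ((1 + x) * (1 + y))" using x y by (simp add: field_simps)
    then show ?thesis using x y by (simp add: d_def abs_mult)
  qed
  have "transfer z h x - transfer z h y =
     ((?w (2 - x) * h (1 / (2 - x)) - ?w (2 - y) * h (1 / (2 - y))) +
     (?w (1 + x) * h (x / (1 + x)) - ?w (1 + y) * h (y / (1 + y)))) / 2"
    by (simp add: transfer_def diff_divide_distrib add_divide_distrib)
  also have "norm \<dots> = norm ((?w (2 - x) * h (1 / (2 - x)) - ?w (2 - y) * h (1 / (2 - y))) +
     (?w (1 + x) * h (x / (1 + x)) - ?w (1 + y) * h (y / (1 + y)))) / 2"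
    by (simp add: norm_divide)
  also have "\<dots> \<le> ((1001 / 1000 * (L * \<bar>1 / (2 - x) - 1 / (2 - y)\<bar>) + d / 1000 * m) +
      (1001 / 1000 * (L * \<bar>x / (1 + x) - y / (1 + y)\<bar>) + d / 1000 * m)) / 2"
    by (intro divide_right_mono order_trans[OF norm_triangle_ineq] add_mono gen)
       (use x y x1 y1 in \<open>auto simp: d_def\<close>)
  also have "\<dots> = 1001 / 2000 * (L * d * (1 / ((2 - x) * (2 - y)) + 1 / ((1 + x) * (1 + y)))) + d / 1000 * m"
    unfolding A B by (simp only: distrib_left distrib_right add_divide_distrib) simp
  also have "\<dots> \<le> 1001 / 2000 * (L * d * (5 / 4)) + d / 1000 * m"
    by (intro add_mono mult_left_mono inverse_product_bound x y) (use L in \<open>auto simp: d_def\<close>)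
  also have "\<dots> \<le> (626 / 1000 * L + m / 1000) * d"
    using mult_nonneg_nonneg[OF L, of d] by (simp add: algebra_simps d_def)
  finally show "dist (transfer z h x) (transfer z h y) \<le> (626 / 1000 * L + m / 1000) * dist x y"
    by (simp add: dist_norm d_def)
qed

text \<open>Once the value at 1 is prescribed, the Lipschitz constant controls the supremum on
  [0,1]; this lets the seminorm act as a norm on differences of normalised functions.\<close>

lemma lipschitz_unit_bound:
  assumes "L-lipschitz_on {0..1} h" "x \<in> {0..1::real}"
  shows "norm (h x - h 1 :: complex) \<le> L"
proof -
  have "norm (h x - h 1) \<le> L * norm (x - 1)"
    using assms by (intro lipschitz_on_normD) auto
  also have "\<dots> \<le> L * 1"
    using assms lipschitz_on_nonneg[OF assms(1)] by (intro mult_left_mono) auto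
  finally show ?thesis by simp
qed

lemma transfer_at_1: "transfer z h 1 = (h 1 + exp (z * of_real (ln 2)) * h (1 / 2)) / 2"
  by (simp add: transfer_def)

lemma half_sum: "(1 + a) / 2 - 1 = (a - 1 :: complex) / 2"
  by (simp add: field_simps)

text \<open>The functions with value 1 at 1 and Lipschitz constant 1/20 form an invariant set:
  626/1000 * 1/20 + 21/20 * 1/1000 is below 1/25, and division by a normaliser of modulus at least
  19/20 keeps the constant below 1/20.\<close>

lemma transfer_normalised:
  assumes z: "norm z \<le> 1 / 4000" and h: "(1 / 20)-lipschitz_on {0..1} h" and h1: "h 1 = 1"
  shows "norm (transfer z h 1 - 1) \<le> 1 / 20"
    and "norm (transfer z h 1) \<ge> 19 / 20"
    and "(1 / 25)-lipschitz_on {0..1} (transfer z h)"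
    and "(1 / 20)-lipschitz_on {0..1} (\<lambda>x. transfer z h x / transfer z h 1)"
proof -
  let ?w = "exp (z * of_real (ln 2)) :: complex"
  have bound: "norm (h x) \<le> 21 / 20" if "x \<in> {0..1}" for x
    using lipschitz_unit_bound[OF h that] norm_triangle_ineq[of "h x - 1" 1] h1 by simp
  have "?w * h (1 / 2) - 1 = (?w - 1) * h (1 / 2) + (h (1 / 2) - h 1)"
    by (simp add: h1 algebra_simps)
  also have "norm \<dots> \<le> norm ((?w - 1) * h (1 / 2)) + norm (h (1 / 2) - h 1)"
    by (rule norm_triangle_ineq)
  also have "\<dots> \<le> 1 / 1000 * (21 / 20) + 1 / 20"
    unfolding norm_mult
    by (intro add_mono mult_mono bound lipschitz_unit_bound[OF h] exp_log_weight(1)[OF z, of 2 1]) auto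
  finally have w: "norm (?w * h (1 / 2) - 1) \<le> 1 / 1000 * (21 / 20) + 1 / 20" .
  have "transfer z h 1 - 1 = (?w * h (1 / 2) - 1) / 2"
    unfolding transfer_at_1 h1 by (rule half_sum)
  then have "norm (transfer z h 1 - 1) = norm (?w * h (1 / 2) - 1) / 2"
    by (simp only: norm_divide) simp
  then show *: "norm (transfer z h 1 - 1) \<le> 1 / 20" using w by simp
  then show **: "norm (transfer z h 1) \<ge> 19 / 20"
    using norm_triangle_ineq2[of 1 "1 - transfer z h 1"] by (simp add: norm_minus_commute)
  show ***: "(1 / 25)-lipschitz_on {0..1} (transfer z h)"
    by (rule lipschitz_on_le[OF transfer_lipschitz[OF z h bound]]) auto
  show "(1 / 20)-lipschitz_on {0..1} (\<lambda>x. transfer z h x / transfer z h 1)"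
  proof (rule lipschitz_onI)
    fix x y :: real assume xy: "x \<in> {0..1}" "y \<in> {0..1}"
    have "norm (transfer z h x - transfer z h y) / norm (transfer z h 1) \<le> (1 / 25 * norm (x - y)) / (19 / 20)"
      using lipschitz_on_normD[OF *** xy] ** by (intro frac_le) auto
    also have "\<dots> \<le> 1 / 20 * norm (x - y)" by simp
    finally show "dist (transfer z h x / transfer z h 1) (transfer z h y / transfer z h 1) \<le> 1 / 20 * dist x y"
      by (simp add: dist_norm norm_divide flip: diff_divide_distrib)
  qed simp
qed

lemma transfer_diff: "transfer z (\<lambda>x. h x - g x) x = transfer z h x - transfer z g x"
  by (simp add: transfer_def field_simps)

lemma transfer_cmult: "transfer z (\<lambda>x. h x / c) x = transfer z h x / c"
  by (simp add: transfer_def add_divide_distrib mult.commute)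

text \<open>Normalisation makes the operator nonlinear. This identity splits an increment of the
  difference of two quotients into a linear part and an effect of unequal normalisers; the latter
  carries c - d, an increment of one function, and so is small as well.\<close>

lemma quotient_difference:
  fixes a b c d e f :: "'a :: field"
  assumes "e \<noteq> 0" "f \<noteq> 0"
  shows "(a / e - c / f) - (b / e - d / f) = ((a - c) - (b - d)) / e - (c - d) * (e - f) / (e * f)"
  using assms by (simp add: field_simps)

lemma quotient_difference_bound:
  fixes p q k e f :: complex
  assumes p: "norm p \<le> 627 / 1000 * (L * d)" and q: "norm q \<le> 1 / 25 * d"
    and k: "norm k \<le> 1001 / 2000 * L" and e: "norm e \<ge> 19 / 20" and f: "norm f \<ge> 19 / 20"
    and L: "L \<ge> 0" and d: "d \<ge> 0"
  shows "norm (p / e - q * k / (e * f)) \<le> 3 / 4 * (L * d)"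
proof -
  have Ld: "L * d \<ge> 0" using L d by simp
  have "norm (p / e - q * k / (e * f)) \<le> norm p / norm e + norm q * norm k / (norm e * norm f)"
    by (metis norm_triangle_ineq4 norm_divide norm_mult)
  also have "norm p / norm e \<le> (627 / 1000 * (L * d)) / (19 / 20)"
    using Ld by (intro frac_le p e) simp_all
  also have "norm q * norm k / (norm e * norm f) \<le> ((1 / 25 * d) * (1001 / 2000 * L)) / (19 / 20 * (19 / 20))"
    using L d by (intro frac_le mult_mono p q k e f) simp_all
  finally show ?thesis using Ld by (simp add: algebra_simps)
qed

text \<open>The difference h - g vanishes at 1, so its seminorm L bounds both its values and the
  change of the normaliser. The linear part contributes 627/1000 divided by 19/20, the change of
  normaliser less than 1/40; the total stays below 3/4.\<close>

lemma transfer_normalised_contraction: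
  assumes z: "norm z \<le> 1 / 4000"
    and h: "(1 / 20)-lipschitz_on {0..1} h" "h 1 = 1"
    and g: "(1 / 20)-lipschitz_on {0..1} g" "g 1 = 1"
    and hg: "L-lipschitz_on {0..1} (\<lambda>x. h x - g x)"
  shows "norm (transfer z h 1 - transfer z g 1) \<le> L"
    and "(3 / 4 * L)-lipschitz_on {0..1} (\<lambda>x. transfer z h x / transfer z h 1 - transfer z g x / transfer z g 1)"
proof -
  let ?k = "\<lambda>x. h x - g x"
  let ?H = "transfer z h" and ?G = "transfer z g" and ?K = "transfer z ?k"
  have L: "L \<ge> 0" by (rule lipschitz_on_nonneg[OF hg])
  have k: "norm (?k x) \<le> L" if "x \<in> {0..1}" for x
    using lipschitz_unit_bound[OF hg that] h g by simp
  have "?K 1 = exp (z * of_real (ln 2)) * ?k (1 / 2) / 2"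
    by (simp add: transfer_at_1 h g)
  also have "norm \<dots> \<le> (1001 / 1000) * L / 2"
    unfolding norm_mult norm_divide
    using exp_log_weight(2)[OF z, of 2 1] k[of "1/2"]
    by (intro divide_mono mult_mono) auto
  finally have K1: "norm (?K 1) \<le> 1001 / 2000 * L" by simp
  show "norm (?H 1 - ?G 1) \<le> L"
    using K1 L unfolding transfer_diff by linarith
  have "(626 / 1000 * L + L / 1000)-lipschitz_on {0..1} ?K"
    by (rule transfer_lipschitz[OF z hg k])
  then have Klip: "(627 / 1000 * L)-lipschitz_on {0..1} ?K" by (rule lipschitz_on_le) simp
  note H = transfer_normalised[OF z h] and G = transfer_normalised[OF z g]
  have nz: "?H 1 \<noteq> 0" "?G 1 \<noteq> 0" using H(2) G(2) by auto
  show "(3 / 4 * L)-lipschitz_on {0..1} (\<lambda>x. ?H x / ?H 1 - ?G x / ?G 1)"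
  proof (rule lipschitz_onI)
    fix x y :: real assume xy: "x \<in> {0..1}" "y \<in> {0..1}"
    have "(?H x / ?H 1 - ?G x / ?G 1) - (?H y / ?H 1 - ?G y / ?G 1) =
        (?K x - ?K y) / ?H 1 - (?G x - ?G y) * ?K 1 / (?H 1 * ?G 1)"
      unfolding transfer_diff by (rule quotient_difference[OF nz])
    also have "norm \<dots> \<le> 3 / 4 * (L * norm (x - y))"
      using lipschitz_on_normD[OF Klip xy] L
      by (intro quotient_difference_bound lipschitz_on_normD[OF G(3) xy] K1 H(2) G(2))
         (simp_all only: mult.assoc norm_ge_zero)
    finally show "dist (?H x / ?H 1 - ?G x / ?G 1) (?H y / ?H 1 - ?G y / ?G 1) \<le> 3 / 4 * L * dist x y"
      by (simp add: dist_norm)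
  qed (use L in simp)
qed

section \<open>Ratios of consecutive moment generating functions\<close>

definition stern_ratio :: "nat \<Rightarrow> complex \<Rightarrow> complex" where
  "stern_ratio N z = stern_mgf (Suc N) z 1 / stern_mgf N z 1"

text \<open>Here \<open>normal\<close> means normalised to the value 1 at x = 1; it does not refer
  to the Gaussian law.\<close>

definition normal_mgf :: "nat \<Rightarrow> complex \<Rightarrow> real \<Rightarrow> complex" where
  "normal_mgf N z x = stern_mgf N z x / stern_mgf N z 1"

lemma normal_mgf_Suc:
  assumes "stern_mgf N z 1 \<noteq> 0" "x \<in> {0..1}"
  shows "normal_mgf (Suc N) z x = transfer z (normal_mgf N z) x / transfer z (normal_mgf N z) 1"
  using assms unfolding normal_mgf_def
  by (simp add: stern_mgf_Suc transfer_cmult)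

text \<open>Nonvanishing of \<open>stern_mgf\<close> cannot be separated from regularity: the
  quotient of stage N+1 by stage N is the transfer of the normalised function at 1, which has
  modulus at least 19/20 because that function lies in the invariant set. So all three claims go
  through one induction.\<close>

lemma normal_mgf_bounds:
  assumes z: "norm z \<le> 1 / 4000"
  shows "stern_mgf N z 1 \<noteq> 0" "normal_mgf N z 1 = 1" "(1 / 20)-lipschitz_on {0..1} (normal_mgf N z)"
proof (induction N)
  case 0
  { case 1 show ?case by (simp add: stern_mgf_0)
  next case 2 show ?case by (simp add: normal_mgf_def stern_mgf_0)
  next case 3 show ?case by (rule lipschitz_onI) (auto simp: normal_mgf_def stern_mgf_0)
  }
next
  case (Suc N)
  note T = transfer_normalised[OF z Suc(3,2)]
  have eq: "transfer z (normal_mgf N z) 1 = stern_mgf (Suc N) z 1 / stern_mgf N z 1"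
    unfolding normal_mgf_def by (simp add: transfer_cmult stern_mgf_Suc)
  { case 1 show ?case using T(2) unfolding eq by auto
  next case 2 show ?case using T(2) unfolding eq by (auto simp: normal_mgf_def)
  next case 3 show ?case using T(4)
      by (rule lipschitz_on_transform) (use normal_mgf_Suc Suc(1) in auto)
  }
qed

text \<open>Stage 0 is the constant 1, so the first difference inherits the constant 1/20 of stage
  1; each further stage applies the contraction once.\<close>

lemma normal_mgf_diff:
  assumes z: "norm z \<le> 1 / 4000"
  shows "(1 / 20 * (3 / 4) ^ N)-lipschitz_on {0..1} (\<lambda>x. normal_mgf (Suc N) z x - normal_mgf N z x)"
proof (induction N)
  case 0
  have "(1 / 20)-lipschitz_on {0..1} (normal_mgf (Suc 0) z)" by (rule normal_mgf_bounds(3)[OF z])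
  then show ?case by (auto simp: lipschitz_on_def normal_mgf_def stern_mgf_0 dist_norm)
next
  case (Suc N)
  show ?case
  proof (rule lipschitz_on_transform)
    show "(1 / 20 * (3 / 4) ^ Suc N)-lipschitz_on {0..1}
      (\<lambda>x. transfer z (normal_mgf (Suc N) z) x / transfer z (normal_mgf (Suc N) z) 1 -
           transfer z (normal_mgf N z) x / transfer z (normal_mgf N z) 1)"
      using transfer_normalised_contraction(2)[OF z normal_mgf_bounds(3,2)[OF z] normal_mgf_bounds(3,2)[OF z] Suc]
      by (rule lipschitz_on_le) simp
  next
    fix x :: real assume "x \<in> {0..1}"
    then show "normal_mgf (Suc (Suc N)) z x - normal_mgf (Suc N) z x =
      transfer z (normal_mgf (Suc N) z) x / transfer z (normal_mgf (Suc N) z) 1 -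
           transfer z (normal_mgf N z) x / transfer z (normal_mgf N z) 1"
      by (simp only: normal_mgf_Suc[OF normal_mgf_bounds(1)[OF z]])
  qed
qed

lemma stern_ratio_eq: "stern_ratio N z = transfer z (normal_mgf N z) 1"
  unfolding normal_mgf_def by (simp add: transfer_cmult stern_mgf_Suc stern_ratio_def)

lemma stern_ratio_near_1: "norm z \<le> 1 / 4000 \<Longrightarrow> norm (stern_ratio N z - 1) \<le> 1 / 20"
  unfolding stern_ratio_eq by (intro transfer_normalised normal_mgf_bounds)

lemma stern_ratio_diff:
  assumes z: "norm z \<le> 1 / 4000"
  shows "norm (stern_ratio (Suc N) z - stern_ratio N z) \<le> (3 / 4) ^ N"
proof -
  have "norm (stern_ratio (Suc N) z - stern_ratio N z) \<le> 1 / 20 * (3 / 4) ^ N"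
    unfolding stern_ratio_eq
    by (intro transfer_normalised_contraction(1)[OF z] normal_mgf_bounds normal_mgf_diff z)
  then show ?thesis by (rule order_trans) simp
qed

lemma stern_mgf_holomorphic [holomorphic_intros]: "(\<lambda>z. stern_mgf N z x) holomorphic_on A"
  unfolding stern_mgf_def block_avg_def scaleR_conv_of_real by (intro holomorphic_intros)

lemma stern_ratio_holomorphic: "stern_ratio N holomorphic_on ball 0 (1 / 4000)"
  unfolding stern_ratio_def using normal_mgf_bounds(1)
  by (intro holomorphic_intros) auto

lemma stern_mgf_prod:
  assumes "norm z \<le> 1 / 4000"
  shows "stern_mgf N z 1 = (\<Prod>k<N. stern_ratio k z)"
  by (induction N) (simp_all add: stern_mgf_0 stern_ratio_def normal_mgf_bounds[OF assms])

section \<open>Cumulant generating functions\<close>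

text \<open>Two summations of geometric tails: the increments of a determine its limit l with error
  O(q^N), then the series of a k - l converges to v with error O(q^N). This is the origin of the
  shape linear term, constant, exponentially small error.\<close>

lemma geometric_increments_sum:
  fixes a :: "nat \<Rightarrow> real"
  assumes a: "\<And>k. \<bar>a (Suc k) - a k\<bar> \<le> C * q ^ k" and q: "0 \<le> q" "q < 1"
  obtains l v D where "\<And>N. \<bar>(\<Sum>k<N. a k) - (l * real N + v)\<bar> \<le> D * q ^ N"
proof -
  have tail: "\<bar>suminf f - (\<Sum>k<n. f k)\<bar> \<le> E / (1 - q) * q ^ n" and "summable f"
    if f: "\<And>k. \<bar>f k\<bar> \<le> E * q ^ k" for f :: "nat \<Rightarrow> real" and E n
  proof -
    have gs: "summable (\<lambda>k. E * q ^ k)" using q by (intro summable_mult summable_geometric) auto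
    then show sf: "summable f"
      by (rule summable_comparison_test') (use f in auto)
    have "suminf f - (\<Sum>k<n. f k) = (\<Sum>k. f (k + n))"
      using suminf_split_initial_segment[OF sf, of n] by simp
    also have "\<bar>\<dots>\<bar> \<le> (\<Sum>k. E * q ^ n * q ^ k)"
    proof (rule order_trans[OF summable_rabs suminf_le])
      have g2: "summable (\<lambda>k. E * q ^ n * q ^ k)" using q by (intro summable_mult summable_geometric) auto
      then show "summable (\<lambda>k. E * q ^ n * q ^ k)" .
      have *: "\<bar>f (k + n)\<bar> \<le> E * q ^ n * q ^ k" for k using f[of "k + n"] by (simp add: power_add mult_ac)
      show "summable (\<lambda>k. \<bar>f (k + n)\<bar>)"
        by (rule summable_comparison_test'[OF g2]) (use * in auto)
      then show "summable (\<lambda>k. \<bar>f (k + n)\<bar>)" .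
      show "\<bar>f (k + n)\<bar> \<le> E * q ^ n * q ^ k" for k by (rule *)
    qed
    also have "\<dots> = E / (1 - q) * q ^ n"
      using q by (subst suminf_mult) (auto simp: suminf_geometric summable_geometric)
    finally show "\<bar>suminf f - (\<Sum>k<n. f k)\<bar> \<le> E / (1 - q) * q ^ n" .
  qed
  define l where "l = a 0 + suminf (\<lambda>k. a (Suc k) - a k)"
  have al: "\<bar>a n - l\<bar> \<le> C / (1 - q) * q ^ n" for n
  proof -
    have "(\<Sum>k<n. a (Suc k) - a k) = a n - a 0" by (rule sum_lessThan_telescope)
    then show ?thesis using tail(1)[OF a, of n] by (simp add: l_def abs_minus_commute)
  qed
  define v where "v = suminf (\<lambda>k. a k - l)"
  show ?thesis
  proof (rule that[of l v "C / (1 - q) / (1 - q)"])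
    fix N
    have "(\<Sum>k<N. a k) - (l * real N + v) = (\<Sum>k<N. a k - l) - v"
      by (simp add: sum_subtractf)
    then show "\<bar>(\<Sum>k<N. a k) - (l * real N + v)\<bar> \<le> C / (1 - q) / (1 - q) * q ^ N"
      using tail(1)[OF al, of N] by (simp add: v_def abs_minus_commute)
  qed
qed

definition log_ratio :: "nat \<Rightarrow> complex \<Rightarrow> complex" where
  "log_ratio k z = Ln (stern_ratio k z)"

lemma Ln_lipschitz_near_1:
  assumes "norm (w - 1) \<le> 1 / 20" "norm (w' - 1) \<le> 1 / 20"
  shows "norm (Ln w - Ln w') \<le> 2 * norm (w - w')"
proof (rule field_differentiable_bound[of "cball 1 (1/20)" Ln "\<lambda>z. inverse z"])
  fix z :: complex assume z: "z \<in> cball 1 (1/20)"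
  have "norm z \<ge> 19 / 20" using z norm_triangle_ineq2[of 1 "1 - z"] by (simp add: dist_norm)
  then have "inverse (norm z) \<le> inverse (19 / 20)" by (intro le_imp_inverse_le) auto
  then show "norm (inverse z) \<le> 2" by (simp add: norm_inverse)
  have "\<bar>Re z - 1\<bar> \<le> 1 / 20" using z abs_Re_le_cmod[of "1 - z"] by (simp add: dist_norm abs_minus_commute)
  then have "z \<notin> \<real>\<^sub>\<le>\<^sub>0" by (auto simp: complex_nonpos_Reals_iff)
  then show "(Ln has_field_derivative inverse z) (at z within cball 1 (1/20))"
    by (rule DERIV_subset[OF has_field_derivative_Ln]) auto
qed (use assms in \<open>auto simp: dist_norm norm_minus_commute\<close>)

lemma stern_ratio_nonpos:
  assumes "norm z \<le> 1 / 4000"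
  shows "stern_ratio k z \<notin> \<real>\<^sub>\<le>\<^sub>0" 
proof -
  have "\<bar>Re (stern_ratio k z) - 1\<bar> \<le> 1 / 20"
    using stern_ratio_near_1[OF assms, of k] abs_Re_le_cmod[of "stern_ratio k z - 1"] by simp
  then show ?thesis by (auto simp: complex_nonpos_Reals_iff)
qed

lemma stern_ratio_nonzero: "norm z \<le> 1 / 4000 \<Longrightarrow> stern_ratio k z \<noteq> 0"
  using stern_ratio_nonpos[of z k] by auto

lemma log_ratio_holomorphic: "log_ratio k holomorphic_on ball 0 (1 / 4000)"
  unfolding log_ratio_def
  by (intro holomorphic_intros stern_ratio_holomorphic stern_ratio_nonpos) auto

lemma log_ratio_bound: "norm z \<le> 1 / 4000 \<Longrightarrow> norm (log_ratio k z) \<le> 1"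
  using Ln_lipschitz_near_1[OF stern_ratio_near_1[of z k], of 1] stern_ratio_near_1[of z k]
  unfolding log_ratio_def Ln_1 by simp

lemma log_ratio_diff: "norm z \<le> 1 / 4000 \<Longrightarrow> norm (log_ratio (Suc k) z - log_ratio k z) \<le> 2 * (3 / 4) ^ k"
  unfolding log_ratio_def
  by (rule order_trans[OF Ln_lipschitz_near_1[OF stern_ratio_near_1 stern_ratio_near_1]])
     (use stern_ratio_diff[of z k] in auto)

text \<open>A logarithm of M_N is assembled from principal logarithms of the ratios, each within
  1/20 of 1. Applying \<open>Ln\<close> to M_N itself could meet the branch cut, since its argument
  may grow with N.\<close>

definition cumulant_gf :: "nat \<Rightarrow> complex \<Rightarrow> complex" where
  "cumulant_gf N z = (\<Sum>k<N. log_ratio k z)"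

lemma cumulant_gf_holomorphic: "cumulant_gf N holomorphic_on ball 0 (1 / 4000)"
  unfolding cumulant_gf_def by (intro holomorphic_on_sum log_ratio_holomorphic)

lemma cumulant_gf_bound: "norm z \<le> 1 / 4000 \<Longrightarrow> norm (cumulant_gf N z) \<le> real N"
  unfolding cumulant_gf_def
  by (rule order_trans[OF norm_sum]) (use sum_mono[of "{..<N}" "\<lambda>k. norm (log_ratio k z)" "\<lambda>_. 1"] log_ratio_bound in simp)

lemma stern_mgf_log_stern: "stern_mgf N z 1 = block_avg N (\<lambda>n. exp (z * of_real (log_stern n)))"
  by (simp add: stern_mgf_def log_stern_def)

lemma exp_cumulant_gf:
  assumes "norm z \<le> 1 / 4000"
  shows "exp (cumulant_gf N z) = block_avg N (\<lambda>n. exp (z * of_real (log_stern n)))"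
proof -
  have "exp (cumulant_gf N z) = (\<Prod>k<N. stern_ratio k z)"
    unfolding cumulant_gf_def exp_sum[OF finite_lessThan] log_ratio_def
    by (intro prod.cong refl exp_Ln) (rule stern_ratio_nonzero[OF assms])
  then show ?thesis by (simp add: stern_mgf_prod[OF assms, symmetric] stern_mgf_log_stern)
qed

section \<open>Mean and variance as derivatives at the origin\<close>

lemma block_avg_of_real: "block_avg N (\<lambda>n. of_real (f n)) = (of_real (block_avg N f) :: complex)"
  by (simp add: block_avg_def scaleR_conv_of_real)

lemma cumulant_gf_0: "cumulant_gf N 0 = 0"
proof -
  have "stern_ratio k 0 = 1" for k
    by (simp add: stern_ratio_def stern_mgf_log_stern block_avg_const)
  then show ?thesis by (simp add: cumulant_gf_def log_ratio_def)
qed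

text \<open>The weight g allows iteration: each differentiation replaces g by f times g.\<close>

lemma block_mgf_derivative:
  "((\<lambda>z. block_avg N (\<lambda>n. of_real (g n) * exp (z * of_real (f n)))) has_field_derivative
     block_avg N (\<lambda>n. of_real (f n * g n) * exp (z * of_real (f n) :: complex))) (at z)"
proof -
  have "((\<lambda>z. of_real (g n) * exp (z * of_real (f n))) has_field_derivative
      of_real (f n * g n) * exp (z * of_real (f n) :: complex)) (at z)" for n
    by (rule DERIV_cong[OF DERIV_cmult[OF DERIV_fun_exp[OF DERIV_cmult_right[OF DERIV_ident]]]]) simp
  then show ?thesis
    unfolding block_avg_def scaleR_conv_of_real by (intro DERIV_cmult DERIV_sum) simp
qed

lemma funpow_2: "(f ^^ 2) x = f (f x)"
  by (simp add: numeral_2_eq_2)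

lemma cumulant_gf_derivs_0:
  shows "deriv (cumulant_gf N) 0 = of_real (block_avg N log_stern)"
    and "(deriv ^^ 2) (cumulant_gf N) 0 = of_real (block_avg N (\<lambda>n. (log_stern n)\<^sup>2) - (block_avg N log_stern)\<^sup>2)"
proof -
  let ?B = "ball 0 (1 / 4000) :: complex set"
  \<comment> \<open>\<open>M j\<close> is the j-th derivative of the moment generating function;
    differentiating exp K = \<open>M 0\<close> gives K' = \<open>M 1\<close> / \<open>M 0\<close>,
    and the quotient rule at 0 gives the variance.\<close>
  define M where "M j z = block_avg N (\<lambda>n. of_real (log_stern n ^ j) * exp (z * of_real (log_stern n) :: complex))" for j z
  have M': "(M j has_field_derivative M (Suc j) z) (at z)" for j z
    unfolding M_def using block_mgf_derivative[of N "\<lambda>n. log_stern n ^ j" log_stern z] by simp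
  have M0: "exp (cumulant_gf N z) = M 0 z" if "z \<in> ?B" for z
    using exp_cumulant_gf[of z N] that by (simp add: M_def)
  have K: "deriv (cumulant_gf N) z = M 1 z / M 0 z" if z: "z \<in> ?B" for z
  proof -
    have "(cumulant_gf N has_field_derivative deriv (cumulant_gf N) z) (at z)"
      using holomorphic_derivI[OF cumulant_gf_holomorphic open_ball z] .
    then have "((\<lambda>z. exp (cumulant_gf N z)) has_field_derivative exp (cumulant_gf N z) * deriv (cumulant_gf N) z) (at z)"
      by (rule DERIV_fun_exp)
    then have "(M 0 has_field_derivative exp (cumulant_gf N z) * deriv (cumulant_gf N) z) (at z)"
      by (rule has_field_derivative_transform_within_open[OF _ open_ball z M0])
    then have "M 0 z * deriv (cumulant_gf N) z = M 1 z"
      using DERIV_unique M'[of 0 z] M0[OF z] by fastforce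
    moreover have "M 0 z \<noteq> 0" using M0[OF z] by (metis exp_not_eq_zero)
    ultimately show ?thesis by (simp add: field_simps)
  qed
  have z0: "M 0 0 = 1" "M 1 0 = of_real (block_avg N log_stern)" "M 2 0 = of_real (block_avg N (\<lambda>n. (log_stern n)\<^sup>2))"
    unfolding M_def by (simp_all only: mult_zero_left exp_zero mult_1_right block_avg_of_real power_0 power_one_right block_avg_const of_real_1)
  show "deriv (cumulant_gf N) 0 = of_real (block_avg N log_stern)"
    using K[of 0] z0 by simp
  have "((\<lambda>z. M 1 z / M 0 z) has_field_derivative (M 2 0 * M 0 0 - M 1 0 * M 1 0) / (M 0 0 * M 0 0)) (at 0)"
    using M'[of 1 0] M'[of 0 0] z0 by (intro DERIV_divide) (auto simp: numeral_2_eq_2)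
  then have "(deriv (cumulant_gf N) has_field_derivative (M 2 0 * M 0 0 - M 1 0 * M 1 0) / (M 0 0 * M 0 0)) (at 0)"
    by (rule has_field_derivative_transform_within_open[OF _ open_ball, of _ _ _ 0 "1/4000"]) (auto simp: K)
  then have "deriv (deriv (cumulant_gf N)) 0 = (M 2 0 * M 0 0 - M 1 0 * M 1 0) / (M 0 0 * M 0 0)"
    by (rule DERIV_imp_deriv)
  then show "(deriv ^^ 2) (cumulant_gf N) 0 = of_real (block_avg N (\<lambda>n. (log_stern n)\<^sup>2) - (block_avg N log_stern)\<^sup>2)"
    unfolding z0 funpow_2 by (simp add: power2_eq_square)
qed

text \<open>Consecutive \<open>log_ratio\<close> functions differ by O((3/4)^k) on the whole disc,
  and Cauchy's inequality on the circle of radius 1/8000 passes this rate to the derivatives at 0 of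
  every order. Mean and variance therefore share the base 3/4.\<close>

lemma cumulant_expansion:
  obtains l v D where "\<And>N. \<bar>Re ((deriv ^^ j) (cumulant_gf N) 0) - (l * real N + v)\<bar> \<le> D * (3 / 4) ^ N"
proof -
  let ?r = "1 / 8000 :: real"
  define a where "a k = Re ((deriv ^^ j) (log_ratio k) 0)" for k
  have hol: "log_ratio k holomorphic_on ball 0 (1 / 4000)" for k by (rule log_ratio_holomorphic)
  have "\<bar>a (Suc k) - a k\<bar> \<le> (fact j * 2 / ?r ^ j) * (3 / 4) ^ k" for k
  proof -
    have "a (Suc k) - a k = Re ((deriv ^^ j) (\<lambda>z. log_ratio (Suc k) z - log_ratio k z) 0)"
      unfolding a_def by (subst higher_deriv_diff[OF hol hol open_ball]) auto
    also have "\<bar>\<dots>\<bar> \<le> norm ((deriv ^^ j) (\<lambda>z. log_ratio (Suc k) z - log_ratio k z) 0)"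
      by (rule abs_Re_le_cmod)
    also have "\<dots> \<le> fact j * (2 * (3 / 4) ^ k) / ?r ^ j"
    proof (rule Cauchy_inequality)
      have sub: "cball 0 ?r \<subseteq> ball (0::complex) (1 / 4000)" by auto
      then show "continuous_on (cball 0 ?r) (\<lambda>z. log_ratio (Suc k) z - log_ratio k z)"
        by (intro continuous_intros holomorphic_on_imp_continuous_on holomorphic_on_subset[OF hol])
      show "(\<lambda>z. log_ratio (Suc k) z - log_ratio k z) holomorphic_on ball 0 ?r"
        by (intro holomorphic_intros holomorphic_on_subset[OF hol]) auto
    qed (auto intro: log_ratio_diff)
    finally show ?thesis by (simp add: mult_ac)
  qed
  then obtain l v D where *: "\<And>N. \<bar>(\<Sum>k<N. a k) - (l * real N + v)\<bar> \<le> D * (3 / 4) ^ N"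
    by (rule geometric_increments_sum) auto
  have "Re ((deriv ^^ j) (cumulant_gf N) 0) = (\<Sum>k<N. a k)" for N
  proof (induction N)
    case (Suc N)
    have "(deriv ^^ j) (\<lambda>z. cumulant_gf N z + log_ratio N z) 0 =
        (deriv ^^ j) (cumulant_gf N) 0 + (deriv ^^ j) (log_ratio N) 0"
      by (rule higher_deriv_add[OF cumulant_gf_holomorphic hol open_ball]) auto
    with Suc show ?case by (simp add: cumulant_gf_def[abs_def] a_def)
  qed (simp add: cumulant_gf_def[abs_def] higher_deriv_const)
  with * show ?thesis by (intro that) auto
qed

text \<open>The third derivative is O(N) uniformly: discs of radius 1/16000 about points of modulus
  at most 1/8000 stay inside the disc of radius 1/4000, where the cumulant function is at most N.
  The expansion is that of the derivative, because later estimates concern the derivative of the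
  error exponent.\<close>

lemma cumulant_gf_Taylor:
  obtains C where "C \<ge> 0" and "\<And>N u. norm u \<le> 1 / 8000 \<Longrightarrow>
    norm (deriv (cumulant_gf N) u - deriv (cumulant_gf N) 0 - (deriv ^^ 2) (cumulant_gf N) 0 * u) \<le> C * real N * (norm u)\<^sup>2"
proof
  let ?C = "fact 3 / (1 / 16000) ^ 3 :: real"
  show "?C \<ge> 0" by simp
  fix N :: nat and u :: complex
  assume u: "norm u \<le> 1 / 8000"
  let ?f = "\<lambda>i. (deriv ^^ (Suc i)) (cumulant_gf N)"
  have "norm (?f 0 u - (\<Sum>i\<le>1. ?f i 0 * (u - 0) ^ i / fact i)) \<le> ?C * real N * norm (u - 0) ^ Suc 1 / fact 1"
  proof (rule complex_Taylor[of "cball 0 (1 / 8000)"])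
    fix i x assume x: "x \<in> cball (0::complex) (1 / 8000)"
    have "((deriv ^^ Suc i) (cumulant_gf N)) holomorphic_on ball 0 (1 / 4000)"
      by (rule holomorphic_higher_deriv[OF cumulant_gf_holomorphic]) auto
    then have "(?f i has_field_derivative deriv (?f i) x) (at x)"
      by (rule holomorphic_derivI) (use x in auto)
    then show "(?f i has_field_derivative ?f (Suc i) x) (at x within cball 0 (1 / 8000))"
      by (auto intro: DERIV_subset)
  next
    fix x assume x: "x \<in> cball (0::complex) (1 / 8000)"
    have sub: "cball x (1 / 16000) \<subseteq> ball (0::complex) (1 / 4000)"
    proof
      fix y assume "y \<in> cball x (1 / 16000)"
      then show "y \<in> ball (0::complex) (1 / 4000)"
        using x norm_triangle_ineq2[of y x] by (simp add: dist_norm norm_minus_commute)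
    qed
    have "norm ((deriv ^^ 3) (cumulant_gf N) x) \<le> fact 3 * real N / (1 / 16000) ^ 3"
    proof (rule Cauchy_inequality)
      show "cumulant_gf N holomorphic_on ball x (1 / 16000)"
        using sub by (intro holomorphic_on_subset[OF cumulant_gf_holomorphic]) auto
      show "continuous_on (cball x (1 / 16000)) (cumulant_gf N)"
        using sub by (intro holomorphic_on_imp_continuous_on holomorphic_on_subset[OF cumulant_gf_holomorphic])
      fix y assume "norm (x - y) = 1 / 16000"
      then have "y \<in> cball x (1 / 16000)" by (simp add: dist_norm)
      with sub have "y \<in> ball 0 (1 / 4000)" by blast
      then show "norm (cumulant_gf N y) \<le> real N" by (intro cumulant_gf_bound) auto
    qed simp
    then show "norm (?f (Suc 1) x) \<le> ?C * real N" by (simp add: eval_nat_numeral)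
  qed (use u in auto)
  then show "norm (deriv (cumulant_gf N) u - deriv (cumulant_gf N) 0 - (deriv ^^ 2) (cumulant_gf N) 0 * u) \<le> ?C * real N * (norm u)\<^sup>2"
    by (simp add: eval_nat_numeral diff_diff_eq del: fact_Suc)
qed

section \<open>Positivity of the constants\<close>

definition log_mean :: "nat \<Rightarrow> real \<Rightarrow> real" where
  "log_mean N x = block_avg N (\<lambda>n. ln (stern_lin x n))"

definition log_var :: "nat \<Rightarrow> real \<Rightarrow> real" where
  "log_var N x = block_avg N (\<lambda>n. (ln (stern_lin x n))\<^sup>2) - (log_mean N x)\<^sup>2"

lemma log_mean_0: "x \<in> {0..1} \<Longrightarrow> log_mean 0 x = 0"
  using stern_even[of 1] by (simp add: log_mean_def block_avg_0 stern_lin_def numeral_2_eq_2 stern_1[unfolded One_nat_def])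

lemma branch_mem:
  assumes "x \<in> {0..1::real}"
  shows "1 / (2 - x) \<in> {0..1}" "x / (1 + x) \<in> {0..1}"
  using assms by (auto simp: field_simps)

lemma ln_stern_lin_even:
  assumes "x \<in> {0..1}" "n \<ge> 1"
  shows "ln (stern_lin x (2 * n)) = ln (2 - x) + ln (stern_lin (1 / (2 - x)) n)"
  using assms stern_lin_pos[OF branch_mem(1)[OF assms(1)] assms(2)]
  by (simp add: stern_lin_even ln_mult)

lemma ln_stern_lin_odd:
  assumes "x \<in> {0..1}" "n \<ge> 1"
  shows "ln (stern_lin x (2 * n + 1)) = ln (1 + x) + ln (stern_lin (x / (1 + x)) n)"
  using assms stern_lin_pos[OF branch_mem(2)[OF assms(1)] assms(2)]
  unfolding stern_lin_odd[OF assms] by (simp add: ln_mult)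

lemma block_avg_branch:
  assumes "x \<in> {0..1}"
  shows "block_avg (Suc N) (\<lambda>n. f (ln (stern_lin x n)) :: real) =
    (block_avg N (\<lambda>n. f (ln (2 - x) + ln (stern_lin (1 / (2 - x)) n))) +
     block_avg N (\<lambda>n. f (ln (1 + x) + ln (stern_lin (x / (1 + x)) n)))) / 2"
proof -
  have "block_avg N (\<lambda>n. f (ln (stern_lin x (2 * n)))) = block_avg N (\<lambda>n. f (ln (2 - x) + ln (stern_lin (1 / (2 - x)) n)))"
    by (intro block_avg_cong) (simp only: ln_stern_lin_even[OF assms])
  moreover have "block_avg N (\<lambda>n. f (ln (stern_lin x (2 * n + 1)))) = block_avg N (\<lambda>n. f (ln (1 + x) + ln (stern_lin (x / (1 + x)) n)))"
    by (intro block_avg_cong) (simp only: ln_stern_lin_odd[OF assms])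
  ultimately show ?thesis unfolding block_avg_Suc by simp
qed

lemma log_mean_Suc:
  assumes "x \<in> {0..1}"
  shows "log_mean (Suc N) x = (ln (2 - x) + log_mean N (1 / (2 - x)) + (ln (1 + x) + log_mean N (x / (1 + x)))) / 2"
  unfolding log_mean_def block_avg_branch[OF assms, where f = "\<lambda>u. u"] block_avg_add block_avg_const ..

text \<open>The two logarithmic weights sum to the logarithm of (2 - x)(1 + x), which is at least 2
  on [0,1]; each recursion step therefore adds ln 2 / 2.\<close>

lemma log_mean_ge:
  assumes "x \<in> {0..1}"
  shows "log_mean N x \<ge> real N * (ln 2 / 2)"
  using assms
proof (induction N arbitrary: x)
  case (Suc N)
  have "2 \<le> (2 - x) * (1 + x)" using mult_nonneg_nonneg[of x "1 - x"] Suc.prems by (simp add: algebra_simps)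
  then have "ln 2 \<le> ln ((2 - x) * (1 + x))" by (subst ln_le_cancel_iff) auto
  also have "\<dots> = ln (2 - x) + ln (1 + x)" using Suc.prems by (simp add: ln_mult)
  finally show ?case
    using Suc.IH[OF branch_mem(1)[OF Suc.prems]] Suc.IH[OF branch_mem(2)[OF Suc.prems]]
    by (simp add: log_mean_Suc[OF Suc.prems] field_simps)
qed (simp add: log_mean_0)

text \<open>The reflection of x to 1 - x exchanges the two branches and the two weights, so the
  recursion preserves the symmetry.\<close>

lemma log_mean_reflect:
  assumes "x \<in> {0..1}"
  shows "log_mean N (1 - x) = log_mean N x"
  using assms
proof (induction N arbitrary: x)
  case (Suc N)
  have "1 / (2 - (1 - x)) = 1 - x / (1 + x)" "(1 - x) / (1 + (1 - x)) = 1 - 1 / (2 - x)"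
    using Suc.prems by (auto simp: field_simps)
  then show ?case
    using Suc.IH[OF branch_mem(1)[OF Suc.prems]] Suc.IH[OF branch_mem(2)[OF Suc.prems]] Suc.prems
    by (simp add: log_mean_Suc)
qed (simp add: log_mean_0)

lemma log_mean_concave:
  assumes "x \<in> {0..1}" "y \<in> {0..1}" "t \<in> {0..1}"
  shows "(1 - t) * log_mean N x + t * log_mean N y \<le> log_mean N ((1 - t) * x + t * y)"
proof -
  have "(1 - t) * log_mean N x + t * log_mean N y =
     block_avg N (\<lambda>n. (1 - t) * ln (stern_lin x n) + t * ln (stern_lin y n))"
    by (simp add: log_mean_def block_avg_add block_avg_cmult)
  also have "\<dots> \<le> block_avg N (\<lambda>n. ln (stern_lin ((1 - t) * x + t * y) n))"
  proof (rule block_avg_mono)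
    fix n :: nat assume n: "n \<ge> 1"
    have "(1 - t) * ln (stern_lin x n) + t * ln (stern_lin y n) \<le> ln ((1 - t) * stern_lin x n + t * stern_lin y n)"
      using concave_onD[OF ln_concave, of t "stern_lin x n" "stern_lin y n"] assms stern_lin_pos[OF _ n]
      by auto
    also have "(1 - t) * stern_lin x n + t * stern_lin y n = stern_lin ((1 - t) * x + t * y) n"
      by (simp add: stern_lin_def algebra_simps)
    finally show "(1 - t) * ln (stern_lin x n) + t * ln (stern_lin y n) \<le> ln (stern_lin ((1 - t) * x + t * y) n)" .
  qed
  finally show ?thesis by (simp add: log_mean_def)
qed

lemma log_mean_between:
  assumes x: "x \<in> {1 / 2..1}" and y: "1 - x \<le> y" "y \<le> x"
  shows "log_mean N x \<le> log_mean N y"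
proof (cases "x = 1 / 2")
  case False
  \<comment> \<open>y is written as a convex combination of 1 - x and x, where
    \<open>log_mean\<close> takes equal values by reflection; x = 1/2 is set apart because the
    denominator vanishes there.\<close>
  define t where "t = (y - (1 - x)) / (2 * x - 1)"
  have t: "t \<in> {0..1}" using assms False by (auto simp: t_def field_simps)
  have "t * (2 * x - 1) = y - (1 - x)" using False by (simp add: t_def)
  then have "(1 - t) * (1 - x) + t * x = y" by (simp add: algebra_simps)
  with log_mean_concave[of "1 - x" x t N] t x log_mean_reflect[of x N]
  show ?thesis by (auto simp: algebra_simps)
next
  case True
  then have "y = x" using y by simp
  then show ?thesis by simp
qed

text \<open>The law of total variance, conditioning on the last binary digit: the mean of two
  conditional variances plus the variance of a two-valued conditional mean.\<close>

lemma log_var_Suc: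
  assumes "x \<in> {0..1}"
  shows "log_var (Suc N) x = (log_var N (1 / (2 - x)) + log_var N (x / (1 + x))) / 2 +
     (ln (2 - x) + log_mean N (1 / (2 - x)) - (ln (1 + x) + log_mean N (x / (1 + x))))\<^sup>2 / 4"
proof -
  have *: "block_avg N (\<lambda>n. (c + ln (stern_lin y n))\<^sup>2) = log_var N y + (c + log_mean N y)\<^sup>2" for c y
  proof -
    have "block_avg N (\<lambda>n. (c + ln (stern_lin y n))\<^sup>2) =
      block_avg N (\<lambda>n. c\<^sup>2 + (2 * c * ln (stern_lin y n) + (ln (stern_lin y n))\<^sup>2))"
      by (simp add: power2_sum algebra_simps)
    also have "\<dots> = c\<^sup>2 + (2 * c * log_mean N y + (log_var N y + (log_mean N y)\<^sup>2))"
      unfolding block_avg_add block_avg_cmult block_avg_const by (simp add: log_mean_def log_var_def)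
    finally show ?thesis by (simp add: power2_sum algebra_simps)
  qed
  define a where "a = ln (2 - x) + log_mean N (1 / (2 - x))"
  define b where "b = ln (1 + x) + log_mean N (x / (1 + x))"
  have "log_var (Suc N) x = (log_var N (1 / (2 - x)) + a\<^sup>2 + (log_var N (x / (1 + x)) + b\<^sup>2)) / 2 - ((a + b) / 2)\<^sup>2"
    unfolding log_var_def[of "Suc N"] block_avg_branch[OF assms, where f = "\<lambda>u. u\<^sup>2"] * log_mean_Suc[OF assms] a_def b_def ..
  also have "\<dots> = (log_var N (1 / (2 - x)) + log_var N (x / (1 + x))) / 2 + (a - b)\<^sup>2 / 4"
    by (simp add: power2_eq_square field_simps)
  finally show ?thesis unfolding a_def b_def .
qed

text \<open>Both sources of the gap have the same sign for x >= 1/2: the weight 1 + x dominates 2 -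
  x, and x/(1+x) lies between 1/(2-x) and its reflection, so concavity favours the same branch. No
  cancellation occurs, and the weights alone give a lower bound.\<close>

lemma branch_gap:
  assumes x: "x \<in> {1 / 2..1}"
  shows "ln ((1 + x) / (2 - x)) \<le> ln (1 + x) + log_mean N (x / (1 + x)) - (ln (2 - x) + log_mean N (1 / (2 - x)))"
proof -
  have "log_mean N (1 / (2 - x)) \<le> log_mean N (x / (1 + x))"
  proof (rule log_mean_between)
    show "1 - 1 / (2 - x) \<le> x / (1 + x)" using x by (simp add: divide_simps) (simp add: algebra_simps)
    have "x \<le> 1 + x * x" using x zero_le_square[of x] by (simp add: add_increasing2)
    then show "x / (1 + x) \<le> 1 / (2 - x)"
      using x by (simp add: divide_simps) (simp add: algebra_simps)
  qed (use x in \<open>auto simp: field_simps\<close>)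
  then show ?thesis using x by (simp add: ln_div)
qed

text \<open>At x = 2/3 the quotient (1 + x)/(2 - x) equals 5/4, and it increases with x; the lower
  third follows by reflection, which changes the sign of the gap.\<close>

lemma branch_gap_sq:
  assumes x: "x \<in> {2 / 3..1} \<or> x \<in> {0..1 / 3}"
  shows "(ln (5 / 4))\<^sup>2 \<le> (ln (2 - x) + log_mean N (1 / (2 - x)) - (ln (1 + x) + log_mean N (x / (1 + x))))\<^sup>2"
proof -
  let ?D = "\<lambda>x. ln (2 - x) + log_mean N (1 / (2 - x)) - (ln (1 + x) + log_mean N (x / (1 + x)))"
  have main: "(ln (5 / 4))\<^sup>2 \<le> (?D x)\<^sup>2" if x: "x \<in> {2 / 3..1}" for x
  proof -
    have "ln (5 / 4) \<le> ln ((1 + x) / (2 - x))" using x by (subst ln_le_cancel_iff) (auto simp: field_simps)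
    also have "\<dots> \<le> - ?D x" using branch_gap[of x N] x by auto
    finally have "(ln (5 / 4))\<^sup>2 \<le> (- ?D x)\<^sup>2" by (intro power_mono) auto
    then show ?thesis by (simp only: power2_minus)
  qed
  from x show ?thesis
  proof
    assume x: "x \<in> {0..1 / 3}"
    have "1 / (2 - (1 - x)) = 1 - x / (1 + x)" "(1 - x) / (1 + (1 - x)) = 1 - 1 / (2 - x)"
      using x by (auto simp: field_simps)
    then have "?D (1 - x) = - ?D x"
      using log_mean_reflect[OF branch_mem(1)[of x]] log_mean_reflect[OF branch_mem(2)[of x]] x by simp
    then show ?thesis using main[of "1 - x"] x by (simp only: power2_minus) auto
  qed (rule main)
qed

lemma halves_bound: "b \<le> u \<Longrightarrow> b \<le> v \<Longrightarrow> c \<le> d \<Longrightarrow> b + c / 4 \<le> (u + v) / 2 + d / (4 :: real)"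
  by argo

text \<open>The gap vanishes at x = 1/2, so a single step gains nothing uniformly. But one of the
  two images of any x lies in an outer third, where the next step gains a quarter of (ln (5/4))^2;
  averaged with the other image this is an eighth per two steps.\<close>

lemma log_var_ge:
  assumes "x \<in> {0..1}"
  shows "log_var (2 * k) x \<ge> real k * ((ln (5 / 4))\<^sup>2 / 8)"
  using assms
proof (induction k arbitrary: x)
  case 0
  then show ?case
    using stern_even[of 1] by (simp add: log_var_def log_mean_0 block_avg_0)
next
  case (Suc k)
  let ?c = "(ln (5 / 4))\<^sup>2 :: real" and ?b = "real k * ((ln (5 / 4))\<^sup>2 / 8)"
  have one: "log_var (Suc (2 * k)) y \<ge> ?b" if y: "y \<in> {0..1}" for y
    using Suc.IH[OF branch_mem(1)[OF y]] Suc.IH[OF branch_mem(2)[OF y]]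
      halves_bound[of ?b _ _ 0] zero_le_power2
    unfolding log_var_Suc[OF y] by simp
  have two: "log_var (Suc (2 * k)) y \<ge> ?b + ?c / 4" if y: "y \<in> {2 / 3..1} \<or> y \<in> {0..1 / 3}" for y
  proof -
    have y': "y \<in> {0..1}" using y by auto
    show ?thesis
      using Suc.IH[OF branch_mem(1)[OF y']] Suc.IH[OF branch_mem(2)[OF y']] branch_gap_sq[OF y, of "2 * k"]
      unfolding log_var_Suc[OF y'] by (rule halves_bound)
  qed
  have "log_var (Suc (Suc (2 * k))) x \<ge> (log_var (Suc (2 * k)) (1 / (2 - x)) + log_var (Suc (2 * k)) (x / (1 + x))) / 2"
    unfolding log_var_Suc[OF Suc.prems] by simp
  moreover have "log_var (Suc (2 * k)) (1 / (2 - x)) + log_var (Suc (2 * k)) (x / (1 + x)) \<ge> ?b + (?b + ?c / 4)"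
  proof (cases "x \<le> 1 / 2")
    case True
    then have "x / (1 + x) \<in> {0..1 / 3}" using Suc.prems by (auto simp: field_simps)
    then show ?thesis using one[OF branch_mem(1)[OF Suc.prems]] two[of "x / (1 + x)"] by linarith
  next
    case False
    then have "1 / (2 - x) \<in> {2 / 3..1}" using Suc.prems by (auto simp: field_simps)
    then show ?thesis using one[OF branch_mem(2)[OF Suc.prems]] two[of "1 / (2 - x)"] by linarith
  qed
  ultimately show ?case by (simp add: field_simps)
qed

text \<open>A slope at most 0 would keep the right side bounded above while the left side grows. The
  factor m admits lower bounds known only along multiples: m = 1 for the mean, m = 2 for the
  variance.\<close>

lemma linear_growth_rate_pos:
  fixes a c l :: real
  assumes le: "\<And>k. c * real k \<le> l * real (m * k) + a" and c: "c > 0"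
  shows "l > 0"
proof (rule ccontr)
  assume "\<not> l > 0"
  obtain k where k: "real k * c > a" using reals_Archimedean3[OF c] by blast
  have "l * real (m * k) \<le> 0" using \<open>\<not> l > 0\<close> by (intro mult_nonpos_nonneg) auto
  then show False using le[of k] k by (simp add: mult.commute)
qed

lemma stern_log_moments:
  obtains l s v w D E where "l > 0" "s > 0"
    "\<And>N. \<bar>block_avg N log_stern - (l * real N + v)\<bar> \<le> D * (3 / 4) ^ N"
    "\<And>N. \<bar>block_avg N (\<lambda>n. (log_stern n)\<^sup>2) - (block_avg N log_stern)\<^sup>2 - (s * real N + w)\<bar> \<le> E * (3 / 4) ^ N"
proof -
  obtain l v D where D: "\<And>N. \<bar>Re ((deriv ^^ 1) (cumulant_gf N) 0) - (l * real N + v)\<bar> \<le> D * (3 / 4) ^ N"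
    using cumulant_expansion[of 1] by blast
  obtain s w E where E: "\<And>N. \<bar>Re ((deriv ^^ 2) (cumulant_gf N) 0) - (s * real N + w)\<bar> \<le> E * (3 / 4) ^ N"
    using cumulant_expansion[of 2] by blast
  have D': "\<bar>block_avg N log_stern - (l * real N + v)\<bar> \<le> D * (3 / 4) ^ N" for N
    using D[of N] cumulant_gf_derivs_0(1)[of N] by simp
  have E': "\<bar>block_avg N (\<lambda>n. (log_stern n)\<^sup>2) - (block_avg N log_stern)\<^sup>2 - (s * real N + w)\<bar> \<le> E * (3 / 4) ^ N" for N
    using E[of N] unfolding cumulant_gf_derivs_0(2) Re_complex_of_real .
  have m: "log_mean N 1 = block_avg N log_stern" for N
    by (simp add: log_mean_def log_stern_def[abs_def])
  have vr: "log_var N 1 = block_avg N (\<lambda>n. (log_stern n)\<^sup>2) - (block_avg N log_stern)\<^sup>2" for N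
    unfolding log_var_def m by (simp add: log_stern_def)
  have ab: "A * (3 / 4) ^ N \<le> \<bar>A\<bar>" for A :: real and N
    using mult_mono[of A "\<bar>A\<bar>" "(3 / 4) ^ N" 1] by (simp add: power_le_one)
  have "l > 0"
  proof (rule linear_growth_rate_pos[of "ln 2 / 2" l 1 "v + \<bar>D\<bar>"])
    show "ln 2 / 2 * real k \<le> l * real (1 * k) + (v + \<bar>D\<bar>)" for k
      using D'[of k] log_mean_ge[of 1 k] ab[of D k] unfolding m abs_le_iff
      by (simp add: algebra_simps)
  qed simp
  moreover have "s > 0"
  proof (rule linear_growth_rate_pos[of "(ln (5 / 4))\<^sup>2 / 8" s 2 "w + \<bar>E\<bar>"])
    show "(ln (5 / 4))\<^sup>2 / 8 * real k \<le> s * real (2 * k) + (w + \<bar>E\<bar>)" for k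
      using E'[of "2 * k"] log_var_ge[of 1 k] ab[of E "2 * k"] unfolding vr[symmetric] abs_le_iff
      by (simp add: algebra_simps)
  qed simp
  ultimately show ?thesis using that D' E' by blast
qed

section \<open>Fejer smoothing and the Berry-Esseen inequality\<close>

text \<open>The kernel is nonnegative and integrable, and its Fourier transform has compact support,
  so smoothing at scale 1/T involves characteristic functions only at frequencies up to T. It is
  left unnormalised; \<open>fejer_mass\<close> records its integral.\<close>

definition fejer :: "real \<Rightarrow> real" where
  "fejer v = (sinc (v / 2))\<^sup>2"

lemma fejer_nonneg [simp]: "0 \<le> fejer v"
  by (simp add: fejer_def)

lemma continuous_fejer: "isCont fejer v"
proof -
  have "isCont (\<lambda>v. sinc (v / 2)) v"
    by (rule isCont_o2[where f = "\<lambda>v. v / 2" and g = sinc, OF _ isCont_sinc]) simp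
  then show ?thesis unfolding fejer_def[abs_def] by (intro isCont_power)
qed

lemma borel_measurable_fejer [measurable]: "fejer \<in> borel_measurable borel"
  by (intro borel_measurable_continuous_onI continuous_at_imp_continuous_on ballI continuous_fejer)

lemma fejer_bound: "fejer v \<le> 5 * inverse (1 + v\<^sup>2)"
proof (cases "v = 0")
  case False
  define s where "s = sin (v / 2)"
  have f: "fejer v = 4 * s\<^sup>2 / v\<^sup>2" using False by (simp add: fejer_def s_def power_divide)
  have s1: "s\<^sup>2 \<le> 1" by (simp add: s_def power2_le_iff_abs_le abs_square_le_1)
  have "\<bar>s\<bar> \<le> \<bar>v / 2\<bar>" unfolding s_def by (rule abs_sin_x_le_abs_x)
  then have "s\<^sup>2 \<le> (v / 2)\<^sup>2" by (simp only: abs_le_square_iff)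
  then have "4 * s\<^sup>2 * (1 + v\<^sup>2) \<le> 5 * v\<^sup>2"
    using mult_right_mono[OF s1, of "v\<^sup>2"] by (simp add: power_divide algebra_simps)
  moreover have "1 + v\<^sup>2 > 0" by (simp add: add_pos_nonneg)
  ultimately show ?thesis using False by (simp add: f field_simps)
qed (simp add: fejer_def)

lemma integrable_fejer [simp]: "integrable lborel fejer"
proof (rule Bochner_Integration.integrable_bound)
  have "integrable lborel (\<lambda>x. inverse (1 + x\<^sup>2) :: real)"
    using integrable_inverse_1_plus_square by (simp add: set_integrable_def)
  then show "integrable lborel (\<lambda>x. 5 * inverse (1 + x\<^sup>2) :: real)" by simp
  have "\<bar>5 * inverse (1 + x\<^sup>2)\<bar> = 5 * inverse (1 + x\<^sup>2)" for x :: real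
    by (simp add: abs_mult)
  then show "AE x in lborel. norm (fejer x) \<le> norm (5 * inverse (1 + x\<^sup>2) :: real)"
    using fejer_bound by (auto simp del: inverse_eq_divide)
qed simp

definition fejer_mass :: real where "fejer_mass = (\<integral>v. fejer v \<partial>lborel)"

lemma fejer_mass_pos: "fejer_mass > 0"
proof -
  have "fejer_mass \<noteq> 0"
  proof
    assume "fejer_mass = 0"
    then have "AE v in lborel. fejer v = 0"
      unfolding fejer_mass_def by (subst (asm) integral_nonneg_eq_0_iff_AE) auto
    then have "AE v in lborel. v \<notin> {0<..<1::real}"
    proof (rule eventually_mono, intro notI)
      fix v :: real assume "fejer v = 0" "v \<in> {0<..<1}"
      then show False using sin_gt_zero[of "v / 2"] pi_gt3 by (auto simp: fejer_def)
    qed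
    then have "{0<..<1::real} \<in> null_sets lborel" by (subst AE_iff_null_sets) auto
    then show False by (simp add: null_sets_def)
  qed
  then show ?thesis by (simp add: fejer_mass_def less_le)
qed

text \<open>\<open>fejer\<close> is the Fourier transform of the compactly supported function \<open>max 0 (1 - \<bar>u\<bar>)\<close>.\<close>

lemma fejer_eq_integral: "((\<lambda>u. 2 * (1 - u) * cos (u * v)) has_integral fejer v) {0..1}"
proof (cases "v = 0")
  case True
  have "((\<lambda>u::real. 2 * (1 - u)) has_integral (2 * 1 - 1\<^sup>2) - (2 * 0 - 0\<^sup>2)) {0..1}"
    by (intro fundamental_theorem_of_calculus)
       (auto intro!: derivative_eq_intros simp flip: has_real_derivative_iff_has_vector_derivative)
  with True show ?thesis by (simp add: fejer_def)
next
  case False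
  let ?F = "\<lambda>u. 2 * ((1 - u) * (sin (u * v) / v) - cos (u * v) / v\<^sup>2)"
  have "((\<lambda>u. 2 * (1 - u) * cos (u * v)) has_integral ?F 1 - ?F 0) {0..1}"
    by (rule fundamental_theorem_of_calculus)
       (use False in \<open>auto intro!: derivative_eq_intros simp: field_simps power2_eq_square
          simp flip: has_real_derivative_iff_has_vector_derivative\<close>)
  moreover have "?F 1 - ?F 0 = fejer v"
    using False cos_double_sin[of "v / 2"] by (simp add: fejer_def power_divide field_simps)
  ultimately show ?thesis by simp
qed

text \<open>The primitive of \<open>fejer\<close> vanishing at 0, as a weighted average of sin (u *
  b) / u; the form b * sinc (u * b) fills in the value b at u = 0. Sines are what links expectations
  to characteristic functions.\<close>

definition fejer_prim :: "real \<Rightarrow> real" where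
  "fejer_prim b = integral {0..1} (\<lambda>u. 2 * (1 - u) * (b * sinc (u * b)))"

lemma sinc_scaled_eq: "u \<noteq> 0 \<Longrightarrow> b * sinc (u * b) = sin (u * b) / u"
  by simp

lemma has_derivative_scaled_sinc: "((\<lambda>b. b * sinc (u * b)) has_real_derivative cos (u * b)) (at b)"
proof (cases "u = 0")
  case False
  then have "(\<lambda>b. b * sinc (u * b)) = (\<lambda>b. sin (u * b) / u)" by auto
  then show ?thesis using False by (auto intro!: derivative_eq_intros)
qed simp

lemma continuous_on_scaled_sinc: "continuous_on A (\<lambda>u. 2 * (1 - u) * (b * sinc (u * b)))"
  by (intro continuous_intros)

lemma DERIV_fejer_prim: "(fejer_prim has_real_derivative fejer b) (at b)"
proof -
  have "((\<lambda>b. integral (cbox 0 1) (\<lambda>u. 2 * (1 - u) * (b * sinc (u * b)))) has_field_derivative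
     integral (cbox 0 1) (\<lambda>u. 2 * (1 - u) * cos (u * b))) (at b within UNIV)"
  proof (rule leibniz_rule_field_derivative)
    show "((\<lambda>x. 2 * (1 - t) * (x * sinc (t * x))) has_real_derivative 2 * (1 - t) * cos (t * x)) (at x within UNIV)" for x t
      by (rule DERIV_cmult, rule has_derivative_scaled_sinc)
    show "(\<lambda>u. 2 * (1 - u) * (x * sinc (u * x))) integrable_on cbox 0 1" for x
      by (intro integrable_continuous continuous_on_scaled_sinc)
    show "continuous_on (UNIV \<times> cbox 0 1) (\<lambda>(x, t). 2 * (1 - t) * cos (t * x :: real))"
      unfolding case_prod_beta by (intro continuous_intros)
  qed auto
  moreover have "integral (cbox 0 1) (\<lambda>u. 2 * (1 - u) * cos (u * b)) = fejer b"
    using fejer_eq_integral[of b] by (simp add: integral_unique)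
  ultimately show ?thesis by (simp add: fejer_prim_def[abs_def])
qed

lemma fejer_prim_0: "fejer_prim 0 = 0"
  by (simp add: fejer_prim_def)

definition fejer_cdf :: "real \<Rightarrow> real" where
  "fejer_cdf b = (LBINT v:{..b}. fejer v)"

lemma set_integrable_fejer [simp]: "A \<in> sets borel \<Longrightarrow> set_integrable lborel A fejer"
  unfolding set_integrable_def by (intro integrable_mult_indicator) auto

lemma fejer_cdf_diff: "a \<le> b \<Longrightarrow> fejer_cdf b - fejer_cdf a = fejer_prim b - fejer_prim a"
proof -
  assume ab: "a \<le> b"
  have "{..b} = {..a} \<union> {a<..b}" using ab by auto
  then have "fejer_cdf b = fejer_cdf a + (LBINT v:{a<..b}. fejer v)"
    unfolding fejer_cdf_def by (simp only:) (rule set_integral_Un, auto)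
  also have "(LBINT v:{a<..b}. fejer v) = (LBINT v:{a..b}. fejer v)"
    unfolding set_lebesgue_integral_def
    by (rule integral_cong_AE) (auto intro!: AE_I[where N = "{a}"] simp: indicator_def)
  also have "\<dots> = fejer_prim b - fejer_prim a"
    using integral_FTC_Icc_real[OF ab DERIV_fejer_prim continuous_fejer]
    by (simp add: set_lebesgue_integral_def mult.commute)
  finally show ?thesis by simp
qed

lemma fejer_cdf_eq: "fejer_cdf b = fejer_cdf 0 + fejer_prim b"
  using fejer_cdf_diff[of 0 b] fejer_cdf_diff[of b 0] fejer_prim_0 by (cases "b \<ge> 0") auto

lemma fejer_tail:
  assumes "e > 0"
  obtains a where "a > 0" "(\<integral>v. fejer v * indicator {v. \<bar>v\<bar> > a} v \<partial>lborel) \<le> e"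
proof -
  have "(\<lambda>n. \<integral>v. fejer v * indicator {v. \<bar>v\<bar> > real (Suc n)} v \<partial>lborel) \<longlonglongrightarrow> (\<integral>v. 0 \<partial>(lborel :: real measure))"
  proof (rule integral_dominated_convergence[where w = fejer])
    show "AE v in lborel. (\<lambda>n. fejer v * indicator {v. \<bar>v\<bar> > real (Suc n)} v) \<longlonglongrightarrow> 0"
    proof (rule AE_I2)
      fix v :: real
      obtain m where "\<bar>v\<bar> \<le> real m" using real_arch_simple by blast
      then have "\<forall>\<^sub>F n in sequentially. fejer v * indicator {v. \<bar>v\<bar> > real (Suc n)} v = 0"
        by (intro eventually_sequentiallyI[of m]) (auto simp: indicator_def)
      then show "(\<lambda>n. fejer v * indicator {v. \<bar>v\<bar> > real (Suc n)} v) \<longlonglongrightarrow> 0"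
        by (rule tendsto_eventually)
    qed
  qed (auto simp: indicator_def)
  then have "\<forall>\<^sub>F n in sequentially. (\<integral>v. fejer v * indicator {v. \<bar>v\<bar> > real (Suc n)} v \<partial>lborel) < e"
    using assms by (intro order_tendstoD(2)) auto
  then obtain n where "(\<integral>v. fejer v * indicator {v. \<bar>v\<bar> > real (Suc n)} v \<partial>lborel) < e"
    by (auto simp: eventually_sequentially)
  then show ?thesis by (intro that[of "real (Suc n)"]) auto
qed

text \<open>If |F - G| is near its supremum at x0, then monotonicity of F and the Lipschitz bound
  for G keep F - G large, of one sign, on an interval of length 2a/T on one side of x0. Centring the
  kernel there makes the smoothed difference large too, apart from the kernel's tail and the drift
  of G.\<close>

lemma smoothing_inequality:
  obtains C where "C \<ge> 0" and "\<And>F G T B x. mono F \<Longrightarrow> mono G \<Longrightarrow> (\<And>x y. \<bar>G x - G y :: real\<bar> \<le> \<bar>x - y\<bar>) \<Longrightarrow>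
     (\<And>x. \<bar>F x - G x\<bar> \<le> 1) \<Longrightarrow> T > 0 \<Longrightarrow>
     (\<And>x. \<bar>\<integral>u. fejer u * (F (x - u / T) - G (x - u / T)) \<partial>lborel\<bar> \<le> B) \<Longrightarrow>
     \<bar>F x - G x\<bar> \<le> C * (B + 1 / T)"
proof -
  let ?c = fejer_mass
  \<comment> \<open>An eighth of the mass outside [-a, a] is small enough: the loss 3/2 * 1/8 leaves
    1/2 - 3/16 = 5/16 of the supremum.\<close>
  obtain a where a: "a > 0" and tail: "(\<integral>v. fejer v * indicator {v. \<bar>v\<bar> > a} v \<partial>lborel) \<le> ?c / 8"
    by (rule fejer_tail[of "?c / 8"]) (use fejer_mass_pos in auto)
  let ?I = "indicator {v. \<bar>v\<bar> > a} :: real \<Rightarrow> real"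
  have intI: "integrable lborel (\<lambda>u. fejer u * ?I u)"
    using set_integrable_fejer[of "{v. \<bar>v\<bar> > a}"] by (simp add: set_integrable_def mult.commute)
  define C where "C = 16 / 5 * (1 / ?c + 2 * a)"
  show ?thesis
  proof (rule that[of C])
    show "C \<ge> 0" using a fejer_mass_pos by (simp add: C_def)
    fix F G :: "real \<Rightarrow> real" and T B x :: real
    assume F: "mono F" and G: "mono G" and lip: "\<And>x y. \<bar>G x - G y\<bar> \<le> \<bar>x - y\<bar>"
      and FG: "\<And>x. \<bar>F x - G x\<bar> \<le> 1" and T: "T > 0"
      and B: "\<And>x. \<bar>\<integral>u. fejer u * (F (x - u / T) - G (x - u / T)) \<partial>lborel\<bar> \<le> B"
    have [measurable]: "F \<in> borel_measurable borel" "G \<in> borel_measurable borel"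
      using F G by (auto intro: borel_measurable_mono)
    define \<eta> where "\<eta> = (SUP x. \<bar>F x - G x\<bar>)"
    have bdd: "bdd_above (range (\<lambda>x. \<bar>F x - G x\<bar>))" using FG by (auto simp: bdd_above_def)
    have le: "\<bar>F x - G x\<bar> \<le> \<eta>" for x unfolding \<eta>_def by (rule cSUP_upper[OF _ bdd]) auto
    have \<eta>0: "\<eta> \<ge> 0" using le[of 0] by linarith
    have B0: "B \<ge> 0" using B[of 0] by linarith
    have int: "integrable lborel (\<lambda>u. fejer u * (F (x - u / T) - G (x - u / T)))" for x
    proof (rule Bochner_Integration.integrable_bound[OF integrable_fejer])
      show "AE u in lborel. norm (fejer u * (F (x - u / T) - G (x - u / T))) \<le> norm (fejer u)"
        using FG mult_left_mono[OF FG fejer_nonneg] by (auto simp: abs_mult)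
    qed measurable
    \<comment> \<open>The sign s treats both directions at once. Outside the window the factor
      beside the kernel is only known to be at least - \<eta>, which lies 3/2 * \<eta> below the
      value \<eta> / 2 used inside.\<close>
    have low: "\<eta> * (5 / 16) * ?c - 2 * a / T * ?c \<le> (\<integral>u. fejer u * (s * (F (x - u / T) - G (x - u / T))) \<partial>lborel)"
      if s: "\<bar>s\<bar> = 1" and near: "\<And>u. \<bar>u\<bar> \<le> a \<Longrightarrow> \<eta> / 2 - 2 * a / T \<le> s * (F (x - u / T) - G (x - u / T))" for s x
    proof -
      have "(\<integral>u. fejer u * (\<eta> / 2 - 2 * a / T) - 3 / 2 * \<eta> * (fejer u * ?I u) \<partial>lborel) \<le>
          (\<integral>u. fejer u * (s * (F (x - u / T) - G (x - u / T))) \<partial>lborel)"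
      proof (rule integral_mono)
        show "integrable lborel (\<lambda>u. fejer u * (\<eta> / 2 - 2 * a / T) - 3 / 2 * \<eta> * (fejer u * ?I u))"
          using intI by auto
        show "integrable lborel (\<lambda>u. fejer u * (s * (F (x - u / T) - G (x - u / T))))"
          using integrable_mult_right[OF int[of x], of s] by (simp add: mult_ac)
        fix u
        show "fejer u * (\<eta> / 2 - 2 * a / T) - 3 / 2 * \<eta> * (fejer u * ?I u) \<le> fejer u * (s * (F (x - u / T) - G (x - u / T)))"
        proof (cases "\<bar>u\<bar> \<le> a")
          case True
          then show ?thesis using mult_left_mono[OF near[OF True] fejer_nonneg, of u] by simp
        next
          case False
          have "\<bar>s * (F (x - u / T) - G (x - u / T))\<bar> \<le> \<eta>" using le s by (simp add: abs_mult)
          then have "\<eta> / 2 - 2 * a / T - 3 / 2 * \<eta> \<le> s * (F (x - u / T) - G (x - u / T))"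
            using divide_pos_pos[of "2 * a" T] a T unfolding abs_le_iff by linarith
          then show ?thesis
            using mult_left_mono[OF _ fejer_nonneg, of _ _ u] False by (fastforce simp: algebra_simps)
        qed
      qed
      also have "(\<integral>u. fejer u * (\<eta> / 2 - 2 * a / T) - 3 / 2 * \<eta> * (fejer u * ?I u) \<partial>lborel) =
          ?c * (\<eta> / 2 - 2 * a / T) - 3 / 2 * \<eta> * (\<integral>u. fejer u * ?I u \<partial>lborel)"
        using intI by (simp add: fejer_mass_def)
      finally have "?c * (\<eta> / 2 - 2 * a / T) - 3 / 2 * \<eta> * (\<integral>u. fejer u * ?I u \<partial>lborel) \<le>
         (\<integral>u. fejer u * (s * (F (x - u / T) - G (x - u / T))) \<partial>lborel)" .
      moreover have "3 / 2 * \<eta> * (\<integral>u. fejer u * ?I u \<partial>lborel) \<le> 3 / 2 * \<eta> * (?c / 8)"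
        using tail \<eta>0 by (intro mult_left_mono) auto
      moreover have "\<eta> * (5 / 16) * ?c - 2 * a / T * ?c = ?c * (\<eta> / 2 - 2 * a / T) - 3 / 2 * \<eta> * (?c / 8)"
        by (simp add: algebra_simps)
      ultimately show ?thesis by linarith
    qed
    have "\<eta> \<le> C * (B + 1 / T)"
    proof (cases "\<eta> = 0")
      case True
      then show ?thesis using B0 T \<open>C \<ge> 0\<close> by simp
    next
      case False
      \<comment> \<open>Half of a positive supremum is exceeded somewhere even if the supremum is
        not attained.\<close>
      then have "\<eta> / 2 < (SUP x. \<bar>F x - G x\<bar>)" using \<eta>0 by (simp add: \<eta>_def)
      then have "\<exists>x0\<in>UNIV. \<eta> / 2 < \<bar>F x0 - G x0\<bar>"
        by (subst less_cSUP_iff[OF UNIV_not_empty bdd, symmetric])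
      then obtain x0 where x0: "\<eta> / 2 < \<bar>F x0 - G x0\<bar>" by blast
      have "\<eta> * (5 / 16) * ?c - 2 * a / T * ?c \<le> B"
      proof (cases "F x0 - G x0 \<ge> 0")
        case True
        \<comment> \<open>The points x - u / T with |u| <= a then fill an interval starting at x0
          and extending to the right, where F is at least F x0; in the opposite case the interval
          extends to the left.\<close>
        define x where "x = x0 + a / T"
        have "\<eta> / 2 - 2 * a / T \<le> 1 * (F (x - u / T) - G (x - u / T))" if u: "\<bar>u\<bar> \<le> a" for u
        proof -
          have d: "x - u / T - x0 = (a - u) / T" by (simp add: x_def diff_divide_distrib)
          have "0 \<le> (a - u) / T" "(a - u) / T \<le> 2 * a / T" using u T by (auto intro!: divide_nonneg_pos divide_right_mono)
          then have "x0 \<le> x - u / T" "x - u / T - x0 \<le> 2 * a / T" unfolding d[symmetric] by auto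
          then show ?thesis using monoD[OF F, of x0 "x - u / T"] lip[of "x - u / T" x0] x0 True by auto
        qed
        from low[OF _ this, simplified] B[of x] show ?thesis by (auto simp: abs_le_iff)
      next
        case neg: False
        define x where "x = x0 - a / T"
        have near: "\<eta> / 2 - 2 * a / T \<le> -1 * (F (x - u / T) - G (x - u / T))" if u: "\<bar>u\<bar> \<le> a" for u
        proof -
          have d: "x0 - (x - u / T) = (a + u) / T" by (simp add: x_def add_divide_distrib)
          have "0 \<le> (a + u) / T" "(a + u) / T \<le> 2 * a / T" using u T by (auto intro!: divide_nonneg_pos divide_right_mono)
          then have "x - u / T \<le> x0" "x0 - (x - u / T) \<le> 2 * a / T" unfolding d[symmetric] by auto
          then show ?thesis using monoD[OF F, of "x - u / T" x0] lip[of "x - u / T" x0] x0 neg by auto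
        qed
        have minus_int: "(\<integral>u. fejer u * (-1 * (F (x - u / T) - G (x - u / T))) \<partial>lborel) =
            - (\<integral>u. fejer u * (F (x - u / T) - G (x - u / T)) \<partial>lborel)"
          by (subst Bochner_Integration.integral_minus[symmetric]) (simp add: algebra_simps)
        from low[OF _ near] have "\<eta> * (5 / 16) * ?c - 2 * a / T * ?c \<le> - (\<integral>u. fejer u * (F (x - u / T) - G (x - u / T)) \<partial>lborel)"
          unfolding minus_int by simp
        then show ?thesis using B[of x] by (auto simp: abs_le_iff)
      qed
      then have "\<eta> \<le> 16 / 5 * (B / ?c + 2 * a / T)" using fejer_mass_pos by (simp add: field_simps)
      also have "\<dots> \<le> C * (B + 1 / T)"
        using a T B0 fejer_mass_pos by (simp add: C_def field_simps)
      finally show ?thesis .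
    qed
    then show "\<bar>F x - G x\<bar> \<le> C * (B + 1 / T)" using le[of x] by linarith
  qed
qed

section \<open>Smoothed distribution functions as sine transforms\<close>

lemma integrable_std_normal_indicator:
  "A \<in> sets borel \<Longrightarrow> integrable lborel (\<lambda>v. std_normal_density v * indicator A v)"
  using integrable_mult_indicator[of A lborel std_normal_density] by (simp add: mult.commute)

lemma std_normal_measure:
  assumes A: "A \<in> sets borel"
  shows "measure std_normal_distribution A = (\<integral>v. std_normal_density v * indicator A v \<partial>lborel)"
proof -
  have "measure std_normal_distribution A = (\<integral>v. indicator A v \<partial>std_normal_distribution)"
    using A by simp
  also have "\<dots> = (\<integral>v. std_normal_density v * indicator A v \<partial>lborel)"
    using A by (subst integral_density) auto
  finally show ?thesis .
qed

lemma std_normal_cdf_lipschitz: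
  "\<bar>cdf std_normal_distribution x - cdf std_normal_distribution y\<bar> \<le> \<bar>x - y\<bar>"
proof -
  interpret real_distribution std_normal_distribution by (rule real_dist_normal_dist)
  have main: "cdf std_normal_distribution b - cdf std_normal_distribution a \<le> b - a" if "a < b" for a b
  proof -
    have "cdf std_normal_distribution b - cdf std_normal_distribution a = measure std_normal_distribution {a<..b}"
      by (rule cdf_diff_eq[OF that])
    also have "\<dots> = (\<integral>v. std_normal_density v * indicator {a<..b} v \<partial>lborel)"
      by (rule std_normal_measure) simp
    also have "\<dots> \<le> (\<integral>v. indicator {a<..b} v \<partial>lborel)"
    proof (rule integral_mono)
      show "integrable lborel (\<lambda>v. std_normal_density v * indicator {a<..b} v)"
        by (rule integrable_std_normal_indicator) simp
      fix v :: real
      have "std_normal_density v \<le> 1 / sqrt (2 * pi) * 1"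
        unfolding std_normal_density_def by (intro mult_left_mono) auto
      also have "\<dots> \<le> 1" using pi_gt3 by (simp add: real_le_rsqrt)
      finally show "std_normal_density v * indicator {a<..b} v \<le> indicator {a<..b} v"
        by (auto simp: indicator_def)
    qed (use that in auto)
    also have "\<dots> = b - a" using that by simp
    finally show ?thesis .
  qed
  consider "x < y" | "x = y" | "y < x" by linarith
  then show ?thesis
    using main[of x y] main[of y x] cdf_nondecreasing[of x y] cdf_nondecreasing[of y x] by cases auto
qed

text \<open>By Fubini, smoothing a distribution function amounts to averaging the kernel's own
  distribution function over the law, because z <= x - u/T is the same condition as u <= T (x -
  z).\<close>

lemma integral_std_normal_swap_cdf:
  assumes T: "T > 0"
  shows "(\<integral>u. fejer u * cdf std_normal_distribution (x - u / T) \<partial>lborel) =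
     (\<integral>z. fejer_cdf (T * (x - z)) \<partial>std_normal_distribution)"
proof -
  let ?M = "std_normal_distribution"
  interpret M: real_distribution ?M by (rule real_dist_normal_dist)
  interpret pair_sigma_finite lborel ?M ..
  let ?f = "\<lambda>u z. if z \<le> x - u / T then fejer u else 0"
  have eq: "(if z \<le> x - u / T then fejer u else 0) = fejer u * indicator {..x - u / T} z" for z u
    by (auto simp: indicator_def)
  have inner: "(\<integral>z. ?f u z \<partial>?M) = fejer u * cdf ?M (x - u / T)" for u
    unfolding eq by (simp add: cdf_def2)
  have "integrable (lborel \<Otimes>\<^sub>M ?M) (case_prod ?f)"
  proof (rule Fubini_integrable)
    show "case_prod ?f \<in> borel_measurable (lborel \<Otimes>\<^sub>M ?M)"
      unfolding case_prod_beta by measurable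
    have "(\<lambda>u. \<integral>z. norm (case_prod ?f (u, z)) \<partial>?M) = (\<lambda>u. fejer u * cdf ?M (x - u / T))"
      using inner by (auto simp: if_distrib cong: if_cong)
    moreover have "integrable lborel (\<lambda>u. fejer u * cdf ?M (x - u / T))"
    proof (rule Bochner_Integration.integrable_bound[OF integrable_fejer])
      have [measurable]: "cdf ?M \<in> borel_measurable borel"
        by (intro borel_measurable_mono monoI M.cdf_nondecreasing)
      show "(\<lambda>u. fejer u * cdf ?M (x - u / T)) \<in> borel_measurable lborel" by measurable
      show "AE u in lborel. norm (fejer u * cdf ?M (x - u / T)) \<le> norm (fejer u)"
        using mult_left_mono[OF M.cdf_bounded_prob fejer_nonneg] by (auto simp: abs_mult M.cdf_nonneg)
    qed
    ultimately show "integrable lborel (\<lambda>u. \<integral>z. norm (case_prod ?f (u, z)) \<partial>?M)" by simp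
    show "AE u in lborel. integrable ?M (\<lambda>z. case_prod ?f (u, z))"
      unfolding prod.case eq by (intro AE_I2 integrable_mult_right M.integrable_const_bound[where B = 1]) (auto simp: indicator_def)
  qed
  from Fubini_integral[OF this] have "(\<integral>u. (\<integral>z. ?f u z \<partial>?M) \<partial>lborel) = (\<integral>z. (\<integral>u. ?f u z \<partial>lborel) \<partial>?M)"
    by simp
  moreover have "(\<integral>u. ?f u z \<partial>lborel) = fejer_cdf (T * (x - z))" for z
  proof -
    have "z \<le> x - u / T \<longleftrightarrow> u \<le> T * (x - z)" for u using T by (simp add: field_simps)
    then show ?thesis unfolding fejer_cdf_def set_lebesgue_integral_def
      by (intro Bochner_Integration.integral_cong) (auto simp: indicator_def)
  qed
  ultimately show ?thesis by (simp only: inner)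
qed

lemma fejer_prim_Lebesgue:
  "fejer_prim b = (\<integral>u. indicator {0..1} u * (2 * (1 - u) * (b * sinc (u * b))) \<partial>lborel)"
  and integrable_fejer_prim: "integrable lborel (\<lambda>u. indicator {0..1} u * (2 * (1 - u) * (b * sinc (u * b))))"
proof -
  have i: "set_integrable lborel {0..1} (\<lambda>u. 2 * (1 - u) * (b * sinc (u * b)))"
    unfolding set_integrable_def by (intro borel_integrable_compact continuous_on_scaled_sinc) simp
  then show "integrable lborel (\<lambda>u. indicator {0..1} u * (2 * (1 - u) * (b * sinc (u * b))))"
    by (simp add: set_integrable_def)
  from set_borel_integral_eq_integral(2)[OF i]
  show "fejer_prim b = (\<integral>u. indicator {0..1} u * (2 * (1 - u) * (b * sinc (u * b))) \<partial>lborel)"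
    by (simp add: fejer_prim_def set_lebesgue_integral_def)
qed

lemma abs_sinc_le_1: "\<bar>sinc x\<bar> \<le> 1"
  using abs_sin_x_le_abs_x[of x] by (auto simp: divide_le_eq)

lemma std_normal_integrable_abs: "integrable std_normal_distribution (\<lambda>z. \<bar>z\<bar>)"
  using integrable_std_normal_distribution_moment[of 1] by (intro integrable_abs) simp

text \<open>As |sinc| <= 1, the integrand is dominated by a multiple of |x| + |z|, so the first
  absolute moment of the normal law justifies the exchange of integrals.\<close>

lemma integral_std_normal_swap_prim:
  shows "integrable std_normal_distribution (\<lambda>z. fejer_prim (T * (x - z)))"
   and "(\<integral>z. fejer_prim (T * (x - z)) \<partial>std_normal_distribution) =
     (\<integral>u. indicator {0..1} u * (2 * (1 - u) * (\<integral>z. T * (x - z) * sinc (u * (T * (x - z))) \<partial>std_normal_distribution)) \<partial>lborel)"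
   and "integrable lborel (\<lambda>u. indicator {0..1} u * (2 * (1 - u) * (\<integral>z. T * (x - z) * sinc (u * (T * (x - z))) \<partial>std_normal_distribution)))"
proof -
  let ?M = "std_normal_distribution"
  interpret M: real_distribution ?M by (rule real_dist_normal_dist)
  interpret pair_sigma_finite ?M lborel ..
  let ?f = "\<lambda>z u. indicator {0..1} u * (2 * (1 - u) * (T * (x - z) * sinc (u * (T * (x - z)))))"
  have bnd: "norm (?f z u) \<le> 2 * (\<bar>T\<bar> * (\<bar>x\<bar> + \<bar>z\<bar>)) * indicator {0..1} u" for z u
  proof (cases "u \<in> {0..1}")
    case True
    have "\<bar>T\<bar> * \<bar>x - z\<bar> * \<bar>sinc (u * (T * (x - z)))\<bar> \<le> \<bar>T\<bar> * (\<bar>x\<bar> + \<bar>z\<bar>) * 1"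
      by (rule mult_mono[OF mult_left_mono abs_sinc_le_1]) auto
    then have "(2 * (1 - u)) * (\<bar>T\<bar> * \<bar>x - z\<bar> * \<bar>sinc (u * (T * (x - z)))\<bar>) \<le> 2 * (\<bar>T\<bar> * (\<bar>x\<bar> + \<bar>z\<bar>) * 1)"
      by (rule mult_mono[rotated]) (use True in \<open>auto intro!: mult_nonneg_nonneg\<close>)
    then show ?thesis using True by (simp only: indicator_simps real_norm_def abs_mult) auto
  qed simp
  have int: "integrable (?M \<Otimes>\<^sub>M lborel) (case_prod ?f)"
  proof (rule Fubini_integrable)
    show meas: "case_prod ?f \<in> borel_measurable (?M \<Otimes>\<^sub>M lborel)"
      unfolding case_prod_beta by measurable
    have i2: "integrable lborel (\<lambda>u. ?f z u)" for z using integrable_fejer_prim[of "T * (x - z)"] .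
    then show "AE z in ?M. integrable lborel (\<lambda>u. case_prod ?f (z, u))" by simp
    show "integrable ?M (\<lambda>z. \<integral>u. norm (case_prod ?f (z, u)) \<partial>lborel)"
    proof (rule Bochner_Integration.integrable_bound)
      show "integrable ?M (\<lambda>z. 2 * (\<bar>T\<bar> * (\<bar>x\<bar> + \<bar>z\<bar>)))"
        using std_normal_integrable_abs by simp
      show "(\<lambda>z. \<integral>u. norm (case_prod ?f (z, u)) \<partial>lborel) \<in> borel_measurable ?M"
        using measurable_compose[OF meas borel_measurable_norm]
        by (intro lborel.borel_measurable_lebesgue_integral) (simp add: case_prod_beta)
      show "AE z in ?M. norm (\<integral>u. norm (case_prod ?f (z, u)) \<partial>lborel) \<le> norm (2 * (\<bar>T\<bar> * (\<bar>x\<bar> + \<bar>z\<bar>)))"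
      proof (rule AE_I2)
        fix z
        have "(\<integral>u. norm (?f z u) \<partial>lborel) \<le> (\<integral>u. 2 * (\<bar>T\<bar> * (\<bar>x\<bar> + \<bar>z\<bar>)) * indicator {0..1::real} u \<partial>lborel)"
          using bnd by (intro integral_mono integrable_norm i2) auto
        also have "(\<integral>u. 2 * (\<bar>T\<bar> * (\<bar>x\<bar> + \<bar>z\<bar>)) * indicator {0..1::real} u \<partial>lborel) = 2 * (\<bar>T\<bar> * (\<bar>x\<bar> + \<bar>z\<bar>))" by simp
        finally show "norm (\<integral>u. norm (case_prod ?f (z, u)) \<partial>lborel) \<le> norm (2 * (\<bar>T\<bar> * (\<bar>x\<bar> + \<bar>z\<bar>)))"
          by (simp only: prod.case real_norm_def) (simp add: abs_of_nonneg)
      qed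
    qed
  qed
  show "integrable ?M (\<lambda>z. fejer_prim (T * (x - z)))"
    using integrable_fst[OF int] unfolding fejer_prim_Lebesgue .
  show "(\<integral>z. fejer_prim (T * (x - z)) \<partial>?M) =
     (\<integral>u. indicator {0..1} u * (2 * (1 - u) * (\<integral>z. T * (x - z) * sinc (u * (T * (x - z))) \<partial>?M)) \<partial>lborel)"
    using Fubini_integral[OF int] unfolding fejer_prim_Lebesgue by (simp only: integral_mult_right_zero)
  show "integrable lborel (\<lambda>u. indicator {0..1} u * (2 * (1 - u) * (\<integral>z. T * (x - z) * sinc (u * (T * (x - z))) \<partial>?M)))"
    using integrable_snd[OF int] by (simp only: integral_mult_right_zero)
qed

lemma integral_sin_std_normal:
  "(\<integral>z. sin (s * (x - z)) \<partial>std_normal_distribution) = Im (iexp (s * x) * char std_normal_distribution (- s))"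
  "integrable std_normal_distribution (\<lambda>z. sin (s * (x - z)))"
proof -
  interpret real_distribution std_normal_distribution by (rule real_dist_normal_dist)
  have eq: "iexp (s * (x - z)) = iexp (s * x) * iexp (- s * z)" for z
    by (simp add: exp_add[symmetric] algebra_simps)
  have int: "integrable std_normal_distribution (\<lambda>z. iexp (- s * z))" by (rule integrable_iexp) simp_all
  have "(\<integral>z. sin (s * (x - z)) \<partial>std_normal_distribution) = (\<integral>z. Im (iexp (s * x) * iexp (- s * z)) \<partial>std_normal_distribution)"
    unfolding eq[symmetric] by (simp add: Im_exp)
  also have "\<dots> = Im (iexp (s * x) * char std_normal_distribution (- s))"
    unfolding char_def by (subst integral_Im) (use int in auto)
  finally show "(\<integral>z. sin (s * (x - z)) \<partial>std_normal_distribution) = Im (iexp (s * x) * char std_normal_distribution (- s))" .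
  show "integrable std_normal_distribution (\<lambda>z. sin (s * (x - z)))"
    by (rule integrable_const_bound[where B = 1]) auto
qed

text \<open>Both sine transforms are imaginary parts of exp(i s x) times a characteristic function
  at -s, and the rotation has modulus 1.\<close>

lemma sin_transform_diff:
  assumes B: "norm ((\<Sum>i\<in>A. of_real (q i) * iexp (- s * y i)) - char std_normal_distribution (- s)) \<le> K"
  shows "\<bar>(\<Sum>i\<in>A. q i * sin (s * (x - y i))) - (\<integral>z. sin (s * (x - z)) \<partial>std_normal_distribution)\<bar> \<le> K"
proof -
  have "(\<Sum>i\<in>A. q i * sin (s * (x - y i))) = Im (iexp (s * x) * (\<Sum>i\<in>A. of_real (q i) * iexp (- s * y i)))"
  proof -
    have *: "iexp (s * x) * (of_real (q i) * iexp (- s * y i)) = of_real (q i) * iexp (s * (x - y i))" for i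
      by (simp add: exp_add[symmetric] algebra_simps)
    show ?thesis unfolding sum_distrib_left * by (simp add: Im_exp)
  qed
  then have "\<bar>(\<Sum>i\<in>A. q i * sin (s * (x - y i))) - (\<integral>z. sin (s * (x - z)) \<partial>std_normal_distribution)\<bar> =
     \<bar>Im (iexp (s * x) * ((\<Sum>i\<in>A. of_real (q i) * iexp (- s * y i)) - char std_normal_distribution (- s)))\<bar>"
    unfolding integral_sin_std_normal by (simp only: right_diff_distrib minus_complex.simps)
  also have "\<dots> \<le> norm (iexp (s * x) * ((\<Sum>i\<in>A. of_real (q i) * iexp (- s * y i)) - char std_normal_distribution (- s)))"
    by (rule abs_Im_le_cmod)
  also have "\<dots> \<le> K" using B by (simp add: norm_mult)
  finally show ?thesis .
qed

text \<open>Dividing B |\<tau>| / (1 + \<tau>^2) by u, with \<tau> = u T, leaves half of this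
  integrand. Its primitive is 2 B arctan (u T), so the integral is bounded independently of
  T.\<close>

lemma arctan_integral_bound:
  fixes T B :: real
  assumes "T > 0" "B \<ge> 0"
  shows "integrable lborel (\<lambda>u. indicator {0..1} u * (2 * (B * T / (1 + (u * T)\<^sup>2))))"
    and "(\<integral>u. indicator {0..1} u * (2 * (B * T / (1 + (u * T)\<^sup>2))) \<partial>lborel) \<le> 4 * B"
proof -
  have pos: "1 + (u * T)\<^sup>2 > 0" for u :: real by (simp add: add_pos_nonneg)
  have d: "((\<lambda>u. 2 * B * arctan (u * T)) has_real_derivative 2 * (B * T / (1 + (u * T)\<^sup>2))) (at u)" for u
    by (auto intro!: derivative_eq_intros simp: field_simps)
  have c: "isCont (\<lambda>u. 2 * (B * T / (1 + (u * T)\<^sup>2))) u" for u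
    using pos[of u] by (intro continuous_intros) auto
  from has_bochner_integral_FTC_Icc_real[OF _ d c, of 0 1]
  have h: "has_bochner_integral lborel (\<lambda>u. indicator {0..1} u * (2 * (B * T / (1 + (u * T)\<^sup>2)))) (2 * B * arctan T)"
    by (simp add: mult.commute)
  then show "integrable lborel (\<lambda>u. indicator {0..1} u * (2 * (B * T / (1 + (u * T)\<^sup>2))))" by (rule integrable.intros)
  have "2 * B * arctan T \<le> 2 * B * 2"
    using arctan_ubound[of T] pi_less_4 assms by (intro mult_left_mono) auto
  then show "(\<integral>u. indicator {0..1} u * (2 * (B * T / (1 + (u * T)\<^sup>2))) \<partial>lborel) \<le> 4 * B"
    using has_bochner_integral_integral_eq[OF h] by simp
qed

text \<open>A finitely supported law is kept as explicit weights and points, so that tilting changes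
  only q and recentring only y.\<close>

definition weighted_cdf :: "'a set \<Rightarrow> ('a \<Rightarrow> real) \<Rightarrow> ('a \<Rightarrow> real) \<Rightarrow> real \<Rightarrow> real" where
  "weighted_cdf A q y s = (\<Sum>i\<in>A. q i * of_bool (y i \<le> s))"

lemma weighted_cdf_mono:
  assumes "\<And>i. i \<in> A \<Longrightarrow> q i \<ge> 0"
  shows "mono (weighted_cdf A q y)"
  unfolding weighted_cdf_def by (intro monoI sum_mono mult_left_mono assms) auto

lemma weighted_cdf_bounds:
  assumes "\<And>i. i \<in> A \<Longrightarrow> q i \<ge> 0" "sum q A = 1"
  shows "0 \<le> weighted_cdf A q y s" "weighted_cdf A q y s \<le> 1"
proof -
  show "0 \<le> weighted_cdf A q y s" unfolding weighted_cdf_def by (intro sum_nonneg mult_nonneg_nonneg assms) auto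
  have "weighted_cdf A q y s \<le> (\<Sum>i\<in>A. q i * 1)"
    unfolding weighted_cdf_def by (intro sum_mono mult_left_mono assms) auto
  then show "weighted_cdf A q y s \<le> 1" using assms by simp
qed

text \<open>Each smoothed distribution function is a constant plus a mixture of sine transforms at
  frequencies u T with u in [0,1]. The bound on the characteristic functions vanishes at 0, which
  cancels the factor 1/u, and decays, which makes the result independent of T.\<close>

lemma smoothed_difference:
  assumes A: "finite A" and q: "\<And>i. i \<in> A \<Longrightarrow> q i \<ge> 0" "sum q A = 1" and T: "T > 0" and B: "B \<ge> 0"
    and char: "\<And>\<tau>. \<bar>\<tau>\<bar> \<le> T \<Longrightarrow> norm ((\<Sum>i\<in>A. of_real (q i) * iexp (\<tau> * y i)) - char std_normal_distribution \<tau>) \<le> B * \<bar>\<tau>\<bar> / (1 + \<tau>\<^sup>2)"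
  shows "\<bar>\<integral>u. fejer u * (weighted_cdf A q y (x - u / T) - cdf std_normal_distribution (x - u / T)) \<partial>lborel\<bar> \<le> 4 * B"
proof -
  let ?M = "std_normal_distribution"
  interpret M: real_distribution ?M by (rule real_dist_normal_dist)
  let ?S = "\<lambda>u b. b * sinc (u * b)"
  have fin: "(\<integral>u. fejer u * weighted_cdf A q y (x - u / T) \<partial>lborel) = (\<Sum>i\<in>A. q i * fejer_cdf (T * (x - y i)))"
    and ifin: "integrable lborel (\<lambda>u. fejer u * weighted_cdf A q y (x - u / T))"
  proof -
    have eq: "fejer u * weighted_cdf A q y (x - u / T) = (\<Sum>i\<in>A. q i * (indicator {..T * (x - y i)} u * fejer u))" for u
    proof -
      have "of_bool (y i \<le> x - u / T) = (indicator {..T * (x - y i)} u :: real)" for i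
        using T by (auto simp: indicator_def field_simps)
      then show ?thesis by (simp add: weighted_cdf_def sum_distrib_left mult_ac)
    qed
    have i: "integrable lborel (\<lambda>u. indicator {..T * (x - y i)} u * fejer u)" for i
      using set_integrable_fejer[of "{..T * (x - y i)}"] by (simp add: set_integrable_def)
    show "integrable lborel (\<lambda>u. fejer u * weighted_cdf A q y (x - u / T))"
      unfolding eq using i by (intro Bochner_Integration.integrable_sum integrable_mult_right)
    show "(\<integral>u. fejer u * weighted_cdf A q y (x - u / T) \<partial>lborel) = (\<Sum>i\<in>A. q i * fejer_cdf (T * (x - y i)))"
      unfolding eq using i by (subst Bochner_Integration.integral_sum) (auto simp: fejer_cdf_def set_lebesgue_integral_def)
  qed
  have inorm: "integrable lborel (\<lambda>u. fejer u * cdf ?M (x - u / T))"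
  proof (rule Bochner_Integration.integrable_bound[OF integrable_fejer])
    have [measurable]: "cdf ?M \<in> borel_measurable borel"
      by (intro borel_measurable_mono monoI M.cdf_nondecreasing)
    show "(\<lambda>u. fejer u * cdf ?M (x - u / T)) \<in> borel_measurable lborel" by measurable
    show "AE u in lborel. norm (fejer u * cdf ?M (x - u / T)) \<le> norm (fejer u)"
      using mult_left_mono[OF M.cdf_bounded_prob fejer_nonneg] by (auto simp: abs_mult M.cdf_nonneg)
  qed
  define P where "P u = (\<Sum>i\<in>A. q i * ?S u (T * (x - y i)))" for u
  define Q where "Q u = (\<integral>z. ?S u (T * (x - z)) \<partial>?M)" for u
  have iP: "integrable lborel (\<lambda>u. indicator {0..1} u * (2 * (1 - u) * P u))"
    and eP: "(\<Sum>i\<in>A. q i * fejer_prim (T * (x - y i))) = (\<integral>u. indicator {0..1} u * (2 * (1 - u) * P u) \<partial>lborel)"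
  proof -
    have eq: "indicator {0..1} u * (2 * (1 - u) * P u) = (\<Sum>i\<in>A. q i * (indicator {0..1} u * (2 * (1 - u) * ?S u (T * (x - y i)))))" for u
      unfolding P_def sum_distrib_left by (intro sum.cong refl) (simp only: mult_ac)
    show "integrable lborel (\<lambda>u. indicator {0..1} u * (2 * (1 - u) * P u))"
      unfolding eq by (intro Bochner_Integration.integrable_sum integrable_mult_right integrable_fejer_prim)
    show "(\<Sum>i\<in>A. q i * fejer_prim (T * (x - y i))) = (\<integral>u. indicator {0..1} u * (2 * (1 - u) * P u) \<partial>lborel)"
      unfolding eq fejer_prim_Lebesgue
      by (subst Bochner_Integration.integral_sum)
         (intro integrable_mult_right integrable_fejer_prim, intro sum.cong refl Bochner_Integration.integral_mult_right_zero[symmetric])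
  qed
  note iQ = integral_std_normal_swap_prim(3)[of T x, folded Q_def]
  have "(\<integral>u. fejer u * (weighted_cdf A q y (x - u / T) - cdf ?M (x - u / T)) \<partial>lborel) =
      (\<Sum>i\<in>A. q i * fejer_cdf (T * (x - y i))) - (\<integral>z. fejer_cdf (T * (x - z)) \<partial>?M)"
    unfolding right_diff_distrib[of "fejer _"]
    by (subst Bochner_Integration.integral_diff[OF ifin inorm]) (simp only: fin integral_std_normal_swap_cdf[OF T])
  \<comment> \<open>Both laws have mass 1, so the constants \<open>fejer_cdf 0\<close>
    cancel.\<close>
  also have "\<dots> = (\<Sum>i\<in>A. q i * fejer_prim (T * (x - y i))) - (\<integral>z. fejer_prim (T * (x - z)) \<partial>?M)"
  proof -
    have "(\<Sum>i\<in>A. q i * fejer_cdf (T * (x - y i))) = fejer_cdf 0 + (\<Sum>i\<in>A. q i * fejer_prim (T * (x - y i)))"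
      unfolding fejer_cdf_eq[of "T * _"] distrib_left sum.distrib sum_distrib_right[symmetric] q(2) by simp
    moreover have "(\<integral>z. fejer_cdf (T * (x - z)) \<partial>?M) = fejer_cdf 0 + (\<integral>z. fejer_prim (T * (x - z)) \<partial>?M)"
      unfolding fejer_cdf_eq[of "T * _"]
      by (subst Bochner_Integration.integral_add[OF _ integral_std_normal_swap_prim(1)]) (simp_all add: M.prob_space[simplified])
    ultimately show ?thesis by simp
  qed
  also have "\<dots> = (\<integral>u. indicator {0..1} u * (2 * (1 - u) * P u) - indicator {0..1} u * (2 * (1 - u) * Q u) \<partial>lborel)"
    unfolding eP integral_std_normal_swap_prim(2) Q_def[symmetric] by (rule Bochner_Integration.integral_diff[OF iP iQ, symmetric])
  finally have diff: "(\<integral>u. fejer u * (weighted_cdf A q y (x - u / T) - cdf ?M (x - u / T)) \<partial>lborel) =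
    (\<integral>u. indicator {0..1} u * (2 * (1 - u) * P u) - indicator {0..1} u * (2 * (1 - u) * Q u) \<partial>lborel)" .
  have "\<bar>\<integral>u. indicator {0..1} u * (2 * (1 - u) * P u) - indicator {0..1} u * (2 * (1 - u) * Q u) \<partial>lborel\<bar> \<le>
      (\<integral>u. \<bar>indicator {0..1} u * (2 * (1 - u) * P u) - indicator {0..1} u * (2 * (1 - u) * Q u)\<bar> \<partial>lborel)"
    by (rule integral_abs_bound)
  also have "\<dots> \<le> (\<integral>u. indicator {0..1} u * (2 * (B * T / (1 + (u * T)\<^sup>2))) \<partial>lborel)"
  proof (rule integral_mono_AE)
    show "integrable lborel (\<lambda>u. \<bar>indicator {0..1} u * (2 * (1 - u) * P u) - indicator {0..1} u * (2 * (1 - u) * Q u)\<bar>)"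
      by (intro integrable_abs Bochner_Integration.integrable_diff iP iQ)
    show "integrable lborel (\<lambda>u. indicator {0..1} u * (2 * (B * T / (1 + (u * T)\<^sup>2))))"
      by (rule arctan_integral_bound(1)[OF T B])
    have "AE u in lborel. u \<noteq> (0::real)" by (rule AE_lborel_singleton)
    then show "AE u in lborel. \<bar>indicator {0..1} u * (2 * (1 - u) * P u) - indicator {0..1} u * (2 * (1 - u) * Q u)\<bar> \<le>
       indicator {0..1} u * (2 * (B * T / (1 + (u * T)\<^sup>2)))"
    proof (rule eventually_mono)
      fix u :: real assume u0: "u \<noteq> 0"
      show "\<bar>indicator {0..1} u * (2 * (1 - u) * P u) - indicator {0..1} u * (2 * (1 - u) * Q u)\<bar> \<le>
       indicator {0..1} u * (2 * (B * T / (1 + (u * T)\<^sup>2)))"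
      proof (cases "u \<in> {0..1}")
        case True
        with u0 have u: "0 < u" "u \<le> 1" by auto
        have S: "?S u (T * (x - z)) = sin ((u * T) * (x - z)) / u" for z
          using sinc_scaled_eq[OF u0, of "T * (x - z)"] by (simp only: mult.assoc)
        have P: "P u = (\<Sum>i\<in>A. q i * sin ((u * T) * (x - y i))) / u"
          unfolding P_def S by (simp add: sum_divide_distrib)
        have Q: "Q u = (\<integral>z. sin ((u * T) * (x - z)) \<partial>?M) / u"
          unfolding Q_def S by simp
        have "\<bar>- (u * T)\<bar> \<le> T" using u T by (simp add: abs_mult mult_le_cancel_right1)
        from sin_transform_diff[OF char[OF this]]
        have "\<bar>(\<Sum>i\<in>A. q i * sin ((u * T) * (x - y i))) - (\<integral>z. sin ((u * T) * (x - z)) \<partial>?M)\<bar> \<le> B * (u * T) / (1 + (u * T)\<^sup>2)"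
          using u T by (simp add: abs_mult)
        then have "\<bar>P u - Q u\<bar> \<le> (B * (u * T) / (1 + (u * T)\<^sup>2)) / u"
          unfolding P Q diff_divide_distrib[symmetric] abs_divide abs_of_pos[OF u(1)]
          using u(1) by (intro divide_right_mono) simp_all
        also have "\<dots> = B * T / (1 + (u * T)\<^sup>2)" using u by simp
        finally have PQ: "\<bar>P u - Q u\<bar> \<le> B * T / (1 + (u * T)\<^sup>2)" .
        have "\<bar>2 * (1 - u) * P u - 2 * (1 - u) * Q u\<bar> = 2 * (1 - u) * \<bar>P u - Q u\<bar>"
          using u by (simp flip: right_diff_distrib add: abs_mult)
        also have "\<dots> \<le> 2 * (B * T / (1 + (u * T)\<^sup>2))"
          using u by (intro mult_mono PQ) auto
        finally show ?thesis using True by simp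
      qed simp
    qed
  qed
  also have "\<dots> \<le> 4 * B" by (rule arctan_integral_bound(2)[OF T B])
  finally show ?thesis unfolding diff .
qed

theorem Berry_Esseen_smoothing:
  obtains C where "C \<ge> 0" and "\<And>(A :: 'a set) q y T B x. finite A \<Longrightarrow> (\<And>i. i \<in> A \<Longrightarrow> q i \<ge> 0) \<Longrightarrow> sum q A = 1 \<Longrightarrow>
     T > 0 \<Longrightarrow> B \<ge> 0 \<Longrightarrow>
     (\<And>\<tau>. \<bar>\<tau>\<bar> \<le> T \<Longrightarrow> norm ((\<Sum>i\<in>A. of_real (q i) * iexp (\<tau> * y i)) - char std_normal_distribution \<tau>) \<le> B * \<bar>\<tau>\<bar> / (1 + \<tau>\<^sup>2)) \<Longrightarrow>
     \<bar>weighted_cdf A q y x - cdf std_normal_distribution x\<bar> \<le> C * (B + 1 / T)"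
proof -
  interpret M: real_distribution std_normal_distribution by (rule real_dist_normal_dist)
  obtain C where C: "C \<ge> 0" and smooth: "\<And>F G T B x. mono F \<Longrightarrow> mono G \<Longrightarrow> (\<And>x y. \<bar>G x - G y :: real\<bar> \<le> \<bar>x - y\<bar>) \<Longrightarrow>
     (\<And>x. \<bar>F x - G x\<bar> \<le> 1) \<Longrightarrow> T > 0 \<Longrightarrow>
     (\<And>x. \<bar>\<integral>u. fejer u * (F (x - u / T) - G (x - u / T)) \<partial>lborel\<bar> \<le> B) \<Longrightarrow>
     \<bar>F x - G x\<bar> \<le> C * (B + 1 / T)"
    using smoothing_inequality by blast
  show ?thesis
  proof (rule that[of "4 * C"])
    show "4 * C \<ge> 0" using C by simp
    fix A :: "'a set" and q y and T B x :: real
    assume A: "finite A" and q: "\<And>i. i \<in> A \<Longrightarrow> q i \<ge> 0" "sum q A = 1" and T: "T > 0" and B: "B \<ge> 0"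
      and char: "\<And>\<tau>. \<bar>\<tau>\<bar> \<le> T \<Longrightarrow> norm ((\<Sum>i\<in>A. of_real (q i) * iexp (\<tau> * y i)) - char std_normal_distribution \<tau>) \<le> B * \<bar>\<tau>\<bar> / (1 + \<tau>\<^sup>2)"
    have "\<bar>weighted_cdf A q y x - cdf std_normal_distribution x\<bar> \<le> C * (4 * B + 1 / T)"
    proof (rule smooth[of "weighted_cdf A q y" "cdf std_normal_distribution"])
      show "mono (cdf std_normal_distribution)" by (intro monoI M.cdf_nondecreasing)
      show "\<bar>weighted_cdf A q y x - cdf std_normal_distribution x\<bar> \<le> 1" for x
        using weighted_cdf_bounds[of A q y x, OF q] M.cdf_nonneg[of x] M.cdf_bounded_prob[of x] by linarith
    qed (use A q T B char in \<open>auto intro!: weighted_cdf_mono std_normal_cdf_lipschitz smoothed_difference\<close>)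
    also have "\<dots> \<le> C * (4 * (B + 1 / T))" using T C by (intro mult_left_mono) (auto intro!: divide_right_mono)
    finally show "\<bar>weighted_cdf A q y x - cdf std_normal_distribution x\<bar> \<le> 4 * C * (B + 1 / T)" by (simp only: mult_ac)
  qed
qed

section \<open>Moderate deviations by exponential tilting\<close>

lemma DERIV_std_normal_cdf: "(cdf std_normal_distribution has_real_derivative std_normal_density x) (at x)"
proof -
  interpret real_distribution std_normal_distribution by (rule real_dist_normal_dist)
  let ?a = "x - 1" and ?b = "x + 1"
  have c: "continuous_on {?a..?b} std_normal_density"
    unfolding std_normal_density_def[abs_def] by (intro continuous_intros) auto
  have eq: "cdf std_normal_distribution y = cdf std_normal_distribution ?a + integral {?a..y} std_normal_density"
    if "y \<in> {?a<..<?b}" for y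
  proof -
    have "cdf std_normal_distribution y - cdf std_normal_distribution ?a = measure std_normal_distribution {?a<..y}"
      using that by (intro cdf_diff_eq) auto
    also have "\<dots> = (\<integral>v. std_normal_density v * indicator {?a<..y} v \<partial>lborel)"
      by (rule std_normal_measure) simp
    also have "\<dots> = (LBINT v:{?a..y}. std_normal_density v)"
      unfolding set_lebesgue_integral_def
      by (rule integral_cong_AE) (auto intro!: AE_I[where N = "{?a}"] simp: indicator_def)
    also have "\<dots> = integral {?a..y} std_normal_density"
      using integrable_std_normal_indicator[of "{?a..y}"]
      by (intro set_borel_integral_eq_integral) (simp add: set_integrable_def mult.commute)
    finally show ?thesis by simp
  qed
  have "((\<lambda>y. integral {?a..y} std_normal_density) has_real_derivative std_normal_density x) (at x within {?a..?b})"
    by (rule integral_has_real_derivative[OF c]) simp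
  then have "((\<lambda>y. integral {?a..y} std_normal_density) has_real_derivative std_normal_density x) (at x)"
    by (subst (asm) at_within_interior) auto
  from DERIV_add[OF DERIV_const this]
  have "((\<lambda>y. cdf std_normal_distribution ?a + integral {?a..y} std_normal_density) has_real_derivative std_normal_density x) (at x)"
    by simp
  then show ?thesis
    by (rule has_field_derivative_transform_within_open[of _ _ _ "{?a<..<?b}"]) (auto simp: eq)
qed

text \<open>The density is even, so the sum of the values at x and -x has derivative 0; its limit at
  infinity is 1.\<close>

lemma std_normal_cdf_minus: "cdf std_normal_distribution (- x) = 1 - cdf std_normal_distribution x"
proof -
  interpret real_distribution std_normal_distribution by (rule real_dist_normal_dist)
  let ?F = "cdf std_normal_distribution"
  let ?f = "\<lambda>x. ?F x + ?F (- x)"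
  have "DERIV ?f x :> 0" for x
    using DERIV_add[OF DERIV_std_normal_cdf[of x] DERIV_chain2[OF DERIV_std_normal_cdf DERIV_minus[OF DERIV_ident]]]
    by (simp add: std_normal_density_def)
  then have const: "?f y = ?f x" for y using DERIV_isconst_all[of ?f y x] by blast
  have "(?f \<longlongrightarrow> 1 + 0) at_top"
    by (intro tendsto_add cdf_lim_at_top_prob filterlim_compose[OF cdf_lim_at_bot filterlim_uminus_at_bot_at_top])
  then have "((\<lambda>_. ?f x) \<longlongrightarrow> 1 + 0) (at_top :: real filter)"
    by (rule Lim_transform_eventually) (intro always_eventually allI const)
  then have "?f x = 1" by (simp add: tendsto_const_iff)
  then show ?thesis by simp
qed

text \<open>The indicator of z <= v, weighted by s * exp (- s * v), integrates to exp (- s * z).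
  Summed over the points of a law, this turns an exponential expectation into a mixture of
  distribution functions.\<close>

lemma exponential_tail_integral:
  fixes s z :: real
  assumes "s > 0"
  shows "has_bochner_integral lborel (\<lambda>v. s * exp (- s * v) * indicator {z..} v) (exp (- s * z))"
proof (rule has_bochner_integral_nn_integral)
  have "(\<integral>\<^sup>+v. ennreal (s * exp (- s * v)) * indicator {z..} v \<partial>lborel) = ennreal (0 - (- exp (- s * z)))"
  proof (rule nn_integral_FTC_atLeast[where F = "\<lambda>v. - exp (- s * v)"])
    show "((\<lambda>v. - exp (- s * v)) has_real_derivative s * exp (- s * v)) (at v)" for v
      by (auto intro!: derivative_eq_intros)
    have "filterlim (\<lambda>v. - s * v) at_bot at_top" using assms by real_asymp
    then have "((\<lambda>v. exp (- s * v)) \<longlongrightarrow> 0) at_top" by (rule filterlim_compose[OF exp_at_bot])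
    from tendsto_minus[OF this] show "((\<lambda>v. - exp (- s * v)) \<longlongrightarrow> 0) at_top" by simp
  qed (use assms in auto)
  then show "(\<integral>\<^sup>+v. ennreal (s * exp (- s * v) * indicator {z..} v) \<partial>lborel) = ennreal (exp (- s * z))"
    by (simp add: indicator_mult_ennreal[symmetric] mult.commute)
qed (use assms in auto)

text \<open>The value \<open>exp (s\<^sup>2 / 2) * (1 - \<Phi> s)\<close> is the expectation of \<open>exp (- s * Z)\<close> on \<open>Z > 0\<close> for
  a standard normal variable \<open>Z\<close>, written as a mixture of distribution functions.\<close>

lemma normal_tail_mixture:
  assumes s: "s > 0"
  shows "has_bochner_integral lborel
    (\<lambda>v. s * exp (- s * v) * (cdf std_normal_distribution v - cdf std_normal_distribution 0) * indicator {0..} v)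
    (exp (s\<^sup>2 / 2) * (1 - cdf std_normal_distribution s))" (is "has_bochner_integral _ _ ?J")
    and "s * (exp (s\<^sup>2 / 2) * (1 - cdf std_normal_distribution s)) \<le> 1"
proof -
  interpret real_distribution std_normal_distribution by (rule real_dist_normal_dist)
  let ?F = "cdf std_normal_distribution" and ?d = "std_normal_density"
  have [measurable]: "?F \<in> borel_measurable borel"
    by (intro borel_measurable_mono monoI cdf_nondecreasing)
  have lim: "((\<lambda>v. exp (- s * v)) \<longlongrightarrow> 0) at_top"
  proof -
    have "filterlim (\<lambda>v. - s * v) at_bot at_top" using s by real_asymp
    then show ?thesis by (rule filterlim_compose[OF exp_at_bot])
  qed
  \<comment> \<open>The primitive comes from completing the square: exp (- s * v) times the density
    at v equals exp (s^2 / 2) times the density at v + s.\<close>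
  let ?P = "\<lambda>v. exp (s\<^sup>2 / 2) * (?F (v + s) - ?F s) - exp (- s * v) * (?F v - ?F 0)"
  have nn: "(\<integral>\<^sup>+v. ennreal (s * exp (- s * v) * (?F v - ?F 0)) * indicator {0..} v \<partial>lborel) = ennreal (?J - ?P 0)"
  proof (rule nn_integral_FTC_atLeast[where F = ?P and T = ?J])
    show "(?P has_real_derivative s * exp (- s * v) * (?F v - ?F 0)) (at v)" for v
    proof -
      have "exp (s\<^sup>2 / 2) * ?d (v + s) = exp (- s * v) * ?d v"
      proof -
        have "s\<^sup>2 / 2 + - (v + s)\<^sup>2 / 2 = - s * v + - v\<^sup>2 / 2" by (simp add: power2_eq_square field_simps)
        then have "exp (s\<^sup>2 / 2) * exp (- (v + s)\<^sup>2 / 2) = exp (- s * v) * exp (- v\<^sup>2 / 2)"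
          by (simp only: exp_add[symmetric])
        then show ?thesis by (simp add: std_normal_density_def)
      qed
      then show ?thesis
        by (auto intro!: derivative_eq_intros DERIV_chain2[OF DERIV_std_normal_cdf] DERIV_std_normal_cdf
              simp: algebra_simps)
    qed
    show "0 \<le> s * exp (- s * v) * (?F v - ?F 0)" if "0 \<le> v" for v
      using s cdf_nondecreasing[OF that] by simp
    have "((\<lambda>v. exp (s\<^sup>2 / 2) * (?F (v + s) - ?F s) - exp (- s * v) * (?F v - ?F 0)) \<longlongrightarrow>
       exp (s\<^sup>2 / 2) * (1 - ?F s) - 0 * (1 - ?F 0)) at_top"
      by (intro tendsto_intros lim cdf_lim_at_top_prob filterlim_compose[OF cdf_lim_at_top_prob])
         (auto intro!: filterlim_at_top_add_at_top filterlim_tendsto_add_at_top filterlim_ident tendsto_const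
           simp: add.commute[of _ s])
    then show "(?P \<longlongrightarrow> ?J) at_top" by simp
  qed measurable
  show h: "has_bochner_integral lborel (\<lambda>v. s * exp (- s * v) * (?F v - ?F 0) * indicator {0..} v) ?J"
  proof (rule has_bochner_integral_nn_integral)
    show "AE v in lborel. 0 \<le> s * exp (- s * v) * (?F v - ?F 0) * indicator {0..} v"
      using s cdf_nondecreasing[of 0] by (auto simp: indicator_def)
    show "0 \<le> ?J" using cdf_bounded_prob[of s] by simp
    show "(\<integral>\<^sup>+v. ennreal (s * exp (- s * v) * (?F v - ?F 0) * indicator {0..} v) \<partial>lborel) = ennreal ?J"
      using nn by (simp add: indicator_mult_ennreal[symmetric] mult.commute)
  qed measurable
  have "(\<integral>\<^sup>+v. ennreal (s * exp (- s * v) * v) * indicator {0..} v \<partial>lborel) = ennreal (0 - (- (0 + 1 / s) * exp (- s * 0)))"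
  proof (rule nn_integral_FTC_atLeast[where F = "\<lambda>v. - (v + 1 / s) * exp (- s * v)"])
    show "((\<lambda>v. - (v + 1 / s) * exp (- s * v)) has_real_derivative s * exp (- s * v) * v) (at v)" for v
      using s by (auto intro!: derivative_eq_intros simp: field_simps)
    show "((\<lambda>v. - (v + 1 / s) * exp (- s * v)) \<longlongrightarrow> 0) at_top" using s by real_asymp
  qed (use s in auto)
  then have h2: "has_bochner_integral lborel (\<lambda>v. s * exp (- s * v) * v * indicator {0..} v) (1 / s)"
    using s by (intro has_bochner_integral_nn_integral AE_I2)
      (simp_all add: indicator_mult_ennreal[symmetric] mult.commute, simp add: indicator_def)
  \<comment> \<open>A bound on the Mills ratio: the normal distribution function has slope at most
    1, so the mixture is at most the mean 1 / s of the exponential law of rate s.\<close>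
  have "?J \<le> 1 / s"
    unfolding has_bochner_integral_integral_eq[OF h, symmetric] has_bochner_integral_integral_eq[OF h2, symmetric]
  proof (rule integral_mono[OF integrable.intros[OF h] integrable.intros[OF h2]])
    fix v :: real
    show "s * exp (- s * v) * (?F v - ?F 0) * indicator {0..} v \<le> s * exp (- s * v) * v * indicator {0..} v"
      using s std_normal_cdf_lipschitz[of v 0] by (auto simp: indicator_def intro!: mult_left_mono)
  qed
  then show "s * ?J \<le> 1" using s by (simp add: field_simps)
qed

lemma std_normal_cdf_LBINT:
  "(LBINT v:{..t}. exp (- (v\<^sup>2 / 2)) / sqrt (2 * pi)) = cdf std_normal_distribution t"
  unfolding cdf_def by (subst std_normal_measure)
    (auto simp: set_lebesgue_integral_def std_normal_density_def mult.commute intro!: Bochner_Integration.integral_cong)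

text \<open>The mixing density s * exp (- s * v) has mass 1 on [0, infinity), so a uniform error of
  the distribution functions passes to the expectations without loss.\<close>

lemma exponential_mixture_compare:
  fixes q z :: "'a \<Rightarrow> real"
  assumes A: "finite A" and s: "s > 0" and z: "\<And>i. i \<in> A \<Longrightarrow> z i \<ge> 0"
    and close: "\<And>v. v \<ge> 0 \<Longrightarrow>
      \<bar>(\<Sum>i\<in>A. q i * of_bool (z i \<le> v)) - (cdf std_normal_distribution v - cdf std_normal_distribution 0)\<bar> \<le> e"
  shows "\<bar>(\<Sum>i\<in>A. q i * exp (- s * z i)) - exp (s\<^sup>2 / 2) * (1 - cdf std_normal_distribution s)\<bar> \<le> e"
proof -
  let ?F = "cdf std_normal_distribution"
  have e0: "e \<ge> 0" using close[of 0] by linarith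
  have 1: "has_bochner_integral lborel (\<lambda>v. \<Sum>i\<in>A. q i * (s * exp (- s * v) * indicator {z i..} v)) (\<Sum>i\<in>A. q i * exp (- s * z i))"
    by (intro has_bochner_integral_sum has_bochner_integral_mult_right exponential_tail_integral s)
  note 2 = normal_tail_mixture(1)[OF s]
  note 3 = has_bochner_integral_diff[OF 1 2]
  note 4 = has_bochner_integral_mult_right[OF exponential_tail_integral[OF s, of 0], of e]
  have le: "\<bar>(\<Sum>i\<in>A. q i * (s * exp (- s * v) * indicator {z i..} v)) - s * exp (- s * v) * (?F v - ?F 0) * indicator {0..} v\<bar>
     \<le> e * (s * exp (- s * v) * indicator {0..} v)" for v
  proof (cases "v \<ge> 0")
    case True
    have "(\<Sum>i\<in>A. q i * (s * exp (- s * v) * indicator {z i..} v)) = s * exp (- s * v) * (\<Sum>i\<in>A. q i * of_bool (z i \<le> v))"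
      unfolding sum_distrib_left by (intro sum.cong) (auto simp: indicator_def)
    then have "\<bar>(\<Sum>i\<in>A. q i * (s * exp (- s * v) * indicator {z i..} v)) - s * exp (- s * v) * (?F v - ?F 0) * indicator {0..} v\<bar>
       = s * exp (- s * v) * \<bar>(\<Sum>i\<in>A. q i * of_bool (z i \<le> v)) - (?F v - ?F 0)\<bar>"
      using s True by (simp flip: right_diff_distrib add: abs_mult)
    also have "\<dots> \<le> s * exp (- s * v) * e"
      using close[OF True] s by (intro mult_left_mono) auto
    finally show ?thesis using True by (simp add: mult_ac)
  next
    case False
    have "indicator {z i..} v = (0::real)" if "i \<in> A" for i using False z[OF that] by (auto simp: indicator_def)
    then show ?thesis using False by simp
  qed
  have "\<bar>(\<Sum>i\<in>A. q i * exp (- s * z i)) - exp (s\<^sup>2 / 2) * (1 - ?F s)\<bar> =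
     \<bar>\<integral>v. (\<Sum>i\<in>A. q i * (s * exp (- s * v) * indicator {z i..} v)) - s * exp (- s * v) * (?F v - ?F 0) * indicator {0..} v \<partial>lborel\<bar>"
    unfolding has_bochner_integral_integral_eq[OF 3] ..
  also have "\<dots> \<le> (\<integral>v. e * (s * exp (- s * v) * indicator {0..} v) \<partial>lborel)"
    using le by (intro integral_abs_bound_integral integrable.intros[OF 3] integrable.intros[OF 4]) auto
  also have "\<dots> = e" using has_bochner_integral_integral_eq[OF 4] by simp
  finally show ?thesis .
qed

text \<open>The half of the Gaussian exponent that survives the error estimate pays for the factor 1
  + x^2 and still yields the decay 1 / (1 + x^2) asked for by the smoothing inequality. With y = x^2
  / 4, the constant 32 matches 16 y^2 against y^2 / 2 in the exponential series.\<close>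

lemma polynomial_gaussian_bound: "(1 + x\<^sup>2) * exp (- (x\<^sup>2 / 4)) \<le> 32 / (1 + x\<^sup>2 :: real)"
proof -
  define y where "y = x\<^sup>2 / 4"
  have y0: "y \<ge> 0" by (simp add: y_def)
  have "(1 + 4 * y)\<^sup>2 \<le> 32 * (1 + y + y\<^sup>2 / 2)"
    using y0 by (simp add: power2_eq_square algebra_simps)
  also have "\<dots> \<le> 32 * exp y" using exp_lower_Taylor_quadratic[OF y0] by simp
  finally have "(1 + x\<^sup>2) * (1 + x\<^sup>2) * exp (- y) \<le> 32"
    by (simp add: y_def exp_minus power2_eq_square field_simps)
  moreover have "1 + x\<^sup>2 > 0" by (simp add: add_pos_nonneg)
  ultimately show ?thesis by (simp add: y_def field_simps)
qed

text \<open>F and G are tail probabilities, \<open>JF\<close> and J the corresponding tilted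
  expectations; going back multiplies by exp (- t^2 / 2). The exponent error r is only O(|t| (1 +
  t^2) / n), one power of |t| too large, and the bound |t| * J <= 1 removes it.\<close>

lemma tail_comparison:
  fixes r t n :: real
  assumes JF: "JF = exp (t\<^sup>2) / m * F" and m: "m = exp (t\<^sup>2 / 2 + r)" and J: "J = exp (t\<^sup>2 / 2) * G"
    and J0: "J \<ge> 0" and tJ: "\<bar>t\<bar> * J \<le> 1" and e: "\<bar>JF - J\<bar> \<le> e"
    and r: "\<bar>r\<bar> \<le> C * (\<bar>t\<bar> * (1 + t\<^sup>2)) / n" "\<bar>r\<bar> \<le> M" and n: "n > 0" and C: "C \<ge> 0"
  shows "\<bar>F - G\<bar> \<le> exp M * (e + C * (1 + t\<^sup>2) / n) * exp (- (t\<^sup>2 / 2))"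
proof -
  have e0: "e \<ge> 0" using e by linarith
  have F: "F = exp (- (t\<^sup>2 / 2)) * (exp r * JF)"
    unfolding JF m by (simp add: exp_add exp_minus field_simps power2_eq_square flip: exp_add)
  have G: "G = exp (- (t\<^sup>2 / 2)) * J"
    unfolding J by (simp add: exp_minus)
  have erM: "exp r \<le> exp M" "exp \<bar>r\<bar> \<le> exp M" using r(2) by auto
  have "\<bar>exp r - 1\<bar> * J \<le> (\<bar>r\<bar> * exp \<bar>r\<bar>) * J"
    using norm_exp_minus_1_bound[of r] J0 by (intro mult_right_mono) auto
  also have "\<dots> \<le> (C * (\<bar>t\<bar> * (1 + t\<^sup>2)) / n * exp M) * J"
    using r erM J0 n C by (intro mult_right_mono mult_mono) auto
  also have "\<dots> = exp M * (C * (1 + t\<^sup>2) / n) * (\<bar>t\<bar> * J)" by simp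
  also have "\<dots> \<le> exp M * (C * (1 + t\<^sup>2) / n) * 1"
    using tJ n C by (intro mult_left_mono mult_nonneg_nonneg divide_nonneg_pos) auto
  finally have 1: "\<bar>exp r - 1\<bar> * J \<le> exp M * (C * (1 + t\<^sup>2) / n)" by simp
  have 2: "exp r * \<bar>JF - J\<bar> \<le> exp M * e"
    using erM e by (intro mult_mono) auto
  have "F - G = exp (- (t\<^sup>2 / 2)) * (exp r * (JF - J) + (exp r - 1) * J)"
    unfolding F G by (simp add: algebra_simps)
  also have "\<bar>\<dots>\<bar> \<le> exp (- (t\<^sup>2 / 2)) * (exp r * \<bar>JF - J\<bar> + \<bar>exp r - 1\<bar> * J)"
    using J0 abs_triangle_ineq[of "exp r * (JF - J)" "(exp r - 1) * J"] by (simp add: abs_mult)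
  also have "\<dots> \<le> exp (- (t\<^sup>2 / 2)) * (exp M * e + exp M * (C * (1 + t\<^sup>2) / n))"
    using 1 2 by (intro mult_left_mono add_mono) auto
  finally show ?thesis by (simp add: algebra_simps)
qed

section \<open>The characteristic function of the tilted law\<close>

lemma Gaussian_error_increment:
  fixes R :: "complex \<Rightarrow> complex"
  assumes hol: "R holomorphic_on ball 0 d"
    and R': "\<And>w. norm w < d \<Longrightarrow> norm (deriv R w) \<le> C * (1 + (norm w)\<^sup>2) / n"
    and C: "C \<ge> 0" "n > 0" and r: "r < d" "norm v \<le> r" "norm w \<le> r"
  shows "norm (R v - R w) \<le> C * (1 + r\<^sup>2) / n * norm (v - w)"
proof (rule field_differentiable_bound[of "cball 0 r" R "deriv R"])
  fix u assume u: "u \<in> cball (0::complex) r"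
  then show "(R has_field_derivative deriv R u) (at u within cball 0 r)"
    using r by (intro DERIV_subset[OF holomorphic_derivI[OF hol open_ball]]) auto
  have "norm (deriv R u) \<le> C * (1 + (norm u)\<^sup>2) / n" using u r by (intro R') auto
  also have "\<dots> \<le> C * (1 + r\<^sup>2) / n"
    using u C by (intro divide_right_mono mult_left_mono add_left_mono power_mono) auto
  finally show "norm (deriv R u) \<le> C * (1 + r\<^sup>2) / n" .
qed (use r in auto)

text \<open>The error exponent may use up half of the Gaussian exponent \<tau>^2 / 2: the cubic part
  is at most \<tau>^2 / 8 by the choice of \<epsilon>, and the part linear in \<tau> is absorbed
  into another \<tau>^2 / 8 and a constant.\<close>

lemma exponent_bound:
  fixes C \<epsilon> M n \<tau> t :: real
  assumes n: "n \<ge> 1" and C: "C \<ge> 0" and \<epsilon>: "C * \<epsilon> \<le> 1 / 8" and \<tau>: "\<bar>\<tau>\<bar> \<le> \<epsilon> * n"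
    and t: "1 + t\<^sup>2 \<le> M * n" and M: "M \<ge> 0"
  shows "C * (1 + (t\<^sup>2 + \<tau>\<^sup>2)) / n * \<bar>\<tau>\<bar> \<le> \<tau>\<^sup>2 / 4 + 2 * (C * M)\<^sup>2"
proof -
  have "C * (1 + (t\<^sup>2 + \<tau>\<^sup>2)) / n * \<bar>\<tau>\<bar> = C * \<bar>\<tau>\<bar> * ((1 + t\<^sup>2) / n) + C * \<tau>\<^sup>2 * (\<bar>\<tau>\<bar> / n)"
    using n by (simp add: field_simps)
  also have "\<dots> \<le> C * \<bar>\<tau>\<bar> * M + C * \<tau>\<^sup>2 * \<epsilon>"
    using n C t \<tau> by (intro add_mono mult_left_mono) (auto simp: field_simps)
  also have "C * \<tau>\<^sup>2 * \<epsilon> = (C * \<epsilon>) * \<tau>\<^sup>2" by simp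
  also have "\<dots> \<le> 1 / 8 * \<tau>\<^sup>2" by (intro mult_right_mono \<epsilon>) auto
  also have "C * \<bar>\<tau>\<bar> * M \<le> \<tau>\<^sup>2 / 8 + 2 * (C * M)\<^sup>2"
    using sum_squares_bound[of "\<bar>\<tau>\<bar> / 2" "2 * (C * M)"] by (simp add: power2_eq_square field_simps)
  finally show ?thesis by simp
qed

text \<open>The recentred tilted law has characteristic function M(t + i \<tau>) exp(-i \<tau> t) /
  M(t), where M is the moment generating function. The quadratic parts combine exactly to
  exp(-\<tau>^2 / 2), leaving exp(R(t + i \<tau>) - R(t)); the bound on the derivative of R makes
  this close to 1 with a factor |\<tau>|, as needed near \<tau> = 0.\<close>

lemma tilted_char_bound:
  fixes R :: "complex \<Rightarrow> complex" and A :: "'a set" and p Y :: "'a \<Rightarrow> real"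
  assumes hol: "R holomorphic_on ball 0 d"
    and R': "\<And>w. norm w < d \<Longrightarrow> norm (deriv R w) \<le> C * (1 + (norm w)\<^sup>2) / n"
    and mgf: "\<And>w. norm w < d \<Longrightarrow> (\<Sum>i\<in>A. of_real (p i) * exp (w * of_real (Y i))) = exp (w\<^sup>2 / 2 + R w)"
    and n: "n \<ge> 1" and C: "C \<ge> 0" and \<epsilon>: "C * \<epsilon> \<le> 1 / 8" and \<tau>: "\<bar>\<tau>\<bar> \<le> \<epsilon> * n"
    and t: "1 + t\<^sup>2 \<le> M * n" and M: "M \<ge> 0" and d: "\<bar>t\<bar> + \<epsilon> * n < d"
    and m: "m = (\<Sum>i\<in>A. p i * exp (t * Y i))" 
  shows "norm ((\<Sum>i\<in>A. of_real (p i * exp (t * Y i) / m) * iexp (\<tau> * (Y i - t))) - char std_normal_distribution \<tau>)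
    \<le> (32 * exp (2 * (C * M)\<^sup>2) * C * (1 + t\<^sup>2) / n) * \<bar>\<tau>\<bar> / (1 + \<tau>\<^sup>2)"
proof -
  define w where "w = Complex t \<tau>"
  have w: "w = of_real t + \<i> * of_real \<tau>" by (simp add: w_def complex_eq_iff)
  have nw2: "(norm w)\<^sup>2 = t\<^sup>2 + \<tau>\<^sup>2" by (simp add: w_def cmod_def)
  have nw: "norm w \<le> \<bar>t\<bar> + \<bar>\<tau>\<bar>" unfolding w by (rule order_trans[OF norm_triangle_ineq]) (simp add: norm_mult)
  have wd: "norm w < d" using nw \<tau> d by linarith
  have td: "norm (of_real t :: complex) < d" using d \<tau> by simp
  have tw: "norm (of_real t :: complex) \<le> norm w" using abs_Re_le_cmod[of w] by (simp add: w_def)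
  have cm: "of_real m = exp ((of_real t)\<^sup>2 / 2 + R (of_real t))"
    using mgf[OF td] unfolding m by (simp flip: exp_of_real)
  then have m0: "m \<noteq> 0" by (metis exp_not_eq_zero of_real_0)
  define D where "D = R w - R (of_real t)"
  have "(\<Sum>i\<in>A. of_real (p i * exp (t * Y i) / m) * iexp (\<tau> * (Y i - t))) =
     (\<Sum>i\<in>A. of_real (p i) * exp (w * of_real (Y i))) * exp (- (\<i> * of_real (\<tau> * t))) / of_real m"
    unfolding sum_distrib_right sum_divide_distrib
  proof (rule sum.cong[OF refl])
    fix i
    have "exp (of_real (t * Y i)) * iexp (\<tau> * (Y i - t)) = exp (w * of_real (Y i)) * exp (- (\<i> * of_real (\<tau> * t)))"
      unfolding w exp_add[symmetric] by (simp add: algebra_simps)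
    then show "of_real (p i * exp (t * Y i) / m) * iexp (\<tau> * (Y i - t)) =
       of_real (p i) * exp (w * of_real (Y i)) * exp (- (\<i> * of_real (\<tau> * t))) / of_real m"
      by (simp only: of_real_mult of_real_divide exp_of_real[symmetric] times_divide_eq_left mult.assoc)
  qed
  also have "\<dots> = exp (w\<^sup>2 / 2 + R w) * exp (- (\<i> * of_real (\<tau> * t))) / exp ((of_real t)\<^sup>2 / 2 + R (of_real t))"
    unfolding mgf[OF wd] cm ..
  also have "\<dots> = exp (of_real (- \<tau>\<^sup>2 / 2)) * exp D"
  proof -
    have "w\<^sup>2 / 2 + R w + - (\<i> * of_real (\<tau> * t)) - ((of_real t)\<^sup>2 / 2 + R (of_real t)) = of_real (- \<tau>\<^sup>2 / 2) + D"
      unfolding w D_def by (simp add: power2_eq_square field_simps)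
    then show ?thesis by (simp only: exp_add[symmetric] exp_diff[symmetric])
  qed
  finally have "(\<Sum>i\<in>A. of_real (p i * exp (t * Y i) / m) * iexp (\<tau> * (Y i - t))) - char std_normal_distribution \<tau> =
      of_real (exp (- \<tau>\<^sup>2 / 2)) * (exp D - 1)"
    unfolding char_std_normal_distribution exp_of_real by (simp only: right_diff_distrib mult_1_right)
  then have "norm ((\<Sum>i\<in>A. of_real (p i * exp (t * Y i) / m) * iexp (\<tau> * (Y i - t))) - char std_normal_distribution \<tau>) =
      exp (- \<tau>\<^sup>2 / 2) * norm (exp D - 1)" by (simp add: norm_mult)
  also have "\<dots> \<le> exp (- \<tau>\<^sup>2 / 2) * (norm D * exp (norm D))"
    by (intro mult_left_mono norm_exp_minus_1_bound) auto
  also have "\<dots> \<le> exp (- \<tau>\<^sup>2 / 2) * ((C * (1 + (t\<^sup>2 + \<tau>\<^sup>2)) / n * \<bar>\<tau>\<bar>) * exp (\<tau>\<^sup>2 / 4 + 2 * (C * M)\<^sup>2))"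
  proof -
    have "norm D \<le> C * (1 + (norm w)\<^sup>2) / n * norm (w - of_real t)"
      unfolding D_def by (rule Gaussian_error_increment[OF hol R' C]) (use n wd tw in auto)
    also have "norm (w - of_real t) = \<bar>\<tau>\<bar>" unfolding w by (simp add: norm_mult)
    finally have D: "norm D \<le> C * (1 + (t\<^sup>2 + \<tau>\<^sup>2)) / n * \<bar>\<tau>\<bar>" by (simp add: nw2)
    then have "norm D \<le> \<tau>\<^sup>2 / 4 + 2 * (C * M)\<^sup>2" using exponent_bound[OF n C \<epsilon> \<tau> t M] by linarith
    then show ?thesis using D by (intro mult_left_mono mult_mono) (use C n in \<open>auto intro!: divide_nonneg_pos mult_nonneg_nonneg add_nonneg_nonneg\<close>)
  qed
  also have "\<dots> \<le> exp (- \<tau>\<^sup>2 / 2) * ((C * ((1 + t\<^sup>2) * (1 + \<tau>\<^sup>2)) / n * \<bar>\<tau>\<bar>) * exp (\<tau>\<^sup>2 / 4 + 2 * (C * M)\<^sup>2))"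
  proof -
    have "1 + (t\<^sup>2 + \<tau>\<^sup>2) \<le> (1 + t\<^sup>2) * (1 + \<tau>\<^sup>2)" by (simp add: algebra_simps)
    then show ?thesis using C n by (intro mult_left_mono mult_right_mono divide_right_mono) auto
  qed
  also have "\<dots> = (exp (2 * (C * M)\<^sup>2) * C * (1 + t\<^sup>2) / n) * \<bar>\<tau>\<bar> * ((1 + \<tau>\<^sup>2) * exp (- (\<tau>\<^sup>2 / 4)))"
  proof -
    have "exp (- \<tau>\<^sup>2 / 2) * exp (\<tau>\<^sup>2 / 4 + 2 * (C * M)\<^sup>2) = exp (2 * (C * M)\<^sup>2) * exp (- (\<tau>\<^sup>2 / 4))"
      unfolding exp_add[symmetric] by (simp add: field_simps)
    then show ?thesis by (simp add: mult_ac)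
  qed
  also have "\<dots> \<le> (exp (2 * (C * M)\<^sup>2) * C * (1 + t\<^sup>2) / n) * \<bar>\<tau>\<bar> * (32 / (1 + \<tau>\<^sup>2))"
    using C n by (intro mult_left_mono polynomial_gaussian_bound) auto
  also have "\<dots> = (32 * exp (2 * (C * M)\<^sup>2) * C * (1 + t\<^sup>2) / n) * \<bar>\<tau>\<bar> / (1 + \<tau>\<^sup>2)" by simp
  finally show ?thesis .
qed

text \<open>The right tail for t > 0 and the left tail for t < 0 are recovered from the tilted law,
  so that the factor exp (-|t| z) always has z >= 0. The value 2 * \<eta> arises because the mass
  between the centre and a distance v is a difference of two distribution functions.\<close>

lemma tail_from_cdf_bound:
  fixes A :: "'a set" and p Y :: "'a \<Rightarrow> real"
  assumes A: "finite A" and p: "\<And>i. i \<in> A \<Longrightarrow> p i \<ge> 0" "sum p A = 1"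
    and m: "m = (\<Sum>i\<in>A. p i * exp (t * Y i))" and mr: "m = exp (t\<^sup>2 / 2 + r)"
    and cdf: "\<And>x. \<bar>weighted_cdf A (\<lambda>i. p i * exp (t * Y i) / m) (\<lambda>i. Y i - t) x - cdf std_normal_distribution x\<bar> \<le> \<eta>"
    and r: "\<bar>r\<bar> \<le> C * (\<bar>t\<bar> * (1 + t\<^sup>2)) / n" "\<bar>r\<bar> \<le> M" and n: "n > 0" and C: "C \<ge> 0"
  shows "\<bar>weighted_cdf A p Y t - cdf std_normal_distribution t\<bar> \<le> exp M * (2 * \<eta> + C * (1 + t\<^sup>2) / n) * exp (- (t\<^sup>2 / 2))"
proof -
  interpret N: real_distribution std_normal_distribution by (rule real_dist_normal_dist)
  let ?F = "cdf std_normal_distribution" and ?q = "\<lambda>i. p i * exp (t * Y i) / m"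
  have m0: "m > 0" by (simp add: mr)
  have q: "?q i \<ge> 0" if "i \<in> A" for i using p(1)[OF that] m0 by simp
  have \<eta>0: "\<eta> \<ge> 0" using cdf[of 0] by linarith
  have M0: "M \<ge> 0" using r by linarith
  have J0: "exp (s\<^sup>2 / 2) * (1 - ?F s) \<ge> 0" for s using N.cdf_bounded_prob[of s] by simp
  consider "t > 0" | "t = 0" | "t < 0" by linarith
  then show ?thesis
  proof cases
    case 1
    let ?B = "{i \<in> A. Y i > t}"
    have B: "finite ?B" using A by simp
    have "\<bar>(\<Sum>i\<in>?B. ?q i * exp (- t * (Y i - t))) - exp (t\<^sup>2 / 2) * (1 - ?F t)\<bar> \<le> 2 * \<eta>"
    proof (rule exponential_mixture_compare[OF B 1])
      fix v :: real assume v: "v \<ge> 0"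
      have "(\<Sum>i\<in>?B. ?q i * of_bool (Y i - t \<le> v)) =
        weighted_cdf A ?q (\<lambda>i. Y i - t) v - weighted_cdf A ?q (\<lambda>i. Y i - t) 0"
        unfolding weighted_cdf_def sum_subtractf[symmetric] using v
        by (intro sum.mono_neutral_cong_left A) (auto simp: of_bool_def)
      then show "\<bar>(\<Sum>i\<in>?B. ?q i * of_bool (Y i - t \<le> v)) - (?F v - ?F 0)\<bar> \<le> 2 * \<eta>"
        using cdf[of v] cdf[of 0] by linarith
    qed auto
    moreover have "(\<Sum>i\<in>?B. ?q i * exp (- t * (Y i - t))) = exp (t\<^sup>2) / m * (1 - weighted_cdf A p Y t)"
    proof -
      have "1 - weighted_cdf A p Y t = (\<Sum>i\<in>?B. p i)"
        unfolding weighted_cdf_def p(2)[symmetric] sum_subtractf[symmetric]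
        by (intro sum.mono_neutral_cong_right A) auto
      moreover have q_exp: "?q i * exp (- t * (Y i - t)) = exp (t\<^sup>2) / m * p i" for i
        by (simp add: field_simps power2_eq_square flip: exp_add)
      ultimately show ?thesis by (simp only: q_exp sum_distrib_left)
    qed
    ultimately have "\<bar>(1 - weighted_cdf A p Y t) - (1 - ?F t)\<bar> \<le> exp M * (2 * \<eta> + C * (1 + t\<^sup>2) / n) * exp (- (t\<^sup>2 / 2))"
      using normal_tail_mixture(2)[OF 1] 1
      by (intro tail_comparison[OF _ mr refl J0 _ _ r n C]) auto
    then show ?thesis by (simp add: abs_minus_commute)
  next
    case 2
    then have "m = 1" using m p(2) by simp
    then have "\<bar>weighted_cdf A p Y t - ?F t\<bar> \<le> \<eta>" using cdf[of 0] 2 by simp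
    also have "\<dots> \<le> 1 * (2 * \<eta> + C * (1 + t\<^sup>2) / n)" using \<eta>0 C n by simp
    also have "\<dots> \<le> exp M * (2 * \<eta> + C * (1 + t\<^sup>2) / n)"
      using \<eta>0 C n M0 by (intro mult_right_mono) auto
    finally show ?thesis using 2 by simp
  next
    case 3
    then have s: "- t > 0" by simp
    let ?B = "{i \<in> A. Y i \<le> t}" and ?W = "weighted_cdf A ?q (\<lambda>i. Y i - t)"
    have B: "finite ?B" using A by simp
    have "\<bar>(\<Sum>i\<in>?B. ?q i * exp (- (- t) * (t - Y i))) - exp ((- t)\<^sup>2 / 2) * (1 - ?F (- t))\<bar> \<le> 2 * \<eta>"
    proof (rule exponential_mixture_compare[OF B s])
      fix v :: real assume v: "v \<ge> 0"
      \<comment> \<open>The strict inequality makes L a left limit of the tilted distribution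
        function, as the closed condition t - Y i <= v demands. L lies between the values at - v - h
        and - v for every h > 0, and the Lipschitz bound for the normal law lets h tend to
        0.\<close>
      define L where "L = (\<Sum>i\<in>A. ?q i * of_bool (Y i - t < - v))"
      have L1: "L \<le> ?F (- v) + \<eta>"
      proof -
        have "L \<le> ?W (- v)"
          unfolding L_def weighted_cdf_def using q by (intro sum_mono mult_left_mono) auto
        then show ?thesis using cdf[of "- v"] by linarith
      qed
      have L2: "?F (- v) - \<eta> \<le> L"
      proof (rule field_le_epsilon)
        fix h :: real assume h: "h > 0"
        have "?W (- v - h) \<le> L"
          unfolding L_def weighted_cdf_def using q h by (intro sum_mono mult_left_mono) auto
        then show "?F (- v) - \<eta> \<le> L + h"
          using cdf[of "- v - h"] std_normal_cdf_lipschitz[of "- v" "- v - h"] h by linarith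
      qed
      have "(\<Sum>i\<in>?B. ?q i * of_bool (t - Y i \<le> v)) = ?W 0 - L"
        unfolding L_def weighted_cdf_def sum_subtractf[symmetric] using v
        by (intro sum.mono_neutral_cong_left A) (auto simp: of_bool_def)
      moreover have "?F v - ?F 0 = ?F 0 - ?F (- v)"
        using std_normal_cdf_minus[of v] std_normal_cdf_minus[of 0] by simp
      ultimately show "\<bar>(\<Sum>i\<in>?B. ?q i * of_bool (t - Y i \<le> v)) - (?F v - ?F 0)\<bar> \<le> 2 * \<eta>"
        using L1 L2 cdf[of 0] by linarith
    qed auto
    moreover have "(\<Sum>i\<in>?B. ?q i * exp (- (- t) * (t - Y i))) = exp (t\<^sup>2) / m * weighted_cdf A p Y t"
    proof -
      have "weighted_cdf A p Y t = (\<Sum>i\<in>?B. p i)"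
        unfolding weighted_cdf_def by (intro sum.mono_neutral_cong_right A) auto
      moreover have q_exp: "?q i * exp (- (- t) * (t - Y i)) = exp (t\<^sup>2) / m * p i" for i
        by (simp add: field_simps power2_eq_square flip: exp_add)
      ultimately show ?thesis by (simp only: q_exp sum_distrib_left)
    qed
    moreover have "1 - ?F (- t) = ?F t" using std_normal_cdf_minus[of t] by simp
    ultimately show ?thesis
      using normal_tail_mixture(2)[OF s] J0[of "- t"] 3
      by (intro tail_comparison[OF _ mr refl _ _ _ r n C]) auto
  qed
qed

lemma collect_factors:
  fixes a b c e n x :: real
  shows "x * (2 * (a * b / n) + c * b / n) * e = x * (2 * a + c) * (b * e / n)"
  by (simp add: algebra_simps add_divide_distrib)

text \<open>Here n stands for sqrt N. The condition |t|^3 <= M n is the range t = O(N^(1/6)) and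
  bounds R at t; |t| <= \<delta> n / 2 leaves room in the disc for imaginary shifts of t up to
  \<epsilon> n.\<close>

theorem moderate_deviation_bound:
  fixes \<delta> C M :: real
  assumes \<delta>: "\<delta> > 0" and C: "C \<ge> 0" and M: "M \<ge> 0"
  obtains K where "\<And>(A :: 'a set) p Y R n t. finite A \<Longrightarrow> (\<And>i. i \<in> A \<Longrightarrow> p i \<ge> 0) \<Longrightarrow> sum p A = 1 \<Longrightarrow> n \<ge> 1 \<Longrightarrow>
     R 0 = 0 \<Longrightarrow> R holomorphic_on ball 0 (\<delta> * n) \<Longrightarrow>
     (\<And>w. norm w < \<delta> * n \<Longrightarrow> norm (deriv R w) \<le> C * (1 + (norm w)\<^sup>2) / n) \<Longrightarrow>
     (\<And>w. norm w < \<delta> * n \<Longrightarrow> (\<Sum>i\<in>A. of_real (p i) * exp (w * of_real (Y i))) = exp (w\<^sup>2 / 2 + R w)) \<Longrightarrow>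
     \<bar>t\<bar> \<le> \<delta> * n / 2 \<Longrightarrow> \<bar>t\<bar> ^ 3 \<le> M * n \<Longrightarrow>
     \<bar>weighted_cdf A p Y t - cdf std_normal_distribution t\<bar> \<le> K * ((1 + t\<^sup>2) * exp (- (t\<^sup>2 / 2)) / n)"
proof -
  obtain C0 where C0: "C0 \<ge> 0" and BE: "\<And>(A :: 'a set) q y T B x. finite A \<Longrightarrow> (\<And>i. i \<in> A \<Longrightarrow> q i \<ge> 0) \<Longrightarrow> sum q A = 1 \<Longrightarrow>
     T > 0 \<Longrightarrow> B \<ge> 0 \<Longrightarrow>
     (\<And>\<tau>. \<bar>\<tau>\<bar> \<le> T \<Longrightarrow> norm ((\<Sum>i\<in>A. of_real (q i) * iexp (\<tau> * y i)) - char std_normal_distribution \<tau>) \<le> B * \<bar>\<tau>\<bar> / (1 + \<tau>\<^sup>2)) \<Longrightarrow>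
     \<bar>weighted_cdf A q y x - cdf std_normal_distribution x\<bar> \<le> C0 * (B + 1 / T)"
    using Berry_Esseen_smoothing by blast
  \<comment> \<open>The second entry gives C * \<epsilon> <= 1/8 for the absorption of the cubic
    term; the first gives |t| + \<epsilon> n <= 3/4 \<delta> n, inside the domain of R.\<close>
  define \<epsilon> where "\<epsilon> = min (\<delta> / 4) (1 / (8 * (C + 1)))"
  have \<epsilon>: "\<epsilon> > 0" "\<epsilon> \<le> \<delta> / 4" using \<delta> C by (auto simp: \<epsilon>_def)
  have "C * \<epsilon> \<le> C * (1 / (8 * (C + 1)))" using C by (intro mult_left_mono) (auto simp: \<epsilon>_def)
  also have "\<dots> \<le> 1 / 8" using C by (simp add: field_simps)
  finally have C\<epsilon>: "C * \<epsilon> \<le> 1 / 8" .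
  \<comment> \<open>E is the constant of the characteristic function estimate, with 2 + M in place
    of M because 1 + t^2 <= (2 + M) n. Next, \<open>M1\<close> bounds C (|t| + |t|^3) / n, hence the
    real part of R at t, by way of |t| <= 1 + |t|^3.\<close>
  define E where "E = 32 * exp (2 * (C * (2 + M))\<^sup>2) * C"
  define M1 where "M1 = C * (1 + 2 * M)"
  show ?thesis
  proof (rule that[of "exp M1 * (2 * (C0 * (E + 1 / \<epsilon>)) + C)"])
    fix A :: "'a set" and p Y :: "'a \<Rightarrow> real" and R :: "complex \<Rightarrow> complex" and n t :: real
    assume A: "finite A" and p: "\<And>i. i \<in> A \<Longrightarrow> p i \<ge> 0" "sum p A = 1" and n: "n \<ge> 1" and R0: "R 0 = 0"
      and hol: "R holomorphic_on ball 0 (\<delta> * n)"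
      and R': "\<And>w. norm w < \<delta> * n \<Longrightarrow> norm (deriv R w) \<le> C * (1 + (norm w)\<^sup>2) / n"
      and mgf: "\<And>w. norm w < \<delta> * n \<Longrightarrow> (\<Sum>i\<in>A. of_real (p i) * exp (w * of_real (Y i))) = exp (w\<^sup>2 / 2 + R w)"
      and t1: "\<bar>t\<bar> \<le> \<delta> * n / 2" and t3: "\<bar>t\<bar> ^ 3 \<le> M * n"
    have n0: "n > 0" using n by simp
    have pw: "\<bar>t\<bar> \<le> 1 + \<bar>t\<bar> ^ 3" "t\<^sup>2 \<le> 1 + \<bar>t\<bar> ^ 3"
    proof -
      have "\<bar>t\<bar> \<le> 1 + \<bar>t\<bar> ^ 3 \<and> \<bar>t\<bar> ^ 2 \<le> 1 + \<bar>t\<bar> ^ 3"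
      proof (cases "\<bar>t\<bar> \<le> 1")
        case True
        then have "\<bar>t\<bar> ^ 2 \<le> 1" "\<bar>t\<bar> ^ 3 \<ge> 0" by (simp_all only: power_le_one abs_ge_zero zero_le_power)
        then show ?thesis using True by linarith
      next
        case False
        then have "\<bar>t\<bar> ^ 1 \<le> \<bar>t\<bar> ^ 3" "\<bar>t\<bar> ^ 2 \<le> \<bar>t\<bar> ^ 3" by (intro power_increasing; simp)+
        then show ?thesis by simp
      qed
      then show "\<bar>t\<bar> \<le> 1 + \<bar>t\<bar> ^ 3" "t\<^sup>2 \<le> 1 + \<bar>t\<bar> ^ 3" by auto
    qed
    have t2: "1 + t\<^sup>2 \<le> (2 + M) * n" using pw t3 n by (simp add: algebra_simps)
    have d: "\<bar>t\<bar> + \<epsilon> * n < \<delta> * n"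
    proof -
      have "\<epsilon> * n \<le> \<delta> / 4 * n" using \<epsilon> n by (intro mult_right_mono) auto
      moreover have "\<delta> * n > 0" using \<delta> n by simp
      ultimately show ?thesis using t1 by linarith
    qed
    have \<epsilon>n: "\<epsilon> * n > 0" using \<epsilon> n by simp
    have td: "norm (of_real t :: complex) < \<delta> * n" using d \<epsilon>n by simp
    define m where "m = (\<Sum>i\<in>A. p i * exp (t * Y i))"
    have "of_real m = exp ((of_real t)\<^sup>2 / 2 + R (of_real t))"
      using mgf[OF td] unfolding m_def by (simp flip: exp_of_real)
    \<comment> \<open>The value of R at t is complex a priori; taking moduli keeps only its real
      part, which determines m since m is nonnegative.\<close>
    then have "norm (of_real m :: complex) = exp (t\<^sup>2 / 2 + Re (R (of_real t)))" by (simp flip: of_real_power)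
    moreover have "m \<ge> 0" unfolding m_def by (intro sum_nonneg mult_nonneg_nonneg p) auto
    ultimately have mr: "m = exp (t\<^sup>2 / 2 + Re (R (of_real t)))" by simp
    have "norm (R (of_real t) - R 0) \<le> C * (1 + (\<bar>t\<bar>)\<^sup>2) / n * norm (of_real t - 0 :: complex)"
      by (rule Gaussian_error_increment[OF hol R' C n0]) (use td in auto)
    then have r1: "\<bar>Re (R (of_real t))\<bar> \<le> C * (\<bar>t\<bar> * (1 + t\<^sup>2)) / n"
      using abs_Re_le_cmod[of "R (of_real t)"] by (simp add: R0 mult_ac)
    also have "\<dots> \<le> C * ((1 + 2 * M) * n) / n"
    proof -
      have "\<bar>t\<bar> * (1 + t\<^sup>2) = \<bar>t\<bar> + \<bar>t\<bar> ^ 3" by (simp add: algebra_simps eval_nat_numeral)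
      also have "\<dots> \<le> (1 + 2 * M) * n" using pw(1) t3 n by (simp add: algebra_simps)
      finally show ?thesis using C n by (intro divide_right_mono mult_left_mono) auto
    qed
    also have "\<dots> = M1" using n by (simp add: M1_def)
    finally have r2: "\<bar>Re (R (of_real t))\<bar> \<le> M1" .
    have "\<bar>weighted_cdf A (\<lambda>i. p i * exp (t * Y i) / m) (\<lambda>i. Y i - t) x - cdf std_normal_distribution x\<bar>
        \<le> C0 * (E + 1 / \<epsilon>) * (1 + t\<^sup>2) / n" for x
    proof -
      have "\<bar>weighted_cdf A (\<lambda>i. p i * exp (t * Y i) / m) (\<lambda>i. Y i - t) x - cdf std_normal_distribution x\<bar>
        \<le> C0 * (E * (1 + t\<^sup>2) / n + 1 / (\<epsilon> * n))"
      proof (rule BE[OF A])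
        show "sum (\<lambda>i. p i * exp (t * Y i) / m) A = 1"
          unfolding sum_divide_distrib[symmetric] m_def[symmetric] using mr by simp
        show "0 \<le> p i * exp (t * Y i) / m" if "i \<in> A" for i using p(1)[OF that] mr by simp
        show "0 \<le> E * (1 + t\<^sup>2) / n" using C n by (simp add: E_def)
        show "norm ((\<Sum>i\<in>A. of_real (p i * exp (t * Y i) / m) * iexp (\<tau> * (Y i - t))) - char std_normal_distribution \<tau>)
           \<le> E * (1 + t\<^sup>2) / n * \<bar>\<tau>\<bar> / (1 + \<tau>\<^sup>2)" if "\<bar>\<tau>\<bar> \<le> \<epsilon> * n" for \<tau>
          unfolding E_def by (rule tilted_char_bound[OF hol R' mgf n C C\<epsilon> that t2 _ d m_def]) (use M in auto)
      qed (rule \<epsilon>n)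
      also have "\<dots> \<le> C0 * (E * (1 + t\<^sup>2) / n + 1 / (\<epsilon> * n) * (1 + t\<^sup>2))"
        using C0 \<epsilon>n by (intro mult_left_mono add_left_mono) (auto intro: divide_right_mono)
      also have "\<dots> = C0 * (E + 1 / \<epsilon>) * (1 + t\<^sup>2) / n"
        using n0 \<epsilon>(1) by (simp add: field_simps)
      finally show ?thesis .
    qed
    from tail_from_cdf_bound[OF A p m_def mr this r1 r2 n0 C]
    show "\<bar>weighted_cdf A p Y t - cdf std_normal_distribution t\<bar> \<le>
       exp M1 * (2 * (C0 * (E + 1 / \<epsilon>)) + C) * ((1 + t\<^sup>2) * exp (- (t\<^sup>2 / 2)) / n)"
      by (simp only: collect_factors)
  qed
qed

section \<open>Application to the Stern sequence\<close>

lemma block_avg_eq_sum: "block_avg N f = (\<Sum>n\<in>dyadic_block N. f n) / 2 ^ N" for f :: "nat \<Rightarrow> real"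
  by (simp add: block_avg_def divide_inverse mult.commute)

lemma unif_block_expectation: "measure_pmf.expectation (unif_block N) f = block_avg N f" for f :: "nat \<Rightarrow> real"
  unfolding unif_block_def block_avg_eq_sum
  by (subst integral_pmf_of_set) (auto simp: finite_dyadic_block dyadic_block_nonempty card_dyadic_block)

lemma unif_block_variance:
  "measure_pmf.variance (unif_block N) f = block_avg N (\<lambda>n. (f n)\<^sup>2) - (block_avg N f)\<^sup>2" for f :: "nat \<Rightarrow> real"
proof -
  have "finite (set_pmf (unif_block N))"
    unfolding unif_block_def by (simp add: finite_dyadic_block dyadic_block_nonempty)
  then show ?thesis
    by (subst measure_pmf.variance_eq) (auto simp: unif_block_expectation intro: integrable_measure_pmf_finite)
qed

lemma unif_block_prob:
  "measure_pmf.prob (unif_block N) {n. Y n \<le> t} = weighted_cdf (dyadic_block N) (\<lambda>_. 1 / 2 ^ N) Y t"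
proof -
  have "measure_pmf.prob (unif_block N) {n. Y n \<le> t} = real (card (dyadic_block N \<inter> {n. Y n \<le> t})) / 2 ^ N"
    unfolding unif_block_def
    by (subst measure_pmf_of_set) (auto simp: finite_dyadic_block dyadic_block_nonempty card_dyadic_block)
  then show ?thesis
    by (simp add: weighted_cdf_def finite_dyadic_block sum_divide_distrib[symmetric] Int_def of_bool_def sum.If_cases)
qed

lemma sqrt_of_powr_sixth:
  assumes "N \<ge> 1"
  defines "x \<equiv> real N powr (1 / 6)"
  shows "x \<ge> 1" "x ^ 3 = sqrt (real N)"
proof -
  show "x \<ge> 1" using assms by (simp add: ge_one_powr_ge_zero)
  then have "x ^ 3 = x powr 3" by (simp add: powr_numeral)
  also have "\<dots> = real N powr (1 / 6 * 3)" unfolding x_def powr_powr ..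
  finally have "x ^ 3 = real N powr (1 / 6 * 3)" .
  then show "x ^ 3 = sqrt (real N)" by (simp add: powr_half_sqrt)
qed

text \<open>R is the cumulant function at u = w / (\<sigma> n) with the centring and the quadratic
  term removed. Its derivative splits into the bounded error of the mean, the bounded error of the
  variance times u, and a Taylor remainder of size N |u|^2; division by \<sigma> n turns all of them
  into O((1 + |w|^2) / n).\<close>

lemma standardised_mgf:
  fixes l \<sigma> :: real
  assumes \<sigma>: "\<sigma> > 0" and N: "N \<ge> 1"
    and mean: "\<And>N. \<bar>block_avg N log_stern - l * real N\<bar> \<le> B\<^sub>1"
    and var: "\<And>N. \<bar>block_avg N (\<lambda>n. (log_stern n)\<^sup>2) - (block_avg N log_stern)\<^sup>2 - \<sigma>\<^sup>2 * real N\<bar> \<le> B\<^sub>2"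
    and Taylor: "\<And>N u. norm u \<le> 1 / 8000 \<Longrightarrow>
      norm (deriv (cumulant_gf N) u - deriv (cumulant_gf N) 0 - (deriv ^^ 2) (cumulant_gf N) 0 * u) \<le> C * real N * (norm u)\<^sup>2"
    and C: "C \<ge> 0"
  defines "n \<equiv> sqrt (real N)" and "Y \<equiv> \<lambda>k. (log_stern k - l * real N) / (\<sigma> * sqrt (real N))"
  obtains R where "R 0 = 0" "R holomorphic_on ball 0 (\<sigma> / 8000 * n)"
    "\<And>w. norm w < \<sigma> / 8000 * n \<Longrightarrow> norm (deriv R w) \<le> ((B\<^sub>1 + B\<^sub>2 + C / \<sigma>\<^sup>2) / \<sigma>) * (1 + (norm w)\<^sup>2) / n"
    "\<And>w. norm w < \<sigma> / 8000 * n \<Longrightarrow>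
       (\<Sum>k\<in>dyadic_block N. of_real (1 / 2 ^ N) * exp (w * of_real (Y k))) = exp (w\<^sup>2 / 2 + R w)"
proof -
  have n: "n > 0" "n\<^sup>2 = real N" using N by (auto simp: n_def)
  define c where "c = \<sigma> * n"
  have c: "c > 0" using \<sigma> n by (simp add: c_def)
  let ?K = "cumulant_gf N" and ?\<rho> = "\<sigma> / 8000 * n"
  define R where "R w = ?K (w / of_real c) - w * of_real (l * n / \<sigma>) - w\<^sup>2 / 2" for w
  have small: "norm (w / of_real c) < 1 / 8000" if "norm w < ?\<rho>" for w :: complex
  proof -
    have "norm (w / of_real c) = norm w / c" using c by (simp add: norm_divide)
    then show ?thesis using that c by (simp add: c_def field_simps)
  qed
  have B: "B\<^sub>1 \<ge> 0" "B\<^sub>2 \<ge> 0" using mean[of N] var[of N] by linarith+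
  have dK: "(?K has_field_derivative deriv ?K u) (at u)" if "norm u < 1 / 8000" for u
    using that by (intro holomorphic_derivI[OF cumulant_gf_holomorphic open_ball]) auto
  have dR: "(R has_field_derivative deriv ?K (w / of_real c) / of_real c - of_real (l * n / \<sigma>) - w) (at w)"
    if w: "norm w < ?\<rho>" for w
  proof -
    have "((\<lambda>w. ?K (w / of_real c)) has_field_derivative deriv ?K (w / of_real c) * (1 / of_real c)) (at w)"
      by (rule DERIV_chain2[where f = ?K and g = "\<lambda>w. w / of_real c", OF dK[OF small[OF w]]]) (rule DERIV_cdivide[OF DERIV_ident])
    then show ?thesis unfolding R_def[abs_def]
      using \<sigma> by (auto intro!: derivative_eq_intros)
  qed
  show ?thesis
  proof (rule that[of R])
    show "R 0 = 0" by (simp add: R_def cumulant_gf_0)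
    show "R holomorphic_on ball 0 ?\<rho>"
      using dR by (intro holomorphic_onI) (auto simp: field_differentiable_def intro: has_field_derivative_at_within)
    fix w :: complex assume w: "norm w < ?\<rho>"
    define u where "u = w / of_real c"
    have u: "norm u \<le> 1 / 8000" using small[OF w] by (simp add: u_def)
    have wu: "w = of_real c * u" using c by (simp add: u_def)
    have "deriv R w = deriv ?K u / of_real c - of_real (l * n / \<sigma>) - w"
      using DERIV_imp_deriv[OF dR[OF w]] by (simp add: u_def)
    also have "\<dots> = (deriv ?K u - of_real (l * real N) - of_real (\<sigma>\<^sup>2 * real N) * u) / of_real c"
    proof -
      have "of_real (l * real N) / of_real c = (of_real (l * n / \<sigma>) :: complex)"
        unfolding n(2)[symmetric] c_def of_real_divide[symmetric]
        using n(1) \<sigma> by (intro arg_cong[where f = of_real]) (simp add: power2_eq_square)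
      moreover have "of_real (\<sigma>\<^sup>2 * real N) * u / of_real c = w"
        unfolding n(2)[symmetric] wu c_def using n(1) \<sigma> by (simp add: power2_eq_square)
      ultimately show ?thesis by (simp add: diff_divide_distrib)
    qed
    also have "norm \<dots> = norm (deriv ?K u - of_real (l * real N) - of_real (\<sigma>\<^sup>2 * real N) * u) / c"
      using c by (simp add: norm_divide)
    also have "\<dots> \<le> (B\<^sub>1 + B\<^sub>2 + C / \<sigma>\<^sup>2 * (norm w)\<^sup>2) / c"
    proof -
      let ?m = "block_avg N log_stern" and ?v = "block_avg N (\<lambda>n. (log_stern n)\<^sup>2) - (block_avg N log_stern)\<^sup>2"
      have "deriv ?K u - of_real (l * real N) - of_real (\<sigma>\<^sup>2 * real N) * u =
         of_real (?m - l * real N) + of_real (?v - \<sigma>\<^sup>2 * real N) * u +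
         (deriv ?K u - deriv ?K 0 - (deriv ^^ 2) ?K 0 * u)"
        unfolding cumulant_gf_derivs_0 by (simp add: algebra_simps)
      also have "norm \<dots> \<le> norm (of_real (?m - l * real N) :: complex) + norm (of_real (?v - \<sigma>\<^sup>2 * real N) * u) +
         norm (deriv ?K u - deriv ?K 0 - (deriv ^^ 2) ?K 0 * u)"
        by (intro order_trans[OF norm_triangle_ineq] add_right_mono norm_triangle_ineq)
      also have "\<dots> \<le> B\<^sub>1 + B\<^sub>2 * 1 + C * real N * (norm u)\<^sup>2"
        unfolding norm_mult norm_of_real
        by (intro add_mono mean Taylor mult_mono var) (use u B in auto)
      also have "C * real N * (norm u)\<^sup>2 = C / \<sigma>\<^sup>2 * (norm w)\<^sup>2"
        unfolding n(2)[symmetric] wu c_def using n \<sigma> by (simp add: norm_mult power_mult_distrib)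
      finally show ?thesis using c by (intro divide_right_mono) auto
    qed
    also have "\<dots> \<le> (B\<^sub>1 + B\<^sub>2 + C / \<sigma>\<^sup>2) * (1 + (norm w)\<^sup>2) / c"
      using B C c mult_nonneg_nonneg[OF _ zero_le_power2[of "norm w"], of "B\<^sub>1 + B\<^sub>2"]
      by (intro divide_right_mono) (auto simp: algebra_simps)
    finally show "norm (deriv R w) \<le> ((B\<^sub>1 + B\<^sub>2 + C / \<sigma>\<^sup>2) / \<sigma>) * (1 + (norm w)\<^sup>2) / n"
      by (simp add: c_def)
  next
    fix w :: complex assume w: "norm w < ?\<rho>"
    define u where "u = w / of_real c"
    have u: "norm u \<le> 1 / 4000" using small[OF w] by (simp add: u_def)
    have shift: "u * of_real (l * real N) = w * of_real (l * n / \<sigma>)"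
      unfolding u_def n(2)[symmetric] c_def using n(1) \<sigma> by (simp add: power2_eq_square)
    have "exp (w * of_real (Y k)) = exp (u * of_real (log_stern k)) * exp (- (w * of_real (l * n / \<sigma>)))" for k
    proof -
      have "w * of_real (Y k) = u * of_real (log_stern k) - u * of_real (l * real N)"
        unfolding Y_def n_def[symmetric] u_def c_def using n \<sigma> by (simp add: field_simps)
      then show ?thesis unfolding shift by (simp add: exp_add[symmetric])
    qed
    then have "(\<Sum>k\<in>dyadic_block N. of_real (1 / 2 ^ N) * exp (w * of_real (Y k))) =
       block_avg N (\<lambda>k. exp (u * of_real (log_stern k))) * exp (- (w * of_real (l * n / \<sigma>)))"
      by (simp add: block_avg_def scaleR_conv_of_real sum_distrib_left sum_distrib_right field_simps)
    also have "\<dots> = exp (w\<^sup>2 / 2 + R w)"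
      unfolding exp_cumulant_gf[OF u, symmetric] exp_add[symmetric] by (simp add: R_def u_def)
    finally show "(\<Sum>k\<in>dyadic_block N. of_real (1 / 2 ^ N) * exp (w * of_real (Y k))) = exp (w\<^sup>2 / 2 + R w)" .
  qed
qed

lemma stern_moderate_deviations:
  fixes l \<sigma> C :: real
  assumes \<sigma>: "\<sigma> > 0" and C: "C > 0"
    and mean: "\<And>N. \<bar>block_avg N log_stern - l * real N\<bar> \<le> B\<^sub>1"
    and var: "\<And>N. \<bar>block_avg N (\<lambda>n. (log_stern n)\<^sup>2) - (block_avg N log_stern)\<^sup>2 - \<sigma>\<^sup>2 * real N\<bar> \<le> B\<^sub>2"
  shows "\<exists>K. \<forall>N t. N \<ge> 1 \<longrightarrow> \<bar>t\<bar> \<le> C * real N powr (1 / 6) \<longrightarrow>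
    \<bar>weighted_cdf (dyadic_block N) (\<lambda>_. 1 / 2 ^ N) (\<lambda>k. (log_stern k - l * real N) / (\<sigma> * sqrt (real N))) t
       - cdf std_normal_distribution t\<bar> \<le> K * ((1 + t\<^sup>2) * exp (- (t\<^sup>2 / 2)) / sqrt (real N))"
proof -
  interpret N: real_distribution std_normal_distribution by (rule real_dist_normal_dist)
  obtain C\<^sub>3 where C3: "C\<^sub>3 \<ge> 0" and Taylor: "\<And>N u. norm u \<le> 1 / 8000 \<Longrightarrow>
    norm (deriv (cumulant_gf N) u - deriv (cumulant_gf N) 0 - (deriv ^^ 2) (cumulant_gf N) 0 * u) \<le> C\<^sub>3 * real N * (norm u)\<^sup>2"
    using cumulant_gf_Taylor by blast
  define \<delta> where "\<delta> = \<sigma> / 8000"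
  define C\<^sub>1 where "C\<^sub>1 = (B\<^sub>1 + B\<^sub>2 + C\<^sub>3 / \<sigma>\<^sup>2) / \<sigma>"
  have \<delta>: "\<delta> > 0" using \<sigma> by (simp add: \<delta>_def)
  have "B\<^sub>1 \<ge> 0" "B\<^sub>2 \<ge> 0" using mean[of 0] var[of 0] by linarith+
  then have C1: "C\<^sub>1 \<ge> 0" using C3 \<sigma> by (simp add: C\<^sub>1_def)
  have C_cubed: "C ^ 3 \<ge> 0" using C by simp
  obtain K where K: "\<And>(A :: nat set) p Y R n t. finite A \<Longrightarrow> (\<And>i. i \<in> A \<Longrightarrow> p i \<ge> 0) \<Longrightarrow> sum p A = 1 \<Longrightarrow> n \<ge> 1 \<Longrightarrow>
     R 0 = 0 \<Longrightarrow> R holomorphic_on ball 0 (\<delta> * n) \<Longrightarrow>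
     (\<And>w. norm w < \<delta> * n \<Longrightarrow> norm (deriv R w) \<le> C\<^sub>1 * (1 + (norm w)\<^sup>2) / n) \<Longrightarrow>
     (\<And>w. norm w < \<delta> * n \<Longrightarrow> (\<Sum>i\<in>A. of_real (p i) * exp (w * of_real (Y i))) = exp (w\<^sup>2 / 2 + R w)) \<Longrightarrow>
     \<bar>t\<bar> \<le> \<delta> * n / 2 \<Longrightarrow> \<bar>t\<bar> ^ 3 \<le> C ^ 3 * n \<Longrightarrow>
     \<bar>weighted_cdf A p Y t - cdf std_normal_distribution t\<bar> \<le> K * ((1 + t\<^sup>2) * exp (- (t\<^sup>2 / 2)) / n)"
    using moderate_deviation_bound[OF \<delta> C1 C_cubed] by blast
  \<comment> \<open>If |t| > \<delta> n / 2 while |t| <= C x, where x = N^(1/6) and n = x^3, then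
    x^2 < a. So n and t are bounded, and \<open>K'\<close> is chosen to make \<open>K'\<close> times
    the error term at least 1, the trivial bound.\<close>
  define a where "a = 2 * C / \<delta>"
  have a: "a > 0" using C \<delta> by (simp add: a_def)
  define K' where "K' = a ^ 3 * exp ((C * a)\<^sup>2 / 2)"
  have K'0: "K' \<ge> 0" using a by (simp add: K'_def)
  show ?thesis
  proof (intro exI[of _ "\<bar>K\<bar> + K'"] allI impI)
    fix N :: nat and t :: real
    assume N: "N \<ge> 1" and t: "\<bar>t\<bar> \<le> C * real N powr (1 / 6)"
    define n where "n = sqrt (real N)"
    define x where "x = real N powr (1 / 6)"
    have x: "x \<ge> 1" "x ^ 3 = n" using sqrt_of_powr_sixth[OF N] by (simp_all add: x_def n_def)
    have n: "n \<ge> 1" using N by (simp add: n_def)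
    have tx: "\<bar>t\<bar> \<le> C * x" using t by (simp add: x_def)
    let ?Y = "\<lambda>k. (log_stern k - l * real N) / (\<sigma> * sqrt (real N))"
    let ?W = "weighted_cdf (dyadic_block N) (\<lambda>_. 1 / 2 ^ N) ?Y t"
    let ?G = "(1 + t\<^sup>2) * exp (- (t\<^sup>2 / 2)) / n"
    have G0: "?G \<ge> 0" using n by simp
    have prob: "sum (\<lambda>_. 1 / 2 ^ N) (dyadic_block N) = (1 :: real)" by (simp add: card_dyadic_block)
    have "\<bar>?W - cdf std_normal_distribution t\<bar> \<le> (\<bar>K\<bar> + K') * ?G"
    proof (cases "\<bar>t\<bar> \<le> \<delta> * n / 2")
      case True
      obtain R where R: "R 0 = 0" "R holomorphic_on ball 0 (\<delta> * n)"
        "\<And>w. norm w < \<delta> * n \<Longrightarrow> norm (deriv R w) \<le> C\<^sub>1 * (1 + (norm w)\<^sup>2) / n"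
        "\<And>w. norm w < \<delta> * n \<Longrightarrow> (\<Sum>k\<in>dyadic_block N. of_real (1 / 2 ^ N) * exp (w * of_real (?Y k))) = exp (w\<^sup>2 / 2 + R w)"
        using standardised_mgf[OF \<sigma> N mean var Taylor C3] unfolding \<delta>_def C\<^sub>1_def n_def by blast
      have "\<bar>t\<bar> ^ 3 \<le> (C * x) ^ 3" by (intro power_mono tx) auto
      then have "\<bar>t\<bar> ^ 3 \<le> C ^ 3 * n" by (simp add: power_mult_distrib x)
      then have "\<bar>?W - cdf std_normal_distribution t\<bar> \<le> K * ?G"
        by (intro K[OF finite_dyadic_block _ prob n R True]) auto
      also have "\<dots> \<le> (\<bar>K\<bar> + K') * ?G" using K'0 by (intro mult_right_mono G0) auto
      finally show ?thesis .
    next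
      case False
      then have "\<delta> * n / 2 < C * x" using tx by linarith
      then have "\<delta> * x ^ 3 / 2 < C * x" unfolding x(2) .
      then have "x * (\<delta> * x\<^sup>2) < x * (2 * C)" by (simp add: eval_nat_numeral mult_ac)
      then have "\<delta> * x\<^sup>2 < 2 * C" using x by (simp add: mult_less_cancel_left)
      then have "x\<^sup>2 < a" using \<delta> by (simp add: a_def field_simps)
      moreover have "x \<le> x\<^sup>2" using x by (simp add: power2_eq_square)
      ultimately have xa: "x \<le> a" by linarith
      have na: "n \<le> a ^ 3" unfolding x(2)[symmetric] using xa x by (intro power_mono) auto
      have "\<bar>t\<bar> \<le> C * a" using tx xa C by (meson mult_left_mono less_imp_le order_trans)
      then have "t\<^sup>2 \<le> (C * a)\<^sup>2" by (simp add: abs_le_square_iff[symmetric] abs_of_pos a C)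
      have "\<bar>?W - cdf std_normal_distribution t\<bar> \<le> 1"
        using weighted_cdf_bounds[of "dyadic_block N" "\<lambda>_. 1 / 2 ^ N" ?Y t, OF _ prob]
          N.cdf_nonneg[of t] N.cdf_bounded_prob[of t] by auto
      also have "1 \<le> K' * ?G"
      proof -
        have "1 * 1 * 1 \<le> (a ^ 3 / n) * (1 + t\<^sup>2) * (exp ((C * a)\<^sup>2 / 2) * exp (- (t\<^sup>2 / 2)))"
          using na n \<open>t\<^sup>2 \<le> (C * a)\<^sup>2\<close>
          by (intro mult_mono) (use a in \<open>auto simp flip: exp_add intro!: divide_nonneg_pos mult_nonneg_nonneg\<close>)
        then show ?thesis by (simp add: K'_def mult_ac)
      qed
      also have "\<dots> \<le> (\<bar>K\<bar> + K') * ?G" by (intro mult_right_mono G0) auto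
      finally show ?thesis .
    qed
    then show "\<bar>?W - cdf std_normal_distribution t\<bar> \<le> (\<bar>K\<bar> + K') * ((1 + t\<^sup>2) * exp (- (t\<^sup>2 / 2)) / sqrt (real N))"
      by (simp only: n_def)
  qed
qed

theorem theorem1p1:
  shows "\<exists>\<alpha> \<sigma> :: real. \<alpha> > 0 \<and> \<sigma> > 0 \<and>
    (\<forall>C > 0. \<exists>K :: real. \<forall>N :: nat. \<forall>t :: real.
       N \<ge> 1 \<longrightarrow> \<bar>t\<bar> \<le> C * real N powr (1 / 6) \<longrightarrow>
       \<bar>measure_pmf.prob (unif_block N)
           {n. (log_stern n - \<alpha> * real N) / (\<sigma> * sqrt (real N)) \<le> t}
         - (LBINT v:{..t}. exp (- (v\<^sup>2 / 2)) / sqrt (2 * pi))\<bar>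
       \<le> K * ((1 + t\<^sup>2) * exp (- (t\<^sup>2 / 2)) / sqrt (real N))) \<and>
    (\<exists>(\<nu>\<^sub>1 :: real) (\<nu>\<^sub>2 :: real) (\<theta> :: real). 0 \<le> \<theta> \<and> \<theta> < 1 \<and>
       (\<lambda>N. measure_pmf.expectation (unif_block N) log_stern - (\<alpha> * real N + \<nu>\<^sub>1))
         \<in> O(\<lambda>N. \<theta> ^ N) \<and>
       (\<lambda>N. measure_pmf.variance (unif_block N) log_stern - (\<sigma>\<^sup>2 * real N + \<nu>\<^sub>2))
         \<in> O(\<lambda>N. real N * \<theta> ^ N))"
proof -
  obtain l s v D w E where ls: "l > 0" "s > 0"
    and mean: "\<And>N. \<bar>block_avg N log_stern - (l * real N + v)\<bar> \<le> D * (3 / 4) ^ N"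
    and var: "\<And>N. \<bar>block_avg N (\<lambda>n. (log_stern n)\<^sup>2) - (block_avg N log_stern)\<^sup>2 - (s * real N + w)\<bar> \<le> E * (3 / 4) ^ N"
    by (rule stern_log_moments, rule that)
  define \<sigma> where "\<sigma> = sqrt s"
  have \<sigma>: "\<sigma> > 0" "\<sigma>\<^sup>2 = s" using ls by (simp_all add: \<sigma>_def)
  have q: "X * (3 / 4) ^ N \<le> \<bar>X\<bar>" for X :: real and N
    using mult_mono[of X "\<bar>X\<bar>" "(3 / 4) ^ N" 1] by (simp add: power_le_one)
  \<comment> \<open>For the limit law, the constant and the exponentially small term merge into one
    bounded error.\<close>
  have mean': "\<bar>block_avg N log_stern - l * real N\<bar> \<le> \<bar>v\<bar> + \<bar>D\<bar>" for N
    using mean[of N] q[of D N] by linarith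
  have var': "\<bar>block_avg N (\<lambda>n. (log_stern n)\<^sup>2) - (block_avg N log_stern)\<^sup>2 - \<sigma>\<^sup>2 * real N\<bar> \<le> \<bar>w\<bar> + \<bar>E\<bar>" for N
    using var[of N] q[of E N] unfolding \<sigma>(2) by linarith
  have clt: "\<exists>K. \<forall>N t. N \<ge> 1 \<longrightarrow> \<bar>t\<bar> \<le> C * real N powr (1 / 6) \<longrightarrow>
    \<bar>measure_pmf.prob (unif_block N) {n. (log_stern n - l * real N) / (\<sigma> * sqrt (real N)) \<le> t}
       - (LBINT v:{..t}. exp (- (v\<^sup>2 / 2)) / sqrt (2 * pi))\<bar> \<le> K * ((1 + t\<^sup>2) * exp (- (t\<^sup>2 / 2)) / sqrt (real N))"
    if "C > 0" for C
    unfolding unif_block_prob std_normal_cdf_LBINT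
    by (rule stern_moderate_deviations[OF \<sigma>(1) that mean' var'])
  have E1: "(\<lambda>N. measure_pmf.expectation (unif_block N) log_stern - (l * real N + v)) \<in> O(\<lambda>N. (3 / 4) ^ N)"
    by (rule bigoI[of _ D]) (simp add: unif_block_expectation mean)
  have "(\<lambda>N. measure_pmf.variance (unif_block N) log_stern - (\<sigma>\<^sup>2 * real N + w)) \<in> O(\<lambda>N. (3 / 4) ^ N)"
    by (rule bigoI[of _ E]) (simp add: unif_block_variance \<sigma>(2) var)
  \<comment> \<open>The factor N vanishes at N = 0, so the comparison starts at N = 1.\<close>
  also have "(\<lambda>N. (3 / 4) ^ N) \<in> O(\<lambda>N. real N * (3 / 4) ^ N)"
    by (rule bigoI[of _ 1], rule eventually_sequentiallyI[of 1]) (simp add: abs_mult)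
  finally have V1: "(\<lambda>N. measure_pmf.variance (unif_block N) log_stern - (\<sigma>\<^sup>2 * real N + w)) \<in> O(\<lambda>N. real N * (3 / 4) ^ N)" .
  have moments: "\<exists>(\<nu>\<^sub>1 :: real) (\<nu>\<^sub>2 :: real) (\<theta> :: real). 0 \<le> \<theta> \<and> \<theta> < 1 \<and>
       (\<lambda>N. measure_pmf.expectation (unif_block N) log_stern - (l * real N + \<nu>\<^sub>1)) \<in> O(\<lambda>N. \<theta> ^ N) \<and>
       (\<lambda>N. measure_pmf.variance (unif_block N) log_stern - (\<sigma>\<^sup>2 * real N + \<nu>\<^sub>2)) \<in> O(\<lambda>N. real N * \<theta> ^ N)"
    by (rule exI[of _ v], rule exI[of _ w], rule exI[of _ "3 / 4"], intro conjI E1 V1) simp_all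
  show ?thesis
    by (rule exI[of _ l], rule exI[of _ \<sigma>], intro conjI allI impI ls(1) \<sigma>(1) clt moments)
qed

end
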